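(* Let $\gamma\in(0,1)$, $\lambda\ge 0$, $K_\gamma>0$, $T>0$, $a<b$, let $p\in\mathbb{C}$ with $\mathrm{Re}(p)>0$, and let $U:[a,b]\to[0,\infty)$ be bounded. Let $G_{x_0}(p,t)$, $(x_0,t)\in[a,b]\times[0,T]$, be the exact solution of $$e^{-(\lambda+pU(x_0))t}\,{}_0^CD_t^{\gamma}\left(e^{(\lambda+pU(x_0))t}G_{x_0}(p,t)\right)-\lambda^{\gamma}G_{x_0}(p,t)=K_{\gamma}\frac{\partial^2}{\partial x_0^2}G_{x_0}(p,t)+f(x_0,p,t)$$ with $G_{x_0}(p,0)=0$ and $G_a(p,t)=G_b(p,t)=0$, and assume $G$ satisfies the regularity assumptions (R) listed in the context. For integers $M\ge2$, $N\ge1$, put $h=\frac{b-a}{M}$, $\tau=\frac TN$, $x_{0,m}=a+mh$, $t_n=n\tau$, and let $G_h^0=0$ and $G_h^1,\dots,G_h^N\in\mathbb{C}^{M-1}$ be the solution of the finite difference scheme $$\sum_{k=0}^n \frac{d_k^{(\gamma,\lambda)}}{\tau^{\gamma}}\,\mathrm{M}_k\, G_h^{n-k}=K_{\gamma}\,\mathrm{H}\,G_h^n+F^n,\qquad n=1,\dots,N,$$ where $F^n=(f(x_{0,1},p,t_n),\dots,f(x_{0,M-1},p,t_n))^T$. Let $E_h^n=\left(G_{x_{0,1}}(p,t_n),\dots,G_{x_{0,M-1}}(p,t_n)\right)^T-G_h^n$. Then there are constants $c_1,c_2>0$ independent of $\tau$ and $h$ (i.e. of $N$ and $M$) such that $$\left\||E_h|\right\|_{0^\prime,h,\infty}<c_1\left(\tau+h^2\right),\qquad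 \left\||E_h|\right\|_{0,h,1}<c_2\left(\tau+h^2\right).$$
   Context: Caputo derivative: ${}_0^CD_t^\gamma v(t)=\frac{1}{\Gamma(1-\gamma)}\int_0^t(t-\xi)^{-\gamma}v'(\xi)\,d\xi$. Coefficients: $g_k^{(\gamma)}$ are defined by $\sum_{k=0}^\infty g_k^{(\gamma)}z^k=(1-z)^\gamma$; $g_k^{(\gamma,\lambda)}=e^{-k\lambda\tau}g_k^{(\gamma)}$; $d_0^{(\gamma,\lambda)}=1-e^{-\gamma\lambda\tau}(\lambda\tau)^\gamma$ and $d_k^{(\gamma,\lambda)}=g_k^{(\gamma,\lambda)}$ for $k\ge1$. Matrices of size $(M-1)\times(M-1)$: $\mathrm{M}_k=\mathrm{diag}\left(e^{-pU(x_{0,1})k\tau},\dots,e^{-pU(x_{0,M-1})k\tau}\right)$, $\mathrm{H}=\frac{1}{h^2}\mathrm{tridiag}(1,-2,1)$. Norms: for $v^n=(v_1^n,\dots,v_{M-1}^n)\in\mathbb{C}^{M-1}$, extended by $v_0^n=v_M^n=0$, put $\|v^n\|_{h,\infty}=\max_{1\le m\le M-1}|v_m^n|$ and $|v^n|_{h,1}=\left(h\sum_{m=1}^M\left|\frac{v_m^n-v_{m-1}^n}{h}\right|^2\right)^{1/2}$. For $v=(v^1,\dots,v^N)$ put $\||v|\|_{0,h,1}=\left(\sum_{n=1}^N|v^n|_{h,1}^2\,\tau\right)^{1/2}$ and $\||v|\|_{0',h,\infty}=\sum_{n=1}^N\|v^n\|_{h,\infty}\,\tau$. Function class: $\mathscr{S}^{1+\gamma}(\mathbb{R})=\left\{v\in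 L^1(\mathbb{R}):\int_{\mathbb{R}}(1+|\omega|)^{1+\gamma}|\mathscr{F}[v](\omega)|\,d\omega<\infty\right\}$, where $\mathscr{F}[v](\omega)=\int_{\mathbb{R}}e^{-i\omega t}v(t)\,dt$. Regularity assumptions (R): $G_{x_0}(p,\cdot)$ is $C^1$ on $[0,T]$ for each $x_0$; for each $t$ the function $x_0\mapsto G_{x_0}(p,t)$ is in $C^4([a,b])$ with $\partial_{x_0}^4G_{x_0}(p,t)$ bounded uniformly in $t\in[0,T]$; and for each $x_0\in[a,b]$ the function $t\mapsto e^{(\lambda+pU(x_0))t}G_{x_0}(p,t)$ on $[0,T]$ extends to a function $v_{x_0}\in\mathscr{S}^{1+\gamma}(\mathbb{R})$ vanishing for $t\le0$, with $\int_{\mathbb{R}}(1+|\omega|)^{1+\gamma}|\mathscr{F}[v_{x_0}](\omega)|\,d\omega$ bounded uniformly in $x_0$. The constants $c_1,c_2$ may depend on $\gamma,\lambda,K_\gamma,T,a,b,p,U$ and $G$. *)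

theory Defs
  imports "HOL-Analysis.Analysis" "Jordan_Normal_Form.Matrix"
begin

unbundle no vec_syntax
hide_const (open) Finite_Cartesian_Product.vec Finite_Cartesian_Product.mat


section \<open>Derivatives on intervals\<close>

(* One-sided at the end points of the interval; outside the interval the function may be arbitrary. *)
fun vderiv_on :: "real set \<Rightarrow> nat \<Rightarrow> (real \<Rightarrow> complex) \<Rightarrow> real \<Rightarrow> complex" where
  "vderiv_on S 0 v = v"
| "vderiv_on S (Suc j) v = (\<lambda>x. vector_derivative (vderiv_on S j v) (at x within S))"

definition C_on :: "nat \<Rightarrow> (real \<Rightarrow> complex) \<Rightarrow> real set \<Rightarrow> bool" where
  "C_on k v S \<longleftrightarrow>
     (\<forall>j<k. vderiv_on S j v differentiable_on S) \<and> continuous_on S (vderiv_on S k v)"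

definition caputo :: "real \<Rightarrow> (real \<Rightarrow> complex) \<Rightarrow> real \<Rightarrow> complex" where
  "caputo \<gamma> v t = (1 / Gamma (1 - \<gamma>)) *\<^sub>R
     (LINT \<xi>:{0..t}|lborel. (t - \<xi>) powr (-\<gamma>) *\<^sub>R vderiv_on {0..t} 1 v \<xi>)"


section \<open>The function class\<close>

definition fourier :: "(real \<Rightarrow> complex) \<Rightarrow> real \<Rightarrow> complex" where
  "fourier v \<omega> = (LINT t|lborel. exp (- (\<i> * complex_of_real (\<omega> * t))) * v t)"

definition S_weight :: "real \<Rightarrow> (real \<Rightarrow> complex) \<Rightarrow> real \<Rightarrow> real" where
  "S_weight \<gamma> v \<omega> = (1 + \<bar>\<omega>\<bar>) powr (1 + \<gamma>) * cmod (fourier v \<omega>)"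

(* The parameter is gamma; the regularity exponent is 1 + gamma. *)
definition S_class :: "real \<Rightarrow> (real \<Rightarrow> complex) set" where
  "S_class \<gamma> = {v. integrable lborel v \<and> integrable lborel (S_weight \<gamma> v)}"


section \<open>The continuous problem\<close>

(* For lam = 0 the term lam powr gamma is 0, as intended. *)
definition exact_solution ::
  "real \<Rightarrow> real \<Rightarrow> real \<Rightarrow> real \<Rightarrow> real \<Rightarrow> real \<Rightarrow> complex \<Rightarrow> (real \<Rightarrow> real) \<Rightarrow>
   (real \<Rightarrow> complex \<Rightarrow> real \<Rightarrow> complex) \<Rightarrow> (real \<Rightarrow> complex \<Rightarrow> real \<Rightarrow> complex) \<Rightarrow> bool" where
  "exact_solution \<gamma> lam K T a b p U f G \<longleftrightarrow>
     (\<forall>x\<in>{a<..<b}. \<forall>t\<in>{0<..T}.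
        exp (- ((complex_of_real lam + p * complex_of_real (U x)) * complex_of_real t)) *
            caputo \<gamma> (\<lambda>s. exp ((complex_of_real lam + p * complex_of_real (U x)) * complex_of_real s) * G x p s) t
          - complex_of_real (lam powr \<gamma>) * G x p t
        = complex_of_real K * vderiv_on {a..b} 2 (\<lambda>y. G y p t) x + f x p t) \<and>
     (\<forall>x\<in>{a..b}. G x p 0 = 0) \<and>
     (\<forall>t\<in>{0..T}. G a p t = 0 \<and> G b p t = 0)"

definition regular ::
  "real \<Rightarrow> real \<Rightarrow> real \<Rightarrow> real \<Rightarrow> real \<Rightarrow> complex \<Rightarrow> (real \<Rightarrow> real) \<Rightarrow>
   (real \<Rightarrow> complex \<Rightarrow> real \<Rightarrow> complex) \<Rightarrow> bool" where
  "regular \<gamma> lam T a b p U G \<longleftrightarrow>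
     (\<forall>x\<in>{a..b}. C_on 1 (\<lambda>t. G x p t) {0..T}) \<and>
     (\<forall>t\<in>{0..T}. C_on 4 (\<lambda>x. G x p t) {a..b}) \<and>
     (\<exists>B. \<forall>t\<in>{0..T}. \<forall>x\<in>{a..b}. cmod (vderiv_on {a..b} 4 (\<lambda>y. G y p t) x) \<le> B) \<and>
     (\<exists>v B. \<forall>x\<in>{a..b}.
        v x \<in> S_class \<gamma> \<and>
        (\<forall>t\<in>{0..T}. v x t = exp ((complex_of_real lam + p * complex_of_real (U x)) * complex_of_real t) * G x p t) \<and>
        (\<forall>t\<le>0. v x t = 0) \<and>
        (LINT \<omega>|lborel. S_weight \<gamma> (v x) \<omega>) \<le> B)"


section \<open>The finite difference scheme\<close>

definition g_coeff :: "real \<Rightarrow> nat \<Rightarrow> real" where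
  "g_coeff \<gamma> = (THE c. \<forall>z. \<bar>z\<bar> < 1 \<longrightarrow> (\<lambda>k. c k * z ^ k) sums ((1 - z) powr \<gamma>))"

lemma g_coeff_eq: "g_coeff \<gamma> k = (-1) ^ k * (\<gamma> gchoose k)"
  and g_coeff_sums: "\<bar>z\<bar> < 1 \<Longrightarrow> (\<lambda>k. g_coeff \<gamma> k * z ^ k) sums ((1 - z) powr \<gamma>)"
proof -
  let ?P = "\<lambda>c :: nat \<Rightarrow> real. \<forall>z. \<bar>z\<bar> < 1 \<longrightarrow> (\<lambda>k. c k * z ^ k) sums ((1 - z) powr \<gamma>)"
  let ?c = "\<lambda>k. (-1) ^ k * (\<gamma> gchoose k)"
  have ex: "?P ?c"
  proof (intro allI impI)
    fix z :: real assume "\<bar>z\<bar> < 1"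
    then have "(\<lambda>k. (\<gamma> gchoose k) * (-z) ^ k) sums (1 + (-z)) powr \<gamma>"
      by (intro gen_binomial_real) auto
    moreover have "(\<gamma> gchoose k) * (-z) ^ k = ?c k * z ^ k" for k
      by (metis (no_types) mult.assoc mult.commute power_minus)
    ultimately show "(\<lambda>k. ?c k * z ^ k) sums ((1 - z) powr \<gamma>)" by simp
  qed
  have uniq: "c = ?c" if c: "?P c" for c
  proof -
    define e where "e k = c k - ?c k" for k
    have e: "(\<lambda>k. e k * z ^ k) sums 0" if "\<bar>z\<bar> < 1" for z
      using sums_diff[OF c[rule_format, OF that] ex[rule_format, OF that]]
      by (simp add: e_def left_diff_distrib)
    have "e n = 0" for n
    proof (induction n rule: less_induct)
      case (less n)
      have "(\<lambda>k. e (k + n) * z ^ k) sums 0" if z: "z \<noteq> 0" "norm z < 1" for z :: real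
      proof -
        have "(\<lambda>k. e (k + n) * z ^ (k + n)) sums 0"
          using e[of z] z less by (subst sums_zero_iff_shift) auto
        from sums_mult2[OF this, of "inverse (z ^ n)"] show ?thesis
          using z by (simp add: power_add field_simps)
      qed
      then have "((\<lambda>z :: real. 0) \<longlongrightarrow> e (0 + n)) (at 0)"
        by (intro powser_limit_0_strong[of 1]) auto
      then show ?case
        by (simp add: tendsto_const_iff)
    qed
    then show ?thesis by (simp add: e_def fun_eq_iff)
  qed
  have eq: "g_coeff \<gamma> = ?c"
    unfolding g_coeff_def by (rule the_equality[where P = ?P]) (fact ex, fact uniq)
  show "g_coeff \<gamma> k = (-1) ^ k * (\<gamma> gchoose k)" by (simp add: eq)
  show "(\<lambda>k. g_coeff \<gamma> k * z ^ k) sums ((1 - z) powr \<gamma>)" if "\<bar>z\<bar> < 1"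
    using ex that by (simp add: eq)
qed

definition g_tempered :: "real \<Rightarrow> real \<Rightarrow> real \<Rightarrow> nat \<Rightarrow> real" where
  "g_tempered \<gamma> lam \<tau> k = exp (- (real k * lam * \<tau>)) * g_coeff \<gamma> k"

definition d_coeff :: "real \<Rightarrow> real \<Rightarrow> real \<Rightarrow> nat \<Rightarrow> real" where
  "d_coeff \<gamma> lam \<tau> k =
     (if k = 0 then 1 - exp (- (\<gamma> * lam * \<tau>)) * (lam * \<tau>) powr \<gamma> else g_tempered \<gamma> lam \<tau> k)"

definition node :: "real \<Rightarrow> real \<Rightarrow> nat \<Rightarrow> real" where
  "node a h m = a + real m * h"

(* Vectors and matrices are indexed from 0: entry i belongs to the interior node number i + 1. *)
definition M_mat ::
  "complex \<Rightarrow> (real \<Rightarrow> real) \<Rightarrow> real \<Rightarrow> nat \<Rightarrow> real \<Rightarrow> real \<Rightarrow> nat \<Rightarrow> complex mat" where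
  "M_mat p U a M h \<tau> k =
     mat_diag (M - 1) (\<lambda>i. exp (- (p * complex_of_real (U (node a h (i + 1))) * of_nat k * complex_of_real \<tau>)))"

definition tridiag :: "nat \<Rightarrow> 'a \<Rightarrow> 'a \<Rightarrow> 'a \<Rightarrow> 'a :: zero mat" where
  "tridiag n l d u = mat n n (\<lambda>(i, j).
     if i = j then d else if i = Suc j then l else if j = Suc i then u else 0)"

definition H_mat :: "nat \<Rightarrow> real \<Rightarrow> complex mat" where
  "H_mat M h = complex_of_real (1 / h\<^sup>2) \<cdot>\<^sub>m tridiag (M - 1) 1 (-2) 1"

definition fd_solution ::
  "real \<Rightarrow> real \<Rightarrow> real \<Rightarrow> complex \<Rightarrow> (real \<Rightarrow> real) \<Rightarrow> (real \<Rightarrow> complex \<Rightarrow> real \<Rightarrow> complex) \<Rightarrow>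
   real \<Rightarrow> nat \<Rightarrow> nat \<Rightarrow> real \<Rightarrow> real \<Rightarrow> (nat \<Rightarrow> complex vec) \<Rightarrow> bool" where
  "fd_solution \<gamma> lam K p U f a M N h \<tau> Gh \<longleftrightarrow>
     Gh 0 = 0\<^sub>v (M - 1) \<and>
     (\<forall>n\<in>{1..N}. Gh n \<in> carrier_vec (M - 1)) \<and>
     (\<forall>n\<in>{1..N}.
        finsum_vec TYPE(complex) (M - 1)
          (\<lambda>k. complex_of_real (d_coeff \<gamma> lam \<tau> k / \<tau> powr \<gamma>) \<cdot>\<^sub>v
            (M_mat p U a M h \<tau> k *\<^sub>v Gh (n - k)))
          {0..n}
        = complex_of_real K \<cdot>\<^sub>v (H_mat M h *\<^sub>v Gh n)
          + vec (M - 1) (\<lambda>i. f (node a h (i + 1)) p (real n * \<tau>)))"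

definition fd_error ::
  "complex \<Rightarrow> (real \<Rightarrow> complex \<Rightarrow> real \<Rightarrow> complex) \<Rightarrow> real \<Rightarrow> nat \<Rightarrow> real \<Rightarrow> real \<Rightarrow>
   (nat \<Rightarrow> complex vec) \<Rightarrow> nat \<Rightarrow> complex vec" where
  "fd_error p G a M h \<tau> Gh n =
     vec (M - 1) (\<lambda>i. G (node a h (i + 1)) p (real n * \<tau>)) - Gh n"


section \<open>Discrete norms\<close>

(* A vector of dimension M - 1, read at the nodes 0, ..., M with value 0 at both end nodes. *)
definition zero_ext :: "complex vec \<Rightarrow> nat \<Rightarrow> complex" where
  "zero_ext v m = (if 1 \<le> m \<and> m \<le> dim_vec v then v $ (m - 1) else 0)"

definition norm_h_inf :: "nat \<Rightarrow> complex vec \<Rightarrow> real" where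
  "norm_h_inf M v = Max ((\<lambda>m. cmod (zero_ext v m)) ` {1..M - 1})"

definition seminorm_h_1 :: "nat \<Rightarrow> real \<Rightarrow> complex vec \<Rightarrow> real" where
  "seminorm_h_1 M h v =
     sqrt (h * (\<Sum>m = 1..M. (cmod ((zero_ext v m - zero_ext v (m - 1)) / complex_of_real h))\<^sup>2))"

definition norm_0_h_1 :: "nat \<Rightarrow> nat \<Rightarrow> real \<Rightarrow> real \<Rightarrow> (nat \<Rightarrow> complex vec) \<Rightarrow> real" where
  "norm_0_h_1 M N h \<tau> v = sqrt (\<Sum>n = 1..N. (seminorm_h_1 M h (v n))\<^sup>2 * \<tau>)"

definition norm_0'_h_inf :: "nat \<Rightarrow> nat \<Rightarrow> real \<Rightarrow> (nat \<Rightarrow> complex vec) \<Rightarrow> real" where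
  "norm_0'_h_inf M N \<tau> v = (\<Sum>n = 1..N. norm_h_inf M (v n) * \<tau>)"

end

theory Submission
  imports Defs "HOL-Probability.Characteristic_Functions"
begin

text \<open>
  The stability part is an energy argument: the tempered coefficients satisfy
  \<open>\<Sum>k\<ge>1. \<bar>d k\<bar> \<le> d 0\<close> and the diagonal matrices are contractions, so the discrete convolution
  form is nonnegative. Testing the error equation with the error itself and summing by parts in
  space bounds the \<open>H\<^sup>1\<close> seminorm by the residual; a discrete Sobolev inequality yields the maximum norm.

  For the consistency in time no fractional powers of complex numbers are needed. Summation by parts
  writes the difference between the Gruenwald-Letnikov sum and the Caputo derivative of \<open>w\<close> at
  \<open>n * \<tau>\<close> as \<open>\<tau> powr (1 - \<gamma>)\<close> times the integral over \<open>u\<close> of \<open>e u * w' (\<tau> * (n - u))\<close>. The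
  kernel \<open>e u\<close> compares the partial sums of the coefficients, taken at the integer part of \<open>u\<close>, with
  \<open>u powr (- \<gamma>) / Gamma (1 - \<gamma>)\<close>. By Gautschi's inequality \<open>e u\<close> is of order
  \<open>u powr (- \<gamma> - 1)\<close>, and its integral vanishes, so that its Fourier transform is of order
  \<open>\<bar>\<omega>\<bar> powr \<gamma>\<close>. Inserting the Fourier representation of \<open>w'\<close> gives the first order bound by the
  weighted norm of the transform of \<open>w\<close>.
\<close>

section \<open>The coefficients\<close>

text \<open>The weight exponent 1 + \<gamma> is spent exactly: one power of |\<omega>| on the
  derivative and \<gamma> powers on the kernel, whose transform at \<tau> * \<omega> yields
  \<open>\<tau> powr \<gamma>\<close> and completes the prefactor
  \<open>\<tau> powr (1 - \<gamma>)\<close> to \<tau>. Vanishing for t <= 0 works twice: it kills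
  the boundary term of the summation by parts, and it lets the integral over u run over the whole
  half line, where the kernel has mean zero. Tempering and potential are removed together by passing
  to w = exp (\<mu> * t) * G with \<mu> = lam + p * U x and Re \<mu> >= 0; the extra term in the
  zeroth tempered coefficient then reproduces \<open>lam powr \<gamma>\<close> up to O(\<tau>). The
  extension of w is known to be continuous only up to T, and may jump there; hence the transform is
  inverted at points of continuity, and T, which is a grid point, is reached by a left limit. The
  source is eliminated through the differential equation, so the constants can be chosen before
  it.\<close>

definition g_partial :: "real \<Rightarrow> nat \<Rightarrow> real" where
  "g_partial \<gamma> n = (\<Sum>k\<le>n. g_coeff \<gamma> k)"

lemma g_coeff_pochhammer: "g_coeff \<gamma> k = pochhammer (- \<gamma>) k / fact k"
  by (simp add: g_coeff_eq gbinomial_pochhammer flip: power_mult_distrib mult.assoc)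

text \<open>Multiplying the power series of (1 - z) to the power -c by 1 / (1 - z) sums its
  coefficients and raises c by one. It is used at c = -\<gamma> and again at c = 1 - \<gamma>, for
  the partial sums of the partial sums.\<close>

lemma sum_pochhammer_over_fact:
  "(\<Sum>k\<le>n. pochhammer c k / fact k) = pochhammer (c + 1) n / (fact n :: real)"
proof (induction n)
  case (Suc n)
  have "pochhammer (c + 1) (Suc n) = (c + 1 + real n) * pochhammer (c + 1) n"
    by (simp add: pochhammer_Suc)
  moreover have "pochhammer c (Suc n) = c * pochhammer (c + 1) n"
    by (simp add: pochhammer_rec)
  ultimately show ?case using Suc
    by (simp add: divide_simps del: of_nat_Suc) (simp add: algebra_simps)
qed simp

lemma g_partial_pochhammer: "g_partial \<gamma> n = pochhammer (1 - \<gamma>) n / fact n"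
  using sum_pochhammer_over_fact[of "- \<gamma>" n] by (simp add: g_partial_def g_coeff_pochhammer)

context
  fixes \<gamma> :: real
  assumes \<gamma>: "0 < \<gamma>" "\<gamma> < 1"
begin

lemma g_coeff_neg:
  assumes "k \<ge> 1"
  shows "g_coeff \<gamma> k < 0"
proof -
  obtain j where "k = Suc j" using assms by (cases k) auto
  then have "g_coeff \<gamma> k = - \<gamma> * pochhammer (1 - \<gamma>) j / fact k"
    by (simp add: g_coeff_pochhammer pochhammer_rec)
  also have "\<dots> < 0"
    using \<gamma> by (simp add: pochhammer_pos)
  finally show ?thesis .
qed

lemma g_coeff_0 [simp]: "g_coeff \<gamma> 0 = 1"
  by (simp add: g_coeff_pochhammer)

lemma g_partial_pos: "g_partial \<gamma> n > 0"
  using \<gamma> by (simp add: g_partial_pochhammer pochhammer_pos)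

lemma g_partial_Gamma: "Gamma (1 - \<gamma>) * g_partial \<gamma> n = Gamma (real n + 1 - \<gamma>) / fact n"
proof -
  have "1 - \<gamma> \<notin> \<int>\<^sub>\<le>\<^sub>0" using \<gamma> by (auto dest: nonpos_Ints_nonpos)
  moreover have "Gamma (1 - \<gamma>) \<noteq> 0"
    using Gamma_real_pos[of "1 - \<gamma>"] \<gamma> by linarith
  ultimately show ?thesis
    using pochhammer_Gamma[of "1 - \<gamma>" n]
    by (simp add: g_partial_pochhammer algebra_simps)
qed

text \<open>Gautschi's inequality, from log-convexity of the Gamma function.\<close>
lemma Gamma_ratio_le:
  assumes x: "(x :: real) > 0"
  shows "Gamma (x + 1 - \<gamma>) \<le> x powr (- \<gamma>) * Gamma (x + 1)"
proof -
  have "ln (Gamma ((1 - (1 - \<gamma>)) *\<^sub>R x + (1 - \<gamma>) *\<^sub>R (x + 1))) \<le> (1 - (1 - \<gamma>)) * ln (Gamma x) + (1 - \<gamma>) * ln (Gamma (x + 1))"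
    using convex_onD[OF log_convex_Gamma_real, of "1 - \<gamma>" x "x + 1"] \<gamma> x by simp
  moreover have "(1 - (1 - \<gamma>)) *\<^sub>R x + (1 - \<gamma>) *\<^sub>R (x + 1) = x + 1 - \<gamma>"
    by (simp add: algebra_simps)
  moreover have "ln (Gamma (x + 1)) = ln x + ln (Gamma x)"
  proof -
    have "x \<notin> \<int>\<^sub>\<le>\<^sub>0" using x by (auto dest: nonpos_Ints_nonpos)
    then show ?thesis
      using x less_imp_neq[OF Gamma_real_pos[OF x]] Gamma_plus1[of x] by (simp add: ln_mult)
  qed
  ultimately have "ln (Gamma (x + 1 - \<gamma>)) \<le> - \<gamma> * ln x + ln (Gamma (x + 1))"
    by (simp add: algebra_simps)
  also have "\<dots> = ln (x powr (- \<gamma>) * Gamma (x + 1))"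
    using x less_imp_neq[OF Gamma_real_pos[of "x + 1"]] by (simp add: ln_mult ln_powr)
  finally show ?thesis
    using x Gamma_real_pos[of "x + 1"] Gamma_real_pos[of "x + 1 - \<gamma>"] \<gamma> by (subst (asm) ln_le_cancel_iff) auto
qed

text \<open>Log-convexity again, now with x + 1 as the mean of x + 1 - \<gamma> and x + 2 - \<gamma>
  with weights 1 - \<gamma> and \<gamma>. The base x + 1 - \<gamma> that results is enlarged to x +
  1, so that upper and lower bound are values of one function at consecutive integers.\<close>

lemma Gamma_ratio_ge:
  assumes x: "(x :: real) \<ge> 0"
  shows "(x + 1) powr (- \<gamma>) * Gamma (x + 1) \<le> Gamma (x + 1 - \<gamma>)"
proof -
  have "ln (Gamma ((1 - \<gamma>) *\<^sub>R (x + 1 - \<gamma>) + \<gamma> *\<^sub>R (x + 2 - \<gamma>))) \<le> (1 - \<gamma>) * ln (Gamma (x + 1 - \<gamma>)) + \<gamma> * ln (Gamma (x + 2 - \<gamma>))"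
    using convex_onD[OF log_convex_Gamma_real, of \<gamma> "x + 1 - \<gamma>" "x + 2 - \<gamma>"] \<gamma> x by simp
  moreover have "(1 - \<gamma>) *\<^sub>R (x + 1 - \<gamma>) + \<gamma> *\<^sub>R (x + 2 - \<gamma>) = x + 1"
    by (simp add: algebra_simps)
  moreover have "ln (Gamma (x + 2 - \<gamma>)) = ln (x + 1 - \<gamma>) + ln (Gamma (x + 1 - \<gamma>))"
  proof -
    have pos: "x + 1 - \<gamma> > 0" using x \<gamma> by simp
    then have "Gamma (x + 1 - \<gamma> + 1) = (x + 1 - \<gamma>) * Gamma (x + 1 - \<gamma>)"
      by (intro Gamma_plus1) (auto dest: nonpos_Ints_nonpos)
    moreover have "x + 1 - \<gamma> + 1 = x + 2 - \<gamma>" by simp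
    ultimately show ?thesis
      using pos less_imp_neq[OF Gamma_real_pos[OF pos]] by (simp add: ln_mult)
  qed
  ultimately have "ln (Gamma (x + 1)) \<le> \<gamma> * ln (x + 1 - \<gamma>) + ln (Gamma (x + 1 - \<gamma>))"
    by (simp add: algebra_simps)
  also have "\<dots> \<le> \<gamma> * ln (x + 1) + ln (Gamma (x + 1 - \<gamma>))"
    using \<gamma> x by simp
  finally have "- \<gamma> * ln (x + 1) + ln (Gamma (x + 1)) \<le> ln (Gamma (x + 1 - \<gamma>))" by simp
  also have "- \<gamma> * ln (x + 1) + ln (Gamma (x + 1)) = ln ((x + 1) powr (- \<gamma>) * Gamma (x + 1))"
    using x less_imp_neq[OF Gamma_real_pos[of "x + 1"]] by (simp add: ln_mult ln_powr)
  finally show ?thesis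
    using x Gamma_real_pos[of "x + 1"] Gamma_real_pos[of "x + 1 - \<gamma>"] \<gamma> by (subst (asm) ln_le_cancel_iff) auto
qed

lemma g_partial_le: "n \<ge> 1 \<Longrightarrow> Gamma (1 - \<gamma>) * g_partial \<gamma> n \<le> real n powr (- \<gamma>)"
  using Gamma_ratio_le[of "real n"] Gamma_fact[of n, where 'a = real]
  by (simp add: g_partial_Gamma add_ac divide_simps)

lemma g_partial_ge: "real (n + 1) powr (- \<gamma>) \<le> Gamma (1 - \<gamma>) * g_partial \<gamma> n"
  using Gamma_ratio_ge[of "real n"] Gamma_fact[of n, where 'a = real]
  by (simp add: g_partial_Gamma add_ac divide_simps)

text \<open>The summation identity applied a second time. The right side is arranged as n times the
  Gamma ratio of \<open>g_partial_Gamma\<close>, to which the two Gautschi bounds apply once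
  more.\<close>

lemma sum_g_partial:
  "(1 - \<gamma>) * Gamma (1 - \<gamma>) * (\<Sum>k<n. g_partial \<gamma> k) = real n * (Gamma (real n + 1 - \<gamma>) / fact n)"
proof (cases n)
  case (Suc m)
  have "(\<Sum>k<n. g_partial \<gamma> k) = pochhammer (2 - \<gamma>) m / fact m"
    using sum_pochhammer_over_fact[of "1 - \<gamma>" m]
    by (simp add: Suc lessThan_Suc_atMost g_partial_pochhammer)
  then have "(1 - \<gamma>) * (\<Sum>k<n. g_partial \<gamma> k) = pochhammer (1 - \<gamma>) n / fact m"
    by (simp add: Suc pochhammer_rec)
  also have "\<dots> = real n * g_partial \<gamma> n"
    by (simp add: g_partial_pochhammer Suc divide_simps del: of_nat_Suc)
  finally show ?thesis
    using g_partial_Gamma[of n] by (metis (no_types, opaque_lifting) mult.commute mult.left_commute)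
qed simp

lemma powr_neg_diff_le:
  assumes "(x::real) > 0"
  shows "x powr (- \<gamma>) - (x + 1) powr (- \<gamma>) \<le> \<gamma> * x powr (- \<gamma> - 1)"
proof -
  have "\<exists>z>x. z < x + 1 \<and> (x + 1) powr (- \<gamma>) - x powr (- \<gamma>) = (x + 1 - x) * (- \<gamma> * z powr (- \<gamma> - 1))"
    using assms by (intro MVT2) (auto intro!: derivative_eq_intros)
  then obtain z where z: "z > x" "x powr (- \<gamma>) - (x + 1) powr (- \<gamma>) = \<gamma> * z powr (- \<gamma> - 1)" by auto
  then show ?thesis using assms \<gamma> by (auto intro!: powr_mono2')
qed

text \<open>The subtracted term is the integral of
  \<open>u powr (- \<gamma>) / Gamma (1 - \<gamma>)\<close> over [0, n]. Both Gautschi bounds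
  confine the Gamma ratio to a gap of order \<open>n powr (- \<gamma> - 1)\<close>, and the factor n
  costs one order. What matters is that the remainder tends to 0: it makes the kernel below have
  mean zero.\<close>

lemma sum_g_partial_asymp:
  assumes n: "n \<ge> 1"
  shows "\<bar>(\<Sum>k<n. g_partial \<gamma> k) - real n powr (1 - \<gamma>) / ((1 - \<gamma>) * Gamma (1 - \<gamma>))\<bar>
    \<le> \<gamma> / ((1 - \<gamma>) * Gamma (1 - \<gamma>)) * real n powr (- \<gamma>)"
proof -
  define c where "c = (1 - \<gamma>) * Gamma (1 - \<gamma>)"
  have c: "c > 0" using \<gamma> by (simp add: c_def Gamma_real_pos)
  define r where "r = Gamma (1 - \<gamma>) * g_partial \<gamma> n"
  have r: "r \<le> real n powr (- \<gamma>)" "real n powr (- \<gamma>) - r \<le> \<gamma> * real n powr (- \<gamma> - 1)"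
    using g_partial_le[OF n] g_partial_ge[of n] powr_neg_diff_le[of "real n"] n by (simp_all add: r_def add_ac)
  have p: "real n * real n powr (- \<gamma>) = real n powr (1 - \<gamma>)" "real n * real n powr (- \<gamma> - 1) = real n powr (- \<gamma>)"
    using n powr_add[of "real n" 1 "- \<gamma>"]  powr_add[of "real n" 1 "- \<gamma> - 1"] by simp_all
  have "c * (\<Sum>k<n. g_partial \<gamma> k) = real n * r"
    using sum_g_partial[of n] by (simp add: c_def r_def g_partial_Gamma)
  then have *: "(\<Sum>k<n. g_partial \<gamma> k) = real n * r / c" using c by (simp add: field_simps)
  have "\<bar>real n * r - real n powr (1 - \<gamma>)\<bar> = real n * (real n powr (- \<gamma>) - r)"
    using mult_left_mono[OF r(1), of "real n"] p by (simp add: algebra_simps)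
  also have "\<dots> \<le> real n * (\<gamma> * real n powr (- \<gamma> - 1))"
    using r(2) by (intro mult_left_mono) auto
  also have "\<dots> = \<gamma> * real n powr (- \<gamma>)" using p by (simp add: mult.left_commute)
  finally have "\<bar>real n * r - real n powr (1 - \<gamma>)\<bar> / c \<le> \<gamma> * real n powr (- \<gamma>) / c"
    using c by (simp add: divide_right_mono)
  then show ?thesis using c unfolding * c_def[symmetric]
    by (simp add: abs_divide flip: diff_divide_distrib)
qed

text \<open>All coefficients with k >= 1 are negative, so the sum of absolute values is 1 minus a
  partial sum of the binomial series at z = exp (- lam * \<tau>). These partial sums decrease to
  \<open>(1 - z) powr \<gamma>\<close>, and 1 + x <= exp x gives z * lam * \<tau> <= 1 - z, which
  bounds the subtracted term of the zeroth coefficient. For lam = 0 the point z = 1 leaves the disc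
  of convergence, and positivity of \<open>g_partial\<close> replaces the series. No restriction on
  \<tau> arises.\<close>

lemma d_coeff_sum_le:
  assumes l: "0 \<le> lam" "0 < \<tau>"
  shows "(\<Sum>k=1..n. \<bar>d_coeff \<gamma> lam \<tau> k\<bar>) \<le> d_coeff \<gamma> lam \<tau> 0"
proof -
  define z where "z = exp (- (lam * \<tau>))"
  have d: "\<bar>d_coeff \<gamma> lam \<tau> k\<bar> = - (g_coeff \<gamma> k * z ^ k)" if "k \<in> {1..n}" for k
    using that g_coeff_neg[of k]
    by (simp add: d_coeff_def g_tempered_def z_def abs_mult mult.commute mult.left_commute flip: exp_of_nat_mult)
  have split: "(\<Sum>k\<le>n. h k) = h 0 + (\<Sum>k=1..n. h k)" for h :: "nat \<Rightarrow> real"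
    by (simp add: sum.atMost_shift sum.atLeast1_atMost_eq)
  have eq: "(\<Sum>k=1..n. \<bar>d_coeff \<gamma> lam \<tau> k\<bar>) = 1 - (\<Sum>k\<le>n. g_coeff \<gamma> k * z ^ k)"
    by (simp only: sum.cong[OF refl d]) (simp add: split sum_negf)
  show ?thesis
  proof (cases "lam = 0")
    case True
    then show ?thesis unfolding eq using g_partial_pos[of n]
      by (simp add: z_def d_coeff_def g_partial_def)
  next
    case False
    with l have z: "0 < z" "z < 1" by (simp_all add: z_def)
    have s: "(\<lambda>k. g_coeff \<gamma> k * z ^ k) sums ((1 - z) powr \<gamma>)" using z by (intro g_coeff_sums) auto
    have "(1 - z) powr \<gamma> \<le> (\<Sum>k\<le>n. g_coeff \<gamma> k * z ^ k)"
    proof (rule LIMSEQ_le_const2)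
      show "(\<lambda>m. \<Sum>k\<le>m. g_coeff \<gamma> k * z ^ k) \<longlonglongrightarrow> (1 - z) powr \<gamma>"
        using s by (simp add: sums_def_le)
      have "(\<Sum>k\<le>m. g_coeff \<gamma> k * z ^ k) \<le> (\<Sum>k\<le>n. g_coeff \<gamma> k * z ^ k)" if "m \<ge> n" for m
        using that
      proof (induction rule: dec_induct)
        case (step m)
        then show ?case using g_coeff_neg[of "Suc m"] z by (simp add: mult_nonpos_nonneg add_decreasing2)
      qed simp
      then show "\<exists>N. \<forall>m\<ge>N. (\<Sum>k\<le>m. g_coeff \<gamma> k * z ^ k) \<le> (\<Sum>k\<le>n. g_coeff \<gamma> k * z ^ k)" by blast
    qed
    moreover have "(z * (lam * \<tau>)) powr \<gamma> \<le> (1 - z) powr \<gamma>"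
    proof (rule powr_mono2)
      have "1 + lam * \<tau> \<le> exp (lam * \<tau>)" by (rule exp_ge_add_one_self)
      then have "z * (1 + lam * \<tau>) \<le> z * exp (lam * \<tau>)" using z by simp
      also have "z * exp (lam * \<tau>) = 1" by (simp add: z_def exp_minus)
      finally show "z * (lam * \<tau>) \<le> 1 - z" by (simp add: algebra_simps)
    qed (use z l \<gamma> in auto)
    moreover have "(z * (lam * \<tau>)) powr \<gamma> = exp (- (\<gamma> * lam * \<tau>)) * (lam * \<tau>) powr \<gamma>"
      using l by (simp add: powr_mult z_def exp_powr_real mult_ac)
    ultimately show ?thesis unfolding eq by (simp add: d_coeff_def)
  qed
qed

end

section \<open>The kernel of the quadrature error\<close>

text \<open>The function e of the overview. The value 0 for u <= 0 turns integrals over the half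
  line into integrals over the whole line, so that its Fourier transform makes sense.\<close>

definition gl_kernel :: "real \<Rightarrow> real \<Rightarrow> real" where
  "gl_kernel \<gamma> u = (if u \<le> 0 then 0 else g_partial \<gamma> (nat \<lfloor>u\<rfloor>) - u powr (- \<gamma>) / Gamma (1 - \<gamma>))"

lemma gl_kernel_measurable [measurable]: "gl_kernel \<gamma> \<in> borel_measurable lborel"
  unfolding gl_kernel_def by measurable

text \<open>The coefficient is constant only on [k, k + 1); at the right end point the floor has
  already jumped, and that point is discarded as a null set. Values in a Banach space serve both the
  constant 1 and the complex derivative of w.\<close>

lemma has_integral_step:
  fixes f :: "real \<Rightarrow> 'a :: banach"
  assumes "\<And>k. k < n \<Longrightarrow> (f has_integral I k) {real k..real k + 1}"
  shows "((\<lambda>u. c (nat \<lfloor>u\<rfloor>) *\<^sub>R f u) has_integral (\<Sum>k<n. c k *\<^sub>R I k)) {0..real n}"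
  using assms
proof (induction n)
  case (Suc n)
  have "((\<lambda>u. c (nat \<lfloor>u\<rfloor>) *\<^sub>R f u) has_integral c n *\<^sub>R I n) {real n..real n + 1}"
  proof (rule has_integral_spike[of "{real n + 1}"])
    show "((\<lambda>u. c n *\<^sub>R f u) has_integral c n *\<^sub>R I n) {real n..real n + 1}"
      using Suc.prems[of n] by (intro has_integral_cmul) auto
    fix u assume "u \<in> {real n..real n + 1} - {real n + 1}"
    then have "\<lfloor>u\<rfloor> = int n" by (intro floor_unique) auto
    then show "c (nat \<lfloor>u\<rfloor>) *\<^sub>R f u = c n *\<^sub>R f u" by simp
  qed auto
  moreover have "((\<lambda>u. c (nat \<lfloor>u\<rfloor>) *\<^sub>R f u) has_integral (\<Sum>k<n. c k *\<^sub>R I k)) {0..real n}"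
    using Suc.IH Suc.prems by simp
  ultimately have "((\<lambda>u. c (nat \<lfloor>u\<rfloor>) *\<^sub>R f u) has_integral (\<Sum>k<n. c k *\<^sub>R I k) + c n *\<^sub>R I n) {0..real n + 1}"
    by - (rule has_integral_combine[of 0 "real n"], auto)
  then show ?case by (simp add: add.commute)
qed (auto simp: has_integral_refl)

text \<open>A bridge from the gauge integral, in which the power integrals are evaluated, to the
  Lebesgue integral: for a nonnegative function integrability is already absolute.\<close>

lemma integrable_has_integral_nonneg:
  fixes f :: "real \<Rightarrow> real"
  assumes [measurable]: "f \<in> borel_measurable borel" "S \<in> sets borel"
    and nn: "\<And>x. x \<in> S \<Longrightarrow> 0 \<le> f x" and I: "(f has_integral I) S"
  shows "set_integrable lborel S f" "(LINT x:S|lborel. f x) = I"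
proof -
  have "f absolutely_integrable_on S"
    using nn I by (intro nonnegative_absolutely_integrable_1) (auto simp: has_integral_integrable)
  then show *: "set_integrable lborel S f"
    unfolding set_integrable_def by (subst (asm) integrable_completion) auto
  show "(LINT x:S|lborel. f x) = I"
    using set_borel_integral_eq_integral(2)[OF *] integral_unique[OF I] by simp
qed

context
  fixes \<gamma> :: real
  assumes \<gamma>: "0 < \<gamma>" "\<gamma> < 1"
begin

lemma powr_integral_0:
  assumes "r > 0"
  shows "set_integrable lborel {0<..r} (\<lambda>u. u powr (- \<gamma>))"
    and "(LINT u:{0<..r}|lborel. u powr (- \<gamma>)) = r powr (1 - \<gamma>) / (1 - \<gamma>)"
proof -
  have "((\<lambda>u. u powr (- \<gamma>)) has_integral (r powr (- \<gamma> + 1) / (- \<gamma> + 1))) {0..r}"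
    using \<gamma> assms by (intro has_integral_powr_from_0) auto
  then have "((\<lambda>u. u powr (- \<gamma>)) has_integral (r powr (1 - \<gamma>) / (1 - \<gamma>))) {0..r}"
    by simp
  then have "((\<lambda>u. u powr (- \<gamma>)) has_integral (r powr (1 - \<gamma>) / (1 - \<gamma>))) {0<..r}"
    by (rule has_integral_spike_set_eq[THEN iffD1, rotated -1])
       (auto simp: intro: negligible_subset[of "{0}"])
  from integrable_has_integral_nonneg[OF _ _ _ this]
  show "set_integrable lborel {0<..r} (\<lambda>u. u powr (- \<gamma>))"
    and "(LINT u:{0<..r}|lborel. u powr (- \<gamma>)) = r powr (1 - \<gamma>) / (1 - \<gamma>)" by auto
qed

lemma powr_integral_inf:
  assumes "r > 0"
  shows "set_integrable lborel {r..} (\<lambda>u. u powr (- \<gamma> - 1))"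
    and "(LINT u:{r..}|lborel. u powr (- \<gamma> - 1)) = r powr (- \<gamma>) / \<gamma>"
proof -
  have "((\<lambda>u. u powr (- \<gamma> - 1)) has_integral - (r powr ((- \<gamma> - 1) + 1)) / ((- \<gamma> - 1) + 1)) {r..}"
    using \<gamma> assms by (intro has_integral_powr_to_inf) auto
  then have "((\<lambda>u. u powr (- \<gamma> - 1)) has_integral (r powr (- \<gamma>) / \<gamma>)) {r..}"
    by simp
  from integrable_has_integral_nonneg[OF _ _ _ this]
  show "set_integrable lborel {r..} (\<lambda>u. u powr (- \<gamma> - 1))"
    and "(LINT u:{r..}|lborel. u powr (- \<gamma> - 1)) = r powr (- \<gamma>) / \<gamma>" by auto
qed

text \<open>The bound with exponent -\<gamma> - 1 holds on the whole half line but is integrable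
  only away from 0; the one with exponent -\<gamma> supplies integrability near 0.\<close>

lemma gl_kernel_bound:
  obtains C where "C > 0" "\<And>u. u > 0 \<Longrightarrow> \<bar>gl_kernel \<gamma> u\<bar> \<le> C * u powr (- \<gamma> - 1)"
    "\<And>u. 0 < u \<Longrightarrow> u \<le> 1 \<Longrightarrow> \<bar>gl_kernel \<gamma> u\<bar> \<le> C * u powr (- \<gamma>)"
proof -
  define \<Gamma> where "\<Gamma> = Gamma (1 - \<gamma>)"
  have \<Gamma>: "\<Gamma> > 0" using \<gamma> by (simp add: \<Gamma>_def Gamma_real_pos)
  \<comment> \<open>The 1 covers \<open>g_partial \<gamma> 0 = 1\<close> on (0, 1). The 4 bounds
    \<open>2 powr (\<gamma> + 1)\<close>, the price of replacing the integer part of u by u /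
    2.\<close>
  define C where "C = 1 + 4 / \<Gamma>"
  have small: "\<bar>gl_kernel \<gamma> u\<bar> \<le> C * u powr (- \<gamma>)" if u: "0 < u" "u < 1" for u
  proof -
    have "\<lfloor>u\<rfloor> = 0" using u by (intro floor_unique) auto
    then have "gl_kernel \<gamma> u = 1 - u powr (- \<gamma>) / \<Gamma>"
      using u \<gamma> by (simp add: gl_kernel_def \<Gamma>_def g_partial_def)
    then have "\<bar>gl_kernel \<gamma> u\<bar> \<le> 1 + u powr (- \<gamma>) / \<Gamma>"
      using \<Gamma> abs_triangle_ineq4[of 1 "u powr (- \<gamma>) / \<Gamma>"] by simp
    also have "\<dots> \<le> u powr (- \<gamma>) + 4 * u powr (- \<gamma>) / \<Gamma>"
      using \<Gamma> u \<gamma> powr_mono2'[of "- \<gamma>" u 1] by (intro add_mono divide_right_mono) auto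
    also have "\<dots> = C * u powr (- \<gamma>)" by (simp add: C_def algebra_simps)
    finally show ?thesis .
  qed
  have large: "\<bar>gl_kernel \<gamma> u\<bar> \<le> C * u powr (- \<gamma> - 1)" if u: "u \<ge> 1" for u
  proof -
    define k where "k = nat \<lfloor>u\<rfloor>"
    have "\<lfloor>u\<rfloor> \<ge> 1" using u by simp
    then have k: "k \<ge> 1" "real k \<le> u" "u < real k + 1"
      using u unfolding k_def by linarith+
    have "u powr (- \<gamma>) \<le> real k powr (- \<gamma>)" "(real k + 1) powr (- \<gamma>) \<le> u powr (- \<gamma>)"
      using k u \<gamma> by (auto intro!: powr_mono2')
    moreover have "\<Gamma> * g_partial \<gamma> k \<le> real k powr (- \<gamma>)" "(real k + 1) powr (- \<gamma>) \<le> \<Gamma> * g_partial \<gamma> k"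
      using g_partial_le[OF \<gamma> k(1)] g_partial_ge[OF \<gamma>, of k] by (simp_all add: \<Gamma>_def add_ac)
    \<comment> \<open>Both quantities lie between \<open>(real k + 1) powr (- \<gamma>)\<close> and
      \<open>real k powr (- \<gamma>)\<close>, so their distance is at most the length of that
      interval.\<close>
    ultimately have "\<bar>\<Gamma> * g_partial \<gamma> k - u powr (- \<gamma>)\<bar> \<le> real k powr (- \<gamma>) - (real k + 1) powr (- \<gamma>)"
      by linarith
    also have "\<dots> \<le> \<gamma> * real k powr (- \<gamma> - 1)"
      using k by (intro powr_neg_diff_le \<gamma>) auto
    also have "\<dots> \<le> 1 * (u / 2) powr (- \<gamma> - 1)"
    proof -
      have "u / 2 \<le> real k" using k by linarith
      then show ?thesis using u \<gamma> by (intro mult_mono powr_mono2') auto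
    qed
    also have "\<dots> = 2 powr (\<gamma> + 1) * u powr (- \<gamma> - 1)"
      using u powr_minus_divide[of 2 "\<gamma> + 1"] by (simp add: powr_divide)
    also have "\<dots> \<le> 2 powr 2 * u powr (- \<gamma> - 1)"
      using \<gamma> by (intro mult_right_mono powr_mono) auto
    finally have *: "\<bar>\<Gamma> * g_partial \<gamma> k - u powr (- \<gamma>)\<bar> \<le> 4 * u powr (- \<gamma> - 1)" by simp
    have "gl_kernel \<gamma> u = (\<Gamma> * g_partial \<gamma> k - u powr (- \<gamma>)) / \<Gamma>"
      using u \<Gamma> by (simp add: gl_kernel_def k_def \<Gamma>_def diff_divide_distrib)
    then have "\<bar>gl_kernel \<gamma> u\<bar> \<le> 4 * u powr (- \<gamma> - 1) / \<Gamma>"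
      using * \<Gamma> by (simp add: abs_divide divide_right_mono)
    also have "\<dots> \<le> C * u powr (- \<gamma> - 1)" by (simp add: C_def algebra_simps)
    finally show ?thesis .
  qed
  have "C > 0" using \<Gamma> by (simp add: C_def add_pos_pos)
  show ?thesis
  proof
    fix u :: real assume u: "u > 0"
    show "\<bar>gl_kernel \<gamma> u\<bar> \<le> C * u powr (- \<gamma> - 1)"
    proof (cases "u < 1")
      case True
      have "u powr (- \<gamma>) \<le> u powr (- \<gamma> - 1)"
        using u True by (intro powr_mono') auto
      then show ?thesis using small[OF u True] \<open>C > 0\<close>
        by (meson mult_le_cancel_left_pos order_trans)
    qed (use large in auto)
  next
    fix u :: real assume u: "u > 0" "u \<le> 1"
    then show "\<bar>gl_kernel \<gamma> u\<bar> \<le> C * u powr (- \<gamma>)"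
      using small[of u] large[of 1] by (cases "u = 1") auto
  qed fact
qed

lemma integrable_gl_kernel: "integrable lborel (gl_kernel \<gamma>)"
proof -
  obtain C where C: "C > 0" "\<And>u. u > 0 \<Longrightarrow> \<bar>gl_kernel \<gamma> u\<bar> \<le> C * u powr (- \<gamma> - 1)"
    "\<And>u. 0 < u \<Longrightarrow> u \<le> 1 \<Longrightarrow> \<bar>gl_kernel \<gamma> u\<bar> \<le> C * u powr (- \<gamma>)"
    using gl_kernel_bound by blast
  have "integrable lborel (\<lambda>u. C * (indicator {0<..1} u * u powr (- \<gamma>)) + C * (indicator {1..} u * u powr (- \<gamma> - 1)))"
    using powr_integral_0(1)[of 1] powr_integral_inf(1)[of 1]
    by (intro Bochner_Integration.integrable_add integrable_mult_right) (auto simp: set_integrable_def)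
  then show ?thesis
  proof (rule Bochner_Integration.integrable_bound)
    have "\<bar>gl_kernel \<gamma> u\<bar> \<le> \<bar>C * (indicator {0<..1} u * u powr (- \<gamma>)) + C * (indicator {1..} u * u powr (- \<gamma> - 1))\<bar>" for u
      using C(2)[of u] C(3)[of u] C(1)
      by (cases "u \<le> 0"; cases "u < 1"; cases "u = 1") (auto simp: gl_kernel_def)
    then show "AE u in lborel. norm (gl_kernel \<gamma> u) \<le>
      norm (C * (indicator {0<..1} u * u powr (- \<gamma>)) + C * (indicator {1..} u * u powr (- \<gamma> - 1)))"
      by simp
  qed simp
qed

lemma gl_kernel_integral_initial:
  "(LINT u:{0<..real n}|lborel. gl_kernel \<gamma> u) =
    (\<Sum>k<n. g_partial \<gamma> k) - real n powr (1 - \<gamma>) / ((1 - \<gamma>) * Gamma (1 - \<gamma>))"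
proof (cases "n = 0")
  case False
  have "((\<lambda>u. g_partial \<gamma> (nat \<lfloor>u\<rfloor>) *\<^sub>R (1::real)) has_integral (\<Sum>k<n. g_partial \<gamma> k *\<^sub>R (1::real))) {0..real n}"
    by (rule has_integral_step) (metis add_diff_cancel_left' content_real_if has_integral_const_real le_add_same_cancel1 scaleR_one zero_le_one)
  then have 1: "((\<lambda>u. g_partial \<gamma> (nat \<lfloor>u\<rfloor>)) has_integral (\<Sum>k<n. g_partial \<gamma> k)) {0..real n}" by simp
  have "((\<lambda>u. u powr (- \<gamma>)) has_integral (real n powr (- \<gamma> + 1) / (- \<gamma> + 1))) {0..real n}"
    using \<gamma> by (intro has_integral_powr_from_0) auto
  from has_integral_diff[OF 1 has_integral_divide[OF this, of "Gamma (1 - \<gamma>)"]]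
  have "((\<lambda>u. g_partial \<gamma> (nat \<lfloor>u\<rfloor>) - u powr (- \<gamma>) / Gamma (1 - \<gamma>)) has_integral
     ((\<Sum>k<n. g_partial \<gamma> k) - real n powr (1 - \<gamma>) / ((1 - \<gamma>) * Gamma (1 - \<gamma>)))) {0..real n}"
    by simp
  then have "(gl_kernel \<gamma> has_integral
     ((\<Sum>k<n. g_partial \<gamma> k) - real n powr (1 - \<gamma>) / ((1 - \<gamma>) * Gamma (1 - \<gamma>)))) {0..real n}"
    by (rule has_integral_spike[of "{0}", rotated -1]) (auto simp: gl_kernel_def)
  then have "(gl_kernel \<gamma> has_integral
     ((\<Sum>k<n. g_partial \<gamma> k) - real n powr (1 - \<gamma>) / ((1 - \<gamma>) * Gamma (1 - \<gamma>)))) {0<..real n}"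
    by (rule has_integral_spike_set_eq[THEN iffD1, rotated -1])
       (auto simp: intro: negligible_subset[of "{0}"])
  moreover have "set_integrable lborel {0<..real n} (gl_kernel \<gamma>)"
    using integrable_gl_kernel unfolding set_integrable_def
    by (intro integrable_mult_indicator) auto
  ultimately show ?thesis
    by (simp add: set_borel_integral_eq_integral integral_unique)
qed (simp add: set_lebesgue_integral_def)

text \<open>The integrals over (0, n] converge to the full integral by dominated convergence and to
  0 by the asymptotics of the summed partial sums, whose leading term is exactly the integral of the
  power. This cancellation is what allows the exponential in the transform to be replaced by its
  difference from 1.\<close>

lemma gl_kernel_integral: "(LINT u|lborel. gl_kernel \<gamma> u) = 0"
proof (rule LIMSEQ_unique)
  show "(\<lambda>n. LINT u:{0<..real n}|lborel. gl_kernel \<gamma> u) \<longlonglongrightarrow> (LINT u|lborel. gl_kernel \<gamma> u)"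
    unfolding set_lebesgue_integral_def
  proof (rule integral_dominated_convergence[where w = "\<lambda>u. \<bar>gl_kernel \<gamma> u\<bar>"])
    show "AE u in lborel. (\<lambda>n. indicator {0<..real n} u *\<^sub>R gl_kernel \<gamma> u) \<longlonglongrightarrow> gl_kernel \<gamma> u"
    proof (intro AE_I2 tendsto_eventually)
      fix u :: real
      obtain m where m: "u \<le> real m" using real_arch_simple by blast
      show "\<forall>\<^sub>F n in sequentially. indicator {0<..real n} u *\<^sub>R gl_kernel \<gamma> u = gl_kernel \<gamma> u"
        using eventually_ge_at_top[of m]
        by eventually_elim (use m in \<open>auto simp: indicator_def gl_kernel_def\<close>)
    qed
    show "AE u in lborel. norm (indicator {0<..real n} u *\<^sub>R gl_kernel \<gamma> u) \<le> \<bar>gl_kernel \<gamma> u\<bar>" for n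
      by (auto simp: indicator_def)
  qed (use integrable_gl_kernel in auto)
  define c where "c = \<gamma> / ((1 - \<gamma>) * Gamma (1 - \<gamma>))"
  have "(\<lambda>n. c * real n powr (- \<gamma>)) \<longlonglongrightarrow> c * 0"
    using \<gamma> by (intro tendsto_intros tendsto_neg_powr filterlim_real_sequentially) auto
  then have "(\<lambda>n. c * real n powr (- \<gamma>)) \<longlonglongrightarrow> 0" by simp
  then show "(\<lambda>n. LINT u:{0<..real n}|lborel. gl_kernel \<gamma> u) \<longlonglongrightarrow> 0"
  proof (rule Lim_null_comparison[rotated])
    show "\<forall>\<^sub>F n in sequentially. norm (LINT u:{0<..real n}|lborel. gl_kernel \<gamma> u) \<le> c * real n powr (- \<gamma>)"
      using eventually_ge_at_top[of 1]
    proof eventually_elim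
      case (elim n)
      then show ?case
        using sum_g_partial_asymp[OF \<gamma> elim] unfolding gl_kernel_integral_initial c_def real_norm_def by blast
    qed
  qed
qed

end

context
  fixes \<gamma> :: real
  assumes \<gamma>: "0 < \<gamma>" "\<gamma> < 1"
begin
text \<open>Mean zero replaces the phase by the phase minus 1. The integral is split at r = 1 /
  |\<omega>|: below r the phase difference is at most |\<omega>| * u, which also tames the
  singularity at 0, and above r it is at most 2. Against \<open>u powr (- \<gamma> - 1)\<close> both
  pieces scale like \<open>\<bar>\<omega>\<bar> powr \<gamma>\<close>, with factors 1 / (1 -
  \<gamma>) and 2 / \<gamma>. At \<omega> = 0 the claim is the vanishing mean itself.\<close>

lemma fourier_gl_kernel_bound:
  obtains C where "C > 0" "\<And>\<omega>. cmod (fourier (\<lambda>u. complex_of_real (gl_kernel \<gamma> u)) \<omega>) \<le> C * \<bar>\<omega>\<bar> powr \<gamma>"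
proof -
  obtain C where C: "C > 0" "\<And>u. u > 0 \<Longrightarrow> \<bar>gl_kernel \<gamma> u\<bar> \<le> C * u powr (- \<gamma> - 1)"
    by (rule gl_kernel_bound[OF \<gamma>]) blast
  define C' where "C' = C / (1 - \<gamma>) + 2 * C / \<gamma>"
  have C': "C' > 0" using C \<gamma> by (simp add: C'_def add_pos_pos)
  have int: "integrable lborel (\<lambda>u. exp (- (\<i> * complex_of_real (\<omega> * u))) * complex_of_real (gl_kernel \<gamma> u))" for \<omega>
    by (rule Bochner_Integration.integrable_bound[OF integrable_gl_kernel[OF \<gamma>]]) (auto simp: norm_mult)
  have "cmod (fourier (\<lambda>u. complex_of_real (gl_kernel \<gamma> u)) \<omega>) \<le> C' * \<bar>\<omega>\<bar> powr \<gamma>" for \<omega>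
  proof (cases "\<omega> = 0")
    case True
    then show ?thesis by (simp add: fourier_def gl_kernel_integral[OF \<gamma>])
  next
    case False
    define r where "r = 1 / \<bar>\<omega>\<bar>"
    have r: "r > 0" using False by (simp add: r_def)
    define B where "B u = C * \<bar>\<omega>\<bar> * (indicator {0<..r} u * u powr (- \<gamma>)) + 2 * C * (indicator {r..} u * u powr (- \<gamma> - 1))" for u
    have B: "integrable lborel B" "(LINT u|lborel. B u) = C * \<bar>\<omega>\<bar> * (r powr (1 - \<gamma>) / (1 - \<gamma>)) + 2 * C * (r powr (- \<gamma>) / \<gamma>)"
    proof -
      note p = powr_integral_0[OF \<gamma> r, unfolded set_integrable_def set_lebesgue_integral_def real_scaleR_def]
        powr_integral_inf[OF \<gamma> r, unfolded set_integrable_def set_lebesgue_integral_def real_scaleR_def]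
      show "integrable lborel B" unfolding B_def
        by (intro Bochner_Integration.integrable_add integrable_mult_right p)
      show "(LINT u|lborel. B u) = C * \<bar>\<omega>\<bar> * (r powr (1 - \<gamma>) / (1 - \<gamma>)) + 2 * C * (r powr (- \<gamma>) / \<gamma>)"
        unfolding B_def
        by (subst Bochner_Integration.integral_add) (use p in \<open>auto intro!: integrable_mult_right\<close>)
    qed
    have "fourier (\<lambda>u. complex_of_real (gl_kernel \<gamma> u)) \<omega> =
      (LINT u|lborel. (exp (- (\<i> * complex_of_real (\<omega> * u))) - 1) * complex_of_real (gl_kernel \<gamma> u))"
      using int[of \<omega>] integrable_gl_kernel[OF \<gamma>] gl_kernel_integral[OF \<gamma>] by (simp add: fourier_def left_diff_distrib)
    also have "cmod \<dots> \<le> (LINT u|lborel. B u)"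
    proof (rule Bochner_Integration.integral_norm_bound_integral[OF _ B(1)])
      show "integrable lborel (\<lambda>u. (exp (- (\<i> * complex_of_real (\<omega> * u))) - 1) * complex_of_real (gl_kernel \<gamma> u))"
        unfolding left_diff_distrib using int[of \<omega>] integrable_gl_kernel[OF \<gamma>] by auto
      fix u :: real
      \<comment> \<open>Both estimates come from |exp (i x) - 1| = 2 |sin (x / 2)|.\<close>
      have e: "cmod (exp (- (\<i> * complex_of_real (\<omega> * u))) - 1) \<le> \<bar>\<omega>\<bar> * \<bar>u\<bar>" "cmod (exp (- (\<i> * complex_of_real (\<omega> * u))) - 1) \<le> 2"
        using dist_exp_i_1[of "- (\<omega> * u)"] abs_sin_x_le_abs_x[of "- (\<omega> * u) / 2"] abs_sin_le_one[of "- (\<omega> * u) / 2"]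
        by (auto simp: abs_mult)
      show "cmod ((exp (- (\<i> * complex_of_real (\<omega> * u))) - 1) * complex_of_real (gl_kernel \<gamma> u)) \<le> B u"
      proof (cases "u \<le> 0")
        case True
        then show ?thesis using C r by (auto simp: gl_kernel_def B_def)
      next
        case False
        then have u: "u > 0" by simp
        show ?thesis
        proof (cases "u < r")
          case True
          have "cmod ((exp (- (\<i> * complex_of_real (\<omega> * u))) - 1) * complex_of_real (gl_kernel \<gamma> u)) \<le> (\<bar>\<omega>\<bar> * \<bar>u\<bar>) * (C * u powr (- \<gamma> - 1))"
            unfolding norm_mult norm_of_real using e C(2)[OF u] by (intro mult_mono) auto
          also have "\<dots> = C * \<bar>\<omega>\<bar> * (u * u powr (- \<gamma> - 1))" using u by simp
          also have "u * u powr (- \<gamma> - 1) = u powr (- \<gamma>)" using powr_add[of u 1 "- \<gamma> - 1"] u by simp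
          finally show ?thesis using True u by (simp add: B_def)
        next
          case False
          have "cmod ((exp (- (\<i> * complex_of_real (\<omega> * u))) - 1) * complex_of_real (gl_kernel \<gamma> u)) \<le> 2 * (C * u powr (- \<gamma> - 1))"
            unfolding norm_mult norm_of_real using e C(2)[OF u] by (intro mult_mono) auto
          also have "\<dots> \<le> B u" using False u C by (auto simp: B_def)
          finally show ?thesis .
        qed
      qed
    qed
    also have "\<dots> = C' * \<bar>\<omega>\<bar> powr \<gamma>"
    proof -
      have "\<bar>\<omega>\<bar> * r powr (1 - \<gamma>) = \<bar>\<omega>\<bar> powr \<gamma>" "r powr (- \<gamma>) = \<bar>\<omega>\<bar> powr \<gamma>"
      proof -
        have "r = \<bar>\<omega>\<bar> powr (- 1)" using False by (simp add: r_def powr_minus_divide)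
        then have *: "r powr y = \<bar>\<omega>\<bar> powr (- y)" for y by (simp only: powr_powr) simp
        show "r powr (- \<gamma>) = \<bar>\<omega>\<bar> powr \<gamma>" by (simp add: *)
        show "\<bar>\<omega>\<bar> * r powr (1 - \<gamma>) = \<bar>\<omega>\<bar> powr \<gamma>"
          using powr_add[of "\<bar>\<omega>\<bar>" 1 "\<gamma> - 1"] by (simp add: *)
      qed
      then show ?thesis unfolding B C'_def by (simp add: algebra_simps)
    qed
    finally show ?thesis .
  qed
  with C' show ?thesis using that by blast
qed

end

section \<open>Fourier inversion\<close>

lemma norm_fourier_phase [simp]: "cmod (exp (- (\<i> * complex_of_real x))) = 1"
  by (simp add: norm_exp_i_times[of "- x", simplified])

lemma norm_iexp: "cmod (exp (\<i> * complex_of_real x)) = 1"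
  by (rule norm_exp_i_times)

lemma fourier_measurable [measurable]:
  assumes [measurable]: "v \<in> borel_measurable borel"
  shows "fourier v \<in> borel_measurable borel"
  unfolding fourier_def by measurable

lemma integrable_fourier_integrand:
  assumes "integrable lborel v"
  shows "integrable lborel (\<lambda>t. exp (- (\<i> * complex_of_real (\<omega> * t))) * v t)"
  using assms by (rule Bochner_Integration.integrable_bound) (use assms in \<open>auto simp: norm_mult\<close>)

lemma norm_fourier_le:
  assumes "integrable lborel v"
  shows "cmod (fourier v \<omega>) \<le> (LINT t|lborel. cmod (v t))"
  unfolding fourier_def
  using integrable_fourier_integrand[OF assms] assms
  by (intro Bochner_Integration.integral_norm_bound_integral) (auto simp: norm_mult)

text \<open>Supplies the Fubini hypothesis for both exchanges of integration below, in the inversion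
  theorem and in the kernel estimate; the bounded factor is the Fourier phase.\<close>

lemma integrable_pair_mult:
  fixes f g :: "real \<Rightarrow> complex" and h :: "real \<Rightarrow> real \<Rightarrow> complex"
  assumes f: "integrable lborel f" and g: "integrable lborel g"
    and h: "case_prod h \<in> borel_measurable (lborel \<Otimes>\<^sub>M lborel)" and le: "\<And>x y. cmod (h x y) \<le> 1"
  shows "integrable (lborel \<Otimes>\<^sub>M lborel) (\<lambda>(x, y). f x * g y * h x y)"
proof -
  note [measurable] = borel_measurable_integrable[OF f] borel_measurable_integrable[OF g] h
  have fg: "integrable (lborel \<Otimes>\<^sub>M lborel) (\<lambda>(x, y). f x * g y)"
    by (rule lborel_pair.Fubini_integrable) (use f g in \<open>auto simp: norm_mult\<close>)
  show ?thesis
  proof (rule Bochner_Integration.integrable_bound[OF fg])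
    show "AE x in lborel \<Otimes>\<^sub>M lborel. norm (case x of (x, y) \<Rightarrow> f x * g y * h x y) \<le> norm (case x of (x, y) \<Rightarrow> f x * g y)"
      using le by (intro AE_I2) (auto simp: norm_mult intro!: mult_left_le)
  qed measurable
qed

section \<open>Gaussian regularisation and pointwise inversion\<close>

lemma gaussian_fourier:
  "(LINT x|lborel. std_normal_density x *\<^sub>R exp (\<i> * complex_of_real (t * x))) = complex_of_real (exp (- t\<^sup>2 / 2))"
proof -
  have "(LINT x|lborel. std_normal_density x *\<^sub>R exp (\<i> * complex_of_real (t * x))) = char std_normal_distribution t"
    unfolding char_def by (subst integral_density) auto
  then show ?thesis by (simp add: char_std_normal_distribution)
qed

lemma std_normal_density_le_1: "std_normal_density x \<le> 1"
proof -
  have "1 \<le> sqrt (2 * pi)" using pi_gt3 by simp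
  moreover have "exp (- x\<^sup>2 / 2) \<le> 1" by simp
  ultimately have "exp (- x\<^sup>2 / 2) \<le> sqrt (2 * pi)" by linarith
  then show ?thesis by (simp add: std_normal_density_def divide_simps)
qed

text \<open>A crude tail bound from s <= exp s. For x bounded away from 0 it decays like 1 / y
  uniformly, which is enough for the far part of an approximate identity.\<close>

lemma scaled_gaussian_le:
  assumes "y > 0" "x \<noteq> (0::real)"
  shows "y * std_normal_density (x * y) \<le> 2 / (x\<^sup>2 * y)"
proof -
  have "(x * y)\<^sup>2 / 2 \<le> exp ((x * y)\<^sup>2 / 2)" using exp_ge_add_one_self[of "(x * y)\<^sup>2 / 2"] by linarith
  then have "exp (- (x * y)\<^sup>2 / 2) \<le> 2 / (x * y)\<^sup>2"
    using assms by (simp add: exp_minus field_simps)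
  moreover have "1 \<le> sqrt (2 * pi)" using pi_gt3 by simp
  then have "std_normal_density (x * y) \<le> exp (- (x * y)\<^sup>2 / 2)"
    unfolding std_normal_density_def by (simp add: divide_simps)
  ultimately have "y * std_normal_density (x * y) \<le> y * (2 / (x * y)\<^sup>2)"
    using assms by (intro mult_left_mono) auto
  also have "\<dots> = 2 / (x\<^sup>2 * y)" using assms by (simp add: power2_eq_square)
  finally show ?thesis .
qed

text \<open>An approximate identity at a single point of continuity of an integrable function. Near
  t continuity makes the function bounded, so dominated convergence applies after rescaling; far
  from t the function may be unbounded, but the Gaussian is uniformly small there and the L1 norm
  suffices.\<close>

lemma gaussian_mean_tendsto:
  fixes v :: "real \<Rightarrow> complex"
  assumes v: "integrable lborel v" and cont: "isCont v t"
  shows "(\<lambda>n. LINT s|lborel. v s * complex_of_real (real (Suc n) * std_normal_density ((t - s) * real (Suc n)))) \<longlonglongrightarrow> v t"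
proof -
  note [measurable] = borel_measurable_integrable[OF v]
  obtain \<delta> where \<delta>: "\<delta> > 0" "\<And>s. \<bar>s - t\<bar> < \<delta> \<Longrightarrow> cmod (v s - v t) < 1"
    using cont[unfolded continuous_at_eps_delta, rule_format, of 1] by (auto simp: dist_norm)
  define near where "near = {t - \<delta><..<t + \<delta>}"
  have [measurable]: "near \<in> sets borel" by (simp add: near_def)
  define G where "G n s = complex_of_real (real (Suc n) * std_normal_density ((t - s) * real (Suc n)))" for n s
  have [measurable]: "G n \<in> borel_measurable borel" for n unfolding G_def by measurable
  have G_bound: "cmod (G n s) \<le> real (Suc n)" for n s
    using std_normal_density_le_1 by (simp add: G_def norm_mult mult_left_le del: of_nat_Suc)
  have int: "integrable lborel (\<lambda>s. w s * G n s)" if w: "integrable lborel w" for n w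
    using integrable_mult_right[OF w, of "of_nat (Suc n)"]
  proof (rule Bochner_Integration.integrable_bound)
    show "AE s in lborel. norm (w s * G n s) \<le> norm (of_nat (Suc n) * w s)"
    proof (intro AE_I2)
      fix s
      show "norm (w s * G n s) \<le> norm (of_nat (Suc n) * w s)"
        using mult_left_mono[OF G_bound[of n s], of "cmod (w s)"]
        by (simp add: norm_mult mult.commute del: of_nat_Suc)
    qed
  qed (use borel_measurable_integrable[OF w] in auto)
  define v1 where "v1 s = indicator near s * v s" for s
  define v2 where "v2 s = indicator (- near) s * v s" for s
  have [measurable]: "v1 \<in> borel_measurable borel" "v2 \<in> borel_measurable borel"
    unfolding v1_def v2_def by measurable
  have v12: "integrable lborel v1" "integrable lborel v2"
    unfolding v1_def v2_def by (auto intro!: Bochner_Integration.integrable_bound[OF v] simp: indicator_def)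
  have v1_bound: "cmod (v1 s) \<le> cmod (v t) + 1" for s
    using \<delta>(2)[of s] norm_triangle_sub[of "v s" "v t"] by (auto simp: v1_def indicator_def near_def abs_less_iff)
  have "(\<lambda>n. LINT s|lborel. v1 s * G n s) \<longlonglongrightarrow> v t"
  proof -
    \<comment> \<open>The substitution s = t - u / (n + 1) absorbs the factor n + 1 and leaves a
      fixed Gaussian weight, so that the moving argument sits in the bounded function
      \<open>v1\<close>.\<close>
    have "(LINT s|lborel. v1 s * G n s) = (LINT u|lborel. v1 (t + (- 1 / real (Suc n)) * u) * complex_of_real (std_normal_density u))" for n
      by (subst lborel_integral_real_affine[where c = "- 1 / real (Suc n)" and t = t])
         (auto simp: G_def scaleR_conv_of_real simp flip: integral_mult_right_zero simp del: of_nat_Suc)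
    moreover have "(\<lambda>n. LINT u|lborel. v1 (t + (- 1 / real (Suc n)) * u) * complex_of_real (std_normal_density u))
       \<longlonglongrightarrow> (LINT u|lborel. v t * complex_of_real (std_normal_density u))"
    proof (rule integral_dominated_convergence[where w = "\<lambda>u. (cmod (v t) + 1) * std_normal_density u"])
      show "AE u in lborel. (\<lambda>n. v1 (t + (- 1 / real (Suc n)) * u) * complex_of_real (std_normal_density u))
          \<longlonglongrightarrow> v t * complex_of_real (std_normal_density u)"
      proof (intro AE_I2 tendsto_mult tendsto_const)
        fix u :: real
        have "(\<lambda>n. t + (- 1 * inverse (real (Suc n))) * u) \<longlonglongrightarrow> t + (- 1 * 0) * u"
          by (intro tendsto_intros LIMSEQ_inverse_real_of_nat)
        then have lim: "(\<lambda>n. t + (- 1 / real (Suc n)) * u) \<longlonglongrightarrow> t" by (simp add: divide_inverse)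
        have "(\<lambda>n. v (t + (- 1 / real (Suc n)) * u)) \<longlonglongrightarrow> v t"
          using isCont_tendsto_compose[OF cont lim] .
        moreover have "\<forall>\<^sub>F n in sequentially. t + (- 1 / real (Suc n)) * u \<in> near"
          using \<delta> by (intro topological_tendstoD[OF lim]) (auto simp: near_def)
        then have "\<forall>\<^sub>F n in sequentially. v (t + (- 1 / real (Suc n)) * u) = v1 (t + (- 1 / real (Suc n)) * u)"
          by eventually_elim (simp add: v1_def)
        ultimately show "(\<lambda>n. v1 (t + (- 1 / real (Suc n)) * u)) \<longlonglongrightarrow> v t"
          by (rule Lim_transform_eventually)
      qed
      show "AE u in lborel. norm (v1 (t + (- 1 / real (Suc n)) * u) * complex_of_real (std_normal_density u))
          \<le> (cmod (v t) + 1) * std_normal_density u" for n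
        using v1_bound by (intro AE_I2) (auto simp: norm_mult intro!: mult_right_mono)
    qed (auto simp del: of_nat_Suc)
    ultimately show ?thesis by simp
  qed
  moreover have "(\<lambda>n. LINT s|lborel. v2 s * G n s) \<longlonglongrightarrow> 0"
  proof (rule Lim_null_comparison)
    define I where "I = (LINT s|lborel. cmod (v s))"
    show "\<forall>\<^sub>F n in sequentially. norm (LINT s|lborel. v2 s * G n s) \<le> 2 / \<delta>\<^sup>2 * I * inverse (real (Suc n))"
    proof (intro always_eventually allI)
      fix n
      have "norm (LINT s|lborel. v2 s * G n s) \<le> (LINT s|lborel. 2 / (\<delta>\<^sup>2 * real (Suc n)) * cmod (v s))"
      proof (rule Bochner_Integration.integral_norm_bound_integral)
        fix s
        show "norm (v2 s * G n s) \<le> 2 / (\<delta>\<^sup>2 * real (Suc n)) * cmod (v s)"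
        proof (cases "s \<in> near")
          case False
          then have d: "\<delta> \<le> \<bar>t - s\<bar>" using \<delta> by (auto simp: near_def)
          then have "\<delta>\<^sup>2 \<le> (t - s)\<^sup>2" using \<delta> by (metis abs_le_square_iff abs_of_pos)
          then have "2 / ((t - s)\<^sup>2 * real (Suc n)) \<le> 2 / (\<delta>\<^sup>2 * real (Suc n))"
            using \<delta>(1) d by (intro divide_left_mono mult_right_mono mult_pos_pos) auto
          moreover have "real (Suc n) * std_normal_density ((t - s) * real (Suc n)) \<le> 2 / ((t - s)\<^sup>2 * real (Suc n))"
            using d \<delta>(1) by (intro scaled_gaussian_le) auto
          ultimately have "real (Suc n) * std_normal_density ((t - s) * real (Suc n)) \<le> 2 / (\<delta>\<^sup>2 * real (Suc n))"
            by linarith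
          then have "cmod (G n s) \<le> 2 / (\<delta>\<^sup>2 * real (Suc n))"
            by (simp add: G_def norm_mult del: of_nat_Suc)
          then have "cmod (v s) * cmod (G n s) \<le> cmod (v s) * (2 / (\<delta>\<^sup>2 * real (Suc n)))"
            by (intro mult_left_mono) auto
          then show ?thesis using False
            by (simp add: v2_def norm_mult mult.commute[of _ "cmod (v s)"] del: of_nat_Suc)
        qed (auto simp: v2_def)
      qed (use int[OF v12(2)] v in auto)
      also have "\<dots> = 2 / \<delta>\<^sup>2 * I * inverse (real (Suc n))"
        by (simp add: I_def divide_inverse)
      finally show "norm (LINT s|lborel. v2 s * G n s) \<le> 2 / \<delta>\<^sup>2 * I * inverse (real (Suc n))" .
    qed
    have "(\<lambda>n. 2 / \<delta>\<^sup>2 * I * inverse (real (Suc n))) \<longlonglongrightarrow> 2 / \<delta>\<^sup>2 * I * 0"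
      by (intro tendsto_intros LIMSEQ_inverse_real_of_nat)
    then show "(\<lambda>n. 2 / \<delta>\<^sup>2 * I * inverse (real (Suc n))) \<longlonglongrightarrow> 0" by simp
  qed
  ultimately have "(\<lambda>n. (LINT s|lborel. v1 s * G n s) + (LINT s|lborel. v2 s * G n s)) \<longlonglongrightarrow> v t + 0"
    by (rule tendsto_add)
  moreover have "(LINT s|lborel. v1 s * G n s) + (LINT s|lborel. v2 s * G n s) = (LINT s|lborel. v s * G n s)" for n
    unfolding Bochner_Integration.integral_add[OF int[OF v12(1)] int[OF v12(2)], symmetric]
    by (intro Bochner_Integration.integral_cong) (auto simp: v1_def v2_def indicator_def)
  ultimately show ?thesis by (simp add: G_def)
qed

text \<open>The inverse integral is damped by the Gaussian \<open>\<phi> n\<close>. By Fubini it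
  becomes a Gaussian mean of v, which tends to v t by continuity, while the damping disappears by
  dominated convergence since the transform is integrable. \<open>\<phi> n\<close> tends to 1 / sqrt
  (2 * pi) rather than to 1; this factor and the one from the Gaussian transform combine to 2 * pi.
  Evaluating the double transform at -t avoids a separate inverse transform.\<close>

theorem fourier_inversion_at:
  fixes v :: "real \<Rightarrow> complex"
  assumes v: "integrable lborel v" and Fv: "integrable lborel (fourier v)" and cont: "isCont v t"
  shows "fourier (fourier v) (- t) = 2 * pi * v t"
proof -
  note [measurable] = borel_measurable_integrable[OF v] borel_measurable_integrable[OF Fv]
  define r where "r = sqrt (2 * pi)"
  define G where "G n s = complex_of_real (real (Suc n) * std_normal_density ((t - s) * real (Suc n)))" for n s
  define \<phi> where "\<phi> n \<omega> = complex_of_real (std_normal_density (\<omega> / real (Suc n)))" for n \<omega>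
  have [measurable]: "\<phi> n \<in> borel_measurable borel" for n unfolding \<phi>_def by measurable
  have \<phi>_int: "integrable lborel (\<phi> n)" for n
  proof -
    have "integrable lborel (\<lambda>\<omega>. std_normal_density (0 + 1 / real (Suc n) * \<omega>))"
      by (rule lborel_integrable_real_affine) auto
    then show ?thesis by (simp add: \<phi>_def[abs_def] del: of_nat_Suc)
  qed
  have eq: "(LINT \<omega>|lborel. exp (\<i> * complex_of_real (t * \<omega>)) * fourier v \<omega> * \<phi> n \<omega>) =
    (LINT s|lborel. v s * (complex_of_real (sqrt (2 * pi)) * G n s))" for n
  proof -
    define h where "h s \<omega> = exp (\<i> * complex_of_real ((t - s) * \<omega>))" for s \<omega> :: real
    have "(LINT \<omega>|lborel. exp (\<i> * complex_of_real (t * \<omega>)) * fourier v \<omega> * \<phi> n \<omega>)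
      = (LINT \<omega>|lborel. LINT s|lborel. v s * \<phi> n \<omega> * h s \<omega>)"
      unfolding fourier_def
      by (intro Bochner_Integration.integral_cong refl)
         (auto simp: h_def mult_ac algebra_simps exp_add[symmetric] simp flip: integral_mult_right_zero)
    also have "\<dots> = (LINT s|lborel. LINT \<omega>|lborel. v s * \<phi> n \<omega> * h s \<omega>)"
    proof (rule lborel_pair.Fubini_integral)
      show "integrable (lborel \<Otimes>\<^sub>M lborel) (\<lambda>(s, \<omega>). v s * \<phi> n \<omega> * h s \<omega>)"
        by (rule integrable_pair_mult[OF v \<phi>_int]) (auto simp: h_def norm_iexp)
    qed
    also have "\<dots> = (LINT s|lborel. v s * (complex_of_real (sqrt (2 * pi)) * G n s))"
    proof (intro Bochner_Integration.integral_cong refl)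
      fix s
      have "(LINT \<omega>|lborel. \<phi> n \<omega> * h s \<omega>) = complex_of_real (real (Suc n)) *
        (LINT x|lborel. std_normal_density x *\<^sub>R exp (\<i> * complex_of_real ((t - s) * real (Suc n) * x)))"
        by (subst lborel_integral_real_affine[where c = "real (Suc n)" and t = 0])
           (auto simp: \<phi>_def h_def scaleR_conv_of_real mult_ac simp del: of_nat_Suc)
      also have "\<dots> = complex_of_real (sqrt (2 * pi)) * G n s"
        unfolding gaussian_fourier by (simp add: G_def std_normal_density_def)
      finally show "(LINT \<omega>|lborel. v s * \<phi> n \<omega> * h s \<omega>) = v s * (complex_of_real (sqrt (2 * pi)) * G n s)"
        by (simp add: mult.assoc)
    qed
    finally show ?thesis .
  qed
  have "(\<lambda>n. LINT \<omega>|lborel. exp (\<i> * complex_of_real (t * \<omega>)) * fourier v \<omega> * \<phi> n \<omega>) \<longlonglongrightarrow>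
     (LINT \<omega>|lborel. exp (\<i> * complex_of_real (t * \<omega>)) * fourier v \<omega> * complex_of_real (1 / sqrt (2 * pi)))"
  proof (rule integral_dominated_convergence[where w = "\<lambda>\<omega>. cmod (fourier v \<omega>)"])
    show "AE \<omega> in lborel. (\<lambda>n. exp (\<i> * complex_of_real (t * \<omega>)) * fourier v \<omega> * \<phi> n \<omega>) \<longlonglongrightarrow>
      exp (\<i> * complex_of_real (t * \<omega>)) * fourier v \<omega> * complex_of_real (1 / sqrt (2 * pi))"
    proof (intro AE_I2 tendsto_mult tendsto_const)
      fix \<omega> :: real
      have "(\<lambda>n. \<omega> * inverse (real (Suc n))) \<longlonglongrightarrow> \<omega> * 0"
        by (intro tendsto_intros LIMSEQ_inverse_real_of_nat)
      then have "(\<lambda>n. \<omega> / real (Suc n)) \<longlonglongrightarrow> 0" by (simp add: divide_inverse)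
      moreover have "isCont std_normal_density 0" unfolding std_normal_density_def[abs_def]
        by (intro continuous_intros) auto
      ultimately have "(\<lambda>n. std_normal_density (\<omega> / real (Suc n))) \<longlonglongrightarrow> std_normal_density 0"
        by (rule isCont_tendsto_compose[where g = std_normal_density, rotated])
      then show "(\<lambda>n. \<phi> n \<omega>) \<longlonglongrightarrow> complex_of_real (1 / sqrt (2 * pi))"
        unfolding \<phi>_def by (intro tendsto_of_real) (simp add: std_normal_density_def)
    qed
    show "AE \<omega> in lborel. norm (exp (\<i> * complex_of_real (t * \<omega>)) * fourier v \<omega> * \<phi> n \<omega>) \<le> cmod (fourier v \<omega>)" for n
      using std_normal_density_le_1 by (intro AE_I2) (simp add: norm_mult \<phi>_def mult_left_le norm_iexp)
  qed (use Fv in auto)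
  moreover have "(\<lambda>n. LINT s|lborel. v s * (complex_of_real (sqrt (2 * pi)) * G n s)) \<longlonglongrightarrow> complex_of_real (sqrt (2 * pi)) * v t"
  proof -
    have "(LINT s|lborel. v s * (complex_of_real (sqrt (2 * pi)) * G n s)) =
      complex_of_real (sqrt (2 * pi)) * (LINT s|lborel. v s * G n s)" for n
      unfolding mult.left_commute[of "v _"] by (rule integral_mult_right_zero)
    then show ?thesis
      using tendsto_mult_left[OF gaussian_mean_tendsto[OF v cont], of "complex_of_real (sqrt (2 * pi))"]
      unfolding G_def by simp
  qed
  ultimately have "(LINT \<omega>|lborel. exp (\<i> * complex_of_real (t * \<omega>)) * fourier v \<omega> * complex_of_real (1 / sqrt (2 * pi)))
    = complex_of_real (sqrt (2 * pi)) * v t"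
    unfolding eq by (rule LIMSEQ_unique)
  then have "fourier (fourier v) (- t) * complex_of_real (1 / sqrt (2 * pi)) = complex_of_real (sqrt (2 * pi)) * v t"
    by (simp add: fourier_def[of "fourier v"])
  then have *: "fourier (fourier v) (- t) * complex_of_real (1 / r) = complex_of_real r * v t"
    by (simp only: r_def)
  have r: "r \<noteq> 0" "r * r = 2 * pi" by (simp_all add: r_def)
  have "fourier (fourier v) (- t) = complex_of_real r * (fourier (fourier v) (- t) * complex_of_real (1 / r))"
    using r(1) by simp
  also have "\<dots> = complex_of_real (r * r) * v t" unfolding * by simp
  finally show ?thesis by (simp only: r(2))
qed

text \<open>Differentiation under the integral with only a first moment of F. \<open>R\<close> is
  the first order Taylor remainder of the phase: its linear bound gives the dominating function 2
  |\<omega>| |F|, its quadratic bound the pointwise limit 0 after division by |h|.\<close>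

lemma fourier_has_vector_derivative:
  assumes F: "integrable lborel F" and F1: "integrable lborel (\<lambda>\<omega>. \<i> * complex_of_real \<omega> * F \<omega>)"
  shows "((\<lambda>t. fourier F (- t)) has_vector_derivative fourier (\<lambda>\<omega>. \<i> * complex_of_real \<omega> * F \<omega>) (- t)) (at t)"
proof -
  note [measurable] = borel_measurable_integrable[OF F]
  define R where "R h \<omega> = (exp (\<i> * complex_of_real (h * \<omega>)) - 1 - \<i> * complex_of_real (h * \<omega>))" for h \<omega> :: real
  have [measurable]: "R h \<in> borel_measurable borel" for h unfolding R_def by measurable
  have R1: "cmod (R h \<omega>) \<le> 2 * (\<bar>h\<bar> * \<bar>\<omega>\<bar>)" for h \<omega>
    using iexp_approx2[of "h * \<omega>" 1] by (simp add: R_def abs_mult algebra_simps)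
  have R2: "cmod (R h \<omega>) \<le> h\<^sup>2 * \<omega>\<^sup>2" for h \<omega>
  proof -
    have "cmod (R h \<omega>) \<le> (h * \<omega>)\<^sup>2 / 2"
      using iexp_approx1[of "h * \<omega>" 1] by (simp add: R_def algebra_simps numeral_2_eq_2)
    also have "\<dots> \<le> h\<^sup>2 * \<omega>\<^sup>2" by (simp add: power_mult_distrib)
    finally show ?thesis .
  qed
  have F1': "integrable lborel (\<lambda>\<omega>. \<bar>\<omega>\<bar> * cmod (F \<omega>))"
    using integrable_norm[OF F1] by (simp add: norm_mult)
  have RI: "integrable lborel (\<lambda>\<omega>. cmod (F \<omega>) * cmod (R h \<omega>))" for h
  proof (rule Bochner_Integration.integrable_bound[OF integrable_mult_right[OF F1', of "2 * \<bar>h\<bar>"]])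
    show "AE \<omega> in lborel. norm (cmod (F \<omega>) * cmod (R h \<omega>)) \<le> norm (2 * \<bar>h\<bar> * (\<bar>\<omega>\<bar> * cmod (F \<omega>)))"
    proof (intro AE_I2)
      fix \<omega>
      show "norm (cmod (F \<omega>) * cmod (R h \<omega>)) \<le> norm (2 * \<bar>h\<bar> * (\<bar>\<omega>\<bar> * cmod (F \<omega>)))"
        using mult_left_mono[OF R1[of h \<omega>], of "cmod (F \<omega>)"] by (simp add: abs_mult mult_ac)
    qed
  qed simp
  have lim: "((\<lambda>h. (LINT \<omega>|lborel. cmod (F \<omega>) * cmod (R h \<omega>)) / \<bar>h\<bar>) \<longlongrightarrow> 0) (at 0)"
    unfolding tendsto_at_iff_sequentially
  proof (intro allI impI)
    fix X :: "nat \<Rightarrow> real" assume X: "\<forall>i. X i \<in> UNIV - {0}" "X \<longlonglongrightarrow> 0"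
    have "(\<lambda>n. LINT \<omega>|lborel. cmod (F \<omega>) * cmod (R (X n) \<omega>) / \<bar>X n\<bar>) \<longlonglongrightarrow> integral\<^sup>L lborel (\<lambda>\<omega>::real. 0::real)"
    proof (rule integral_dominated_convergence[where w = "\<lambda>\<omega>. 2 * (\<bar>\<omega>\<bar> * cmod (F \<omega>))"])
      show "AE \<omega> in lborel. (\<lambda>n. cmod (F \<omega>) * cmod (R (X n) \<omega>) / \<bar>X n\<bar>) \<longlonglongrightarrow> 0"
      proof (intro AE_I2, rule Lim_null_comparison)
        fix \<omega>
        show "\<forall>\<^sub>F n in sequentially. norm (cmod (F \<omega>) * cmod (R (X n) \<omega>) / \<bar>X n\<bar>) \<le> cmod (F \<omega>) * \<omega>\<^sup>2 * \<bar>X n\<bar>"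
        proof (intro always_eventually allI)
          fix n
          have "cmod (R (X n) \<omega>) \<le> \<omega>\<^sup>2 * \<bar>X n\<bar> * \<bar>X n\<bar>"
            using R2[of "X n" \<omega>] by (simp add: power2_eq_square mult_ac)
          then have "cmod (R (X n) \<omega>) / \<bar>X n\<bar> \<le> \<omega>\<^sup>2 * \<bar>X n\<bar>" using X(1) by (simp add: divide_le_eq)
          from mult_left_mono[OF this, of "cmod (F \<omega>)"]
          show "norm (cmod (F \<omega>) * cmod (R (X n) \<omega>) / \<bar>X n\<bar>) \<le> cmod (F \<omega>) * \<omega>\<^sup>2 * \<bar>X n\<bar>"
            by (simp add: mult.assoc)
        qed
        show "(\<lambda>n. cmod (F \<omega>) * \<omega>\<^sup>2 * \<bar>X n\<bar>) \<longlonglongrightarrow> 0"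
          using tendsto_mult_left[OF tendsto_rabs[OF X(2)], of "cmod (F \<omega>) * \<omega>\<^sup>2"] by simp
      qed
      show "AE \<omega> in lborel. norm (cmod (F \<omega>) * cmod (R (X n) \<omega>) / \<bar>X n\<bar>) \<le> 2 * (\<bar>\<omega>\<bar> * cmod (F \<omega>))" for n
      proof (intro AE_I2)
        fix \<omega>
        have "cmod (R (X n) \<omega>) / \<bar>X n\<bar> \<le> 2 * \<bar>\<omega>\<bar>"
          using R1[of "X n" \<omega>] X(1) by (simp add: divide_le_eq mult_ac)
        from mult_left_mono[OF this, of "cmod (F \<omega>)"]
        show "norm (cmod (F \<omega>) * cmod (R (X n) \<omega>) / \<bar>X n\<bar>) \<le> 2 * (\<bar>\<omega>\<bar> * cmod (F \<omega>))"
          by (simp add: mult_ac)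
      qed
    qed (use F1' in auto)
    then show "((\<lambda>h. (LINT \<omega>|lborel. cmod (F \<omega>) * cmod (R h \<omega>)) / \<bar>h\<bar>) \<circ> X) \<longlonglongrightarrow> 0"
      by (simp add: o_def)
  qed
  show ?thesis
    unfolding has_vector_derivative_def has_derivative_at
  proof (intro conjI bounded_linear_scaleR_left)
    show "(\<lambda>h. norm (fourier F (- (t + h)) - fourier F (- t) - h *\<^sub>R fourier (\<lambda>\<omega>. \<i> * complex_of_real \<omega> * F \<omega>) (- t)) / norm h) \<midarrow>0\<rightarrow> 0"
    proof (rule Lim_null_comparison[OF always_eventually lim], rule allI)
      fix h
      have i: "integrable lborel (\<lambda>\<omega>. exp (- (\<i> * complex_of_real (- (t + h) * \<omega>))) * F \<omega>)"
        "integrable lborel (\<lambda>\<omega>. exp (- (\<i> * complex_of_real (- t * \<omega>))) * F \<omega>)"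
        "integrable lborel (\<lambda>\<omega>. exp (- (\<i> * complex_of_real (- t * \<omega>))) * (\<i> * complex_of_real \<omega> * F \<omega>))"
        by (intro integrable_fourier_integrand F F1)+
      have "fourier F (- (t + h)) - fourier F (- t) - h *\<^sub>R fourier (\<lambda>\<omega>. \<i> * complex_of_real \<omega> * F \<omega>) (- t)
        = (LINT \<omega>|lborel. exp (- (\<i> * complex_of_real (- (t + h) * \<omega>))) * F \<omega> - exp (- (\<i> * complex_of_real (- t * \<omega>))) * F \<omega>
           - h *\<^sub>R (exp (- (\<i> * complex_of_real (- t * \<omega>))) * (\<i> * complex_of_real \<omega> * F \<omega>)))"
        unfolding fourier_def using i by simp
      also have "\<dots> = (LINT \<omega>|lborel. exp (\<i> * complex_of_real (t * \<omega>)) * F \<omega> * R h \<omega>)"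
        by (intro Bochner_Integration.integral_cong refl)
           (simp add: R_def algebra_simps exp_add scaleR_conv_of_real)
      also have "norm \<dots> \<le> (LINT \<omega>|lborel. cmod (F \<omega>) * cmod (R h \<omega>))"
        by (rule integral_norm_bound[THEN order_trans])
           (simp add: norm_mult norm_iexp)
      finally show "norm (norm (fourier F (- (t + h)) - fourier F (- t) - h *\<^sub>R fourier (\<lambda>\<omega>. \<i> * complex_of_real \<omega> * F \<omega>) (- t)) / norm h)
         \<le> (LINT \<omega>|lborel. cmod (F \<omega>) * cmod (R h \<omega>)) / \<bar>h\<bar>"
        by (simp add: divide_right_mono)
    qed
  qed
qed

section \<open>Truncation error in time\<close>

lemma sum_by_parts_partial:
  fixes y :: "nat \<Rightarrow> complex"
  shows "(\<Sum>k\<le>n. g_coeff \<gamma> k *\<^sub>R y k) =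
    (\<Sum>k<n. g_partial \<gamma> k *\<^sub>R (y k - y (Suc k))) + g_partial \<gamma> n *\<^sub>R y n"
proof (induction n)
  case (Suc n)
  have "g_partial \<gamma> (Suc n) = g_partial \<gamma> n + g_coeff \<gamma> (Suc n)" by (simp add: g_partial_def)
  then show ?case using Suc by (simp add: algebra_simps)
qed (simp add: g_partial_def)

lemma vderiv_on_1:
  assumes "(f has_vector_derivative f') (at x within {a..b})" "x \<in> {a..b}" "a < b"
  shows "vderiv_on {a..b} 1 f x = f'"
  using vector_derivative_within_closed_interval[OF assms(3,2,1)] by simp

context
  fixes \<gamma> :: real
  assumes \<gamma>: "0 < \<gamma>" "\<gamma> < 1"
begin

lemma integrable_lower_weights:
  fixes F :: "real \<Rightarrow> complex"
  assumes [measurable]: "F \<in> borel_measurable borel"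
    and I: "integrable lborel (\<lambda>\<omega>. (1 + \<bar>\<omega>\<bar>) powr (1 + \<gamma>) * cmod (F \<omega>))"
  shows "integrable lborel F"
    and "integrable lborel (\<lambda>\<omega>. \<i> * complex_of_real \<omega> * F \<omega>)"
    and "(LINT \<omega>|lborel. cmod (F \<omega>)) \<le> (LINT \<omega>|lborel. (1 + \<bar>\<omega>\<bar>) powr (1 + \<gamma>) * cmod (F \<omega>))"
proof -
  have w: "1 \<le> (1 + \<bar>\<omega>\<bar>) powr (1 + \<gamma>)" "\<bar>\<omega>\<bar> \<le> (1 + \<bar>\<omega>\<bar>) powr (1 + \<gamma>)" for \<omega> :: real
    using powr_mono[of 0 "1 + \<gamma>" "1 + \<bar>\<omega>\<bar>"] powr_mono[of 1 "1 + \<gamma>" "1 + \<bar>\<omega>\<bar>"] \<gamma> by auto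
  have le: "cmod (F \<omega>) \<le> (1 + \<bar>\<omega>\<bar>) powr (1 + \<gamma>) * cmod (F \<omega>)"
    "\<bar>\<omega>\<bar> * cmod (F \<omega>) \<le> (1 + \<bar>\<omega>\<bar>) powr (1 + \<gamma>) * cmod (F \<omega>)" for \<omega>
    using mult_right_mono[OF w(1)[of \<omega>], of "cmod (F \<omega>)"] mult_right_mono[OF w(2)[of \<omega>], of "cmod (F \<omega>)"] by auto
  show *: "integrable lborel F"
    by (rule Bochner_Integration.integrable_bound[OF I]) (use le in auto)
  show "integrable lborel (\<lambda>\<omega>. \<i> * complex_of_real \<omega> * F \<omega>)"
    by (rule Bochner_Integration.integrable_bound[OF I]) (use le in \<open>auto simp: norm_mult\<close>)
  show "(LINT \<omega>|lborel. cmod (F \<omega>)) \<le> (LINT \<omega>|lborel. (1 + \<bar>\<omega>\<bar>) powr (1 + \<gamma>) * cmod (F \<omega>))"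
    using * I le by (intro integral_mono) auto
qed

text \<open>\<open>D\<close> at \<tau> * u - s is the derivative of the time function at s - \<tau>
  * u. Exchanging the integrals turns the u-integral into the kernel transform at \<tau> * \<omega>,
  of size \<open>\<tau> powr \<gamma> * \<bar>\<omega>\<bar> powr \<gamma>\<close>; with the
  |\<omega>| of the derivative this is exactly the weight available.\<close>

lemma kernel_convolution_bound:
  fixes F :: "real \<Rightarrow> complex"
  assumes C: "\<And>\<omega>. cmod (fourier (\<lambda>u. complex_of_real (gl_kernel \<gamma> u)) \<omega>) \<le> C * \<bar>\<omega>\<bar> powr \<gamma>" "C > 0"
    and [measurable]: "F \<in> borel_measurable borel"
    and I: "integrable lborel (\<lambda>\<omega>. (1 + \<bar>\<omega>\<bar>) powr (1 + \<gamma>) * cmod (F \<omega>))"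
    and \<tau>: "\<tau> > 0"
  defines "D \<equiv> fourier (\<lambda>\<omega>. \<i> * complex_of_real \<omega> * F \<omega>)"
  shows "integrable lborel (\<lambda>u. complex_of_real (gl_kernel \<gamma> u) * D (\<tau> * u - s))"
    and "cmod (LINT u|lborel. complex_of_real (gl_kernel \<gamma> u) * D (\<tau> * u - s))
      \<le> C * \<tau> powr \<gamma> * (LINT \<omega>|lborel. (1 + \<bar>\<omega>\<bar>) powr (1 + \<gamma>) * cmod (F \<omega>))"
proof -
  define f where "f u = complex_of_real (gl_kernel \<gamma> u)" for u
  define g where "g \<omega> = \<i> * complex_of_real \<omega> * F \<omega>" for \<omega>
  define h where "h u \<omega> = exp (- (\<i> * complex_of_real ((\<tau> * u - s) * \<omega>)))" for u \<omega> :: real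
  have f: "integrable lborel f" unfolding f_def using integrable_gl_kernel[OF \<gamma>] by auto
  have g: "integrable lborel g" unfolding g_def by (rule integrable_lower_weights[OF _ I]) auto
  have h: "case_prod h \<in> borel_measurable (lborel \<Otimes>\<^sub>M lborel)" unfolding h_def by measurable
  have int: "integrable (lborel \<Otimes>\<^sub>M lborel) (\<lambda>(u, \<omega>). f u * g \<omega> * h u \<omega>)"
    by (rule integrable_pair_mult[OF f g h]) (simp add: h_def)
  have inner: "(LINT \<omega>|lborel. f u * g \<omega> * h u \<omega>) = f u * D (\<tau> * u - s)" for u
    unfolding D_def fourier_def g_def h_def
    by (subst integral_mult_right_zero[symmetric]) (simp add: mult_ac)
  show "integrable lborel (\<lambda>u. complex_of_real (gl_kernel \<gamma> u) * D (\<tau> * u - s))"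
    using lborel_pair.integrable_fst'[OF int] by (simp add: inner) (simp add: f_def)
  have "(LINT u|lborel. f u * D (\<tau> * u - s)) = (LINT u|lborel. LINT \<omega>|lborel. f u * g \<omega> * h u \<omega>)"
    by (simp add: inner)
  also have "\<dots> = (LINT \<omega>|lborel. LINT u|lborel. f u * g \<omega> * h u \<omega>)"
    by (rule lborel_pair.Fubini_integral[OF int, symmetric])
  also have "\<dots> = (LINT \<omega>|lborel. g \<omega> * exp (\<i> * complex_of_real (s * \<omega>)) * fourier f (\<tau> * \<omega>))"
    unfolding fourier_def h_def
    by (subst integral_mult_right_zero[symmetric])
       (intro Bochner_Integration.integral_cong refl, simp add: exp_add[symmetric] algebra_simps)
  also have "cmod \<dots> \<le> (LINT \<omega>|lborel. C * \<tau> powr \<gamma> * ((1 + \<bar>\<omega>\<bar>) powr (1 + \<gamma>) * cmod (F \<omega>)))"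
  proof (rule order_trans[OF integral_norm_bound], rule integral_mono')
    fix \<omega> :: real
    have "cmod (fourier f (\<tau> * \<omega>)) \<le> C * (\<tau> powr \<gamma> * \<bar>\<omega>\<bar> powr \<gamma>)"
      using C(1)[of "\<tau> * \<omega>"] \<tau> by (simp add: f_def[abs_def] abs_mult powr_mult)
    then have "cmod (g \<omega> * exp (\<i> * complex_of_real (s * \<omega>)) * fourier f (\<tau> * \<omega>)) \<le>
        \<bar>\<omega>\<bar> * cmod (F \<omega>) * (C * (\<tau> powr \<gamma> * \<bar>\<omega>\<bar> powr \<gamma>))"
      by (simp add: norm_mult g_def norm_iexp mult_left_mono del: of_real_mult)
    also have "\<dots> = C * \<tau> powr \<gamma> * cmod (F \<omega>) * \<bar>\<omega>\<bar> powr (1 + \<gamma>)"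
      by (simp add: powr_add)
    also have "\<dots> \<le> C * \<tau> powr \<gamma> * cmod (F \<omega>) * (1 + \<bar>\<omega>\<bar>) powr (1 + \<gamma>)"
      using C(2) \<gamma> by (intro mult_left_mono powr_mono2) auto
    finally show "cmod (g \<omega> * exp (\<i> * complex_of_real (s * \<omega>)) * fourier f (\<tau> * \<omega>)) \<le>
      C * \<tau> powr \<gamma> * ((1 + \<bar>\<omega>\<bar>) powr (1 + \<gamma>) * cmod (F \<omega>))" by (simp add: mult_ac)
  qed (use I C(2) in auto)
  finally show "cmod (LINT u|lborel. complex_of_real (gl_kernel \<gamma> u) * D (\<tau> * u - s))
      \<le> C * \<tau> powr \<gamma> * (LINT \<omega>|lborel. (1 + \<bar>\<omega>\<bar>) powr (1 + \<gamma>) * cmod (F \<omega>))"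
    by (simp add: f_def)
qed

text \<open>Substituting \<xi> = n * \<tau> - \<tau> * u puts the Caputo integral on the scale of
  the step number, where it can be compared with the coefficient sum. The derivative in
  \<open>caputo\<close> is one-sided at the end points, and agreement with W on the closed interval
  determines it there.\<close>

lemma caputo_rescaled:
  fixes W D :: "real \<Rightarrow> complex"
  assumes W: "\<And>t. (W has_vector_derivative D t) (at t)" and w: "\<And>t. t \<in> {0..real n * \<tau>} \<Longrightarrow> w t = W t"
    and \<tau>: "\<tau> > 0" and n: "n \<ge> 1"
  shows "caputo \<gamma> w (real n * \<tau>) = (\<tau> powr (1 - \<gamma>) / Gamma (1 - \<gamma>)) *\<^sub>R
    (LINT u:{0..real n}|lborel. u powr (- \<gamma>) *\<^sub>R D (real n * \<tau> - \<tau> * u))"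
proof -
  let ?T = "real n * \<tau>"
  have T: "?T > 0" using \<tau> n by simp
  have "vderiv_on {0..?T} 1 w \<xi> = D \<xi>" if \<xi>: "\<xi> \<in> {0..?T}" for \<xi>
  proof (rule vderiv_on_1[OF _ \<xi> T])
    have "(W has_vector_derivative D \<xi>) (at \<xi> within {0..?T})"
      using W has_vector_derivative_at_within by blast
    then show "(w has_vector_derivative D \<xi>) (at \<xi> within {0..?T})"
      by (rule has_vector_derivative_transform[OF \<xi>, rotated]) (use w in auto)
  qed
  then have "(LINT \<xi>:{0..?T}|lborel. (?T - \<xi>) powr (- \<gamma>) *\<^sub>R vderiv_on {0..?T} 1 w \<xi>)
    = (LINT \<xi>:{0..?T}|lborel. (?T - \<xi>) powr (- \<gamma>) *\<^sub>R D \<xi>)"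
    by (intro set_lebesgue_integral_cong) auto
  also have "\<dots> = \<tau> *\<^sub>R (LINT u|lborel. indicator {0..?T} (?T - \<tau> * u) *\<^sub>R (\<tau> * u) powr (- \<gamma>) *\<^sub>R D (?T - \<tau> * u))"
    unfolding set_lebesgue_integral_def
    by (subst lborel_integral_real_affine[where c = "- \<tau>" and t = ?T]) (use \<tau> in auto)
  also have "\<dots> = \<tau> *\<^sub>R (LINT u|lborel. \<tau> powr (- \<gamma>) *\<^sub>R (indicator {0..real n} u *\<^sub>R u powr (- \<gamma>) *\<^sub>R D (?T - \<tau> * u)))"
  proof (intro arg_cong[where f = "scaleR \<tau>"] Bochner_Integration.integral_cong refl)
    fix u
    have "?T - \<tau> * u \<in> {0..?T} \<longleftrightarrow> u \<in> {0..real n}"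
      using \<tau> by (auto simp: zero_le_mult_iff mult.commute[of \<tau>])
    then show "indicator {0..?T} (?T - \<tau> * u) *\<^sub>R (\<tau> * u) powr (- \<gamma>) *\<^sub>R D (?T - \<tau> * u) =
      \<tau> powr (- \<gamma>) *\<^sub>R (indicator {0..real n} u *\<^sub>R u powr (- \<gamma>) *\<^sub>R D (?T - \<tau> * u))"
      using \<tau> by (auto simp: indicator_def powr_mult)
  qed
  also have "\<dots> = (\<tau> * \<tau> powr (- \<gamma>)) *\<^sub>R (LINT u:{0..real n}|lborel. u powr (- \<gamma>) *\<^sub>R D (?T - \<tau> * u))"
    unfolding set_lebesgue_integral_def integral_scaleR_right by (rule scaleR_scaleR)
  also have "\<tau> * \<tau> powr (- \<gamma>) = \<tau> powr (1 - \<gamma>)" using powr_add[of \<tau> 1 "- \<gamma>"] \<tau> by simp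
  finally show ?thesis unfolding caputo_def by simp
qed

text \<open>The constant is that of the kernel transform and precedes F, \<tau>, n and w, so it is
  uniform in the space point later on. Agreement of w with the Fourier integral is asked for only up
  to n * \<tau>, because the solution is known only up to T.\<close>

theorem gl_truncation_error:
  obtains C where "C > 0"
    "\<And>F \<tau> n w. \<lbrakk>F \<in> borel_measurable borel; integrable lborel (\<lambda>\<omega>. (1 + \<bar>\<omega>\<bar>) powr (1 + \<gamma>) * cmod (F \<omega>));
      \<tau> > 0; n \<ge> 1; \<And>t. t \<le> 0 \<Longrightarrow> fourier F (- t) = 0;
      \<And>t. t \<in> {0..real n * \<tau>} \<Longrightarrow> w t = fourier F (- t)\<rbrakk> \<Longrightarrow>
      cmod ((\<Sum>k\<le>n. (g_coeff \<gamma> k / \<tau> powr \<gamma>) *\<^sub>R w (real (n - k) * \<tau>)) - caputo \<gamma> w (real n * \<tau>))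
        \<le> C * \<tau> * (LINT \<omega>|lborel. (1 + \<bar>\<omega>\<bar>) powr (1 + \<gamma>) * cmod (F \<omega>))"
proof -
  obtain C where C: "C > 0" "\<And>\<omega>. cmod (fourier (\<lambda>u. complex_of_real (gl_kernel \<gamma> u)) \<omega>) \<le> C * \<bar>\<omega>\<bar> powr \<gamma>"
    by (rule fourier_gl_kernel_bound[OF \<gamma>]) blast
  have "cmod ((\<Sum>k\<le>n. (g_coeff \<gamma> k / \<tau> powr \<gamma>) *\<^sub>R w (real (n - k) * \<tau>)) - caputo \<gamma> w (real n * \<tau>))
        \<le> C * \<tau> * (LINT \<omega>|lborel. (1 + \<bar>\<omega>\<bar>) powr (1 + \<gamma>) * cmod (F \<omega>))"
    if [measurable]: "F \<in> borel_measurable borel" and I: "integrable lborel (\<lambda>\<omega>. (1 + \<bar>\<omega>\<bar>) powr (1 + \<gamma>) * cmod (F \<omega>))"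
      and \<tau>: "\<tau> > 0" and n: "n \<ge> 1" and zero: "\<And>t. t \<le> 0 \<Longrightarrow> fourier F (- t) = 0"
      and w: "\<And>t. t \<in> {0..real n * \<tau>} \<Longrightarrow> w t = fourier F (- t)" for F \<tau> n w
  proof -
    define W where "W t = fourier F (- t)" for t
    define D where "D = fourier (\<lambda>\<omega>. \<i> * complex_of_real \<omega> * F \<omega>)"
    have [measurable]: "D \<in> borel_measurable borel" unfolding D_def by measurable
    note int = integrable_lower_weights[OF _ I]
    have W: "(W has_vector_derivative D (- t)) (at t)" for t
      unfolding W_def D_def by (intro fourier_has_vector_derivative int) auto
    define v where "v u = D (\<tau> * u - real n * \<tau>)" for u
    have [measurable]: "v \<in> borel_measurable borel" unfolding v_def by measurable
    \<comment> \<open>W vanishes to the left of -t, so its left derivative at -t is 0.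
      Differentiability of W on the whole line makes this the full derivative, also at t = 0, where
      the zero part meets the solution.\<close>
    have D0: "D t = 0" if "t \<ge> 0" for t
    proof -
      have "(W has_vector_derivative D t) (at (- t) within {- t - 1..- t})"
        using W[of "- t"] has_vector_derivative_at_within by force
      moreover have "(W has_vector_derivative 0) (at (- t) within {- t - 1..- t})"
        by (rule has_vector_derivative_transform[of _ _ _ "\<lambda>_. 0"]) (use zero that in \<open>auto simp: W_def\<close>)
      ultimately show ?thesis
        using vector_derivative_unique_within_closed_interval[of "- t - 1" "- t" "- t" W] by simp
    qed
    obtain B where B: "B > 0" "\<And>u. cmod (v u) \<le> B"
    proof (rule that)
      have "integrable lborel (\<lambda>\<omega>. \<i> * complex_of_real \<omega> * F \<omega>)" by (rule int) auto
      then show "cmod (v u) \<le> 1 + (LINT \<omega>|lborel. cmod (\<i> * complex_of_real \<omega> * F \<omega>))" for u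
        using norm_fourier_le by (auto simp: v_def D_def intro: add_increasing)
      show "1 + (LINT \<omega>|lborel. cmod (\<i> * complex_of_real \<omega> * F \<omega>)) > 0"
        by (intro add_pos_nonneg) auto
    qed
    have pv: "set_integrable lborel {0..real n} (\<lambda>u. u powr (- \<gamma>) *\<^sub>R v u)"
      unfolding set_integrable_def
    proof (rule Bochner_Integration.integrable_bound)
      show "integrable lborel (\<lambda>u. B * (indicator {0<..real n} u *\<^sub>R u powr (- \<gamma>)))"
        using powr_integral_0(1)[OF \<gamma>, of "real n"] n unfolding set_integrable_def by (intro integrable_mult_right) auto
      show "AE u in lborel. norm (indicator {0..real n} u *\<^sub>R u powr (- \<gamma>) *\<^sub>R v u)
          \<le> norm (B * (indicator {0<..real n} u *\<^sub>R u powr (- \<gamma>)))"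
      proof (intro AE_I2)
        fix u :: real
        show "norm (indicator {0..real n} u *\<^sub>R u powr (- \<gamma>) *\<^sub>R v u)
          \<le> norm (B * (indicator {0<..real n} u *\<^sub>R u powr (- \<gamma>)))"
          using B(1) mult_left_mono[OF B(2)[of u], of "u powr (- \<gamma>)"]
          by (cases "u = 0") (auto simp: indicator_def mult.commute)
      qed
    qed simp
    note conv = kernel_convolution_bound[OF C(2) C(1) _ I \<tau>, folded D_def, of "real n * \<tau>", folded v_def]
    have ke: "set_integrable lborel {0..real n} (\<lambda>u. complex_of_real (gl_kernel \<gamma> u) * v u)"
      unfolding set_integrable_def using conv(1) by (intro integrable_mult_indicator) auto
    \<comment> \<open>Such u correspond to times (n - u) * \<tau> <= 0. Hence the mean-zero kernel
      may be integrated over the whole half line although the memory reaches back only to time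
      0.\<close>
    have v0: "v u = 0" if "u \<ge> real n" for u
      using that \<tau> by (auto simp: v_def mult.commute intro!: D0)
    have "(LINT u|lborel. complex_of_real (gl_kernel \<gamma> u) * v u) = (LINT u:{0..real n}|lborel. complex_of_real (gl_kernel \<gamma> u) * v u)"
      unfolding set_lebesgue_integral_def
      by (intro Bochner_Integration.integral_cong refl) (auto simp: indicator_def gl_kernel_def v0)
    also have "\<dots> = (LINT u:{0..real n}|lborel. g_partial \<gamma> (nat \<lfloor>u\<rfloor>) *\<^sub>R v u)
        - (LINT u:{0..real n}|lborel. (1 / Gamma (1 - \<gamma>)) *\<^sub>R (u powr (- \<gamma>) *\<^sub>R v u))"
    proof -
      \<comment> \<open>Equality fails in general at u = 0, where the left side is 0 by the
        conventions for \<open>gl_kernel\<close> and \<open>powr\<close> but the right side is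
        \<open>v 0\<close>.\<close>
      have eq: "AE u\<in>{0..real n} in lborel. complex_of_real (gl_kernel \<gamma> u) * v u + (1 / Gamma (1 - \<gamma>)) *\<^sub>R (u powr (- \<gamma>) *\<^sub>R v u)
         = g_partial \<gamma> (nat \<lfloor>u\<rfloor>) *\<^sub>R v u"
        using AE_lborel_singleton[of 0]
        by eventually_elim (auto simp: gl_kernel_def scaleR_conv_of_real algebra_simps)
      have pv': "set_integrable lborel {0..real n} (\<lambda>u. (1 / Gamma (1 - \<gamma>)) *\<^sub>R (u powr (- \<gamma>) *\<^sub>R v u))"
        using pv by (rule set_integrable_scaleR_right)
      have "(LINT u:{0..real n}|lborel. g_partial \<gamma> (nat \<lfloor>u\<rfloor>) *\<^sub>R v u)
        = (LINT u:{0..real n}|lborel. complex_of_real (gl_kernel \<gamma> u) * v u + (1 / Gamma (1 - \<gamma>)) *\<^sub>R (u powr (- \<gamma>) *\<^sub>R v u))"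
        by (rule set_lebesgue_integral_cong_AE[symmetric]) (use eq in auto)
      from this[unfolded set_integral_add(2)[OF ke pv']] show ?thesis
        unfolding eq_diff_eq by (rule sym)
    qed
    finally have split: "(LINT u:{0..real n}|lborel. g_partial \<gamma> (nat \<lfloor>u\<rfloor>) *\<^sub>R v u) =
      (LINT u|lborel. complex_of_real (gl_kernel \<gamma> u) * v u) +
      (1 / Gamma (1 - \<gamma>)) *\<^sub>R (LINT u:{0..real n}|lborel. u powr (- \<gamma>) *\<^sub>R v u)"
      by (simp del: scaleR_scaleR)
    have gi: "set_integrable lborel {0..real n} (\<lambda>u. g_partial \<gamma> (nat \<lfloor>u\<rfloor>) *\<^sub>R v u)"
    proof -
      have eq: "AE u\<in>{0..real n} in lborel. complex_of_real (gl_kernel \<gamma> u) * v u + (1 / Gamma (1 - \<gamma>)) *\<^sub>R (u powr (- \<gamma>) *\<^sub>R v u)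
         = g_partial \<gamma> (nat \<lfloor>u\<rfloor>) *\<^sub>R v u"
        using AE_lborel_singleton[of 0]
        by eventually_elim (auto simp: gl_kernel_def scaleR_conv_of_real algebra_simps)
      have "set_integrable lborel {0..real n} (\<lambda>u. complex_of_real (gl_kernel \<gamma> u) * v u + (1 / Gamma (1 - \<gamma>)) *\<^sub>R (u powr (- \<gamma>) *\<^sub>R v u))"
        by (rule set_integral_add(1)[OF ke set_integrable_scaleR_right[OF pv]])
      then show ?thesis
        by (subst (asm) set_integrable_cong_AE[where g = "\<lambda>u. g_partial \<gamma> (nat \<lfloor>u\<rfloor>) *\<^sub>R v u"]) (use eq in auto)
    qed
    \<comment> \<open>Values backwards in time. \<open>v\<close> is -1 / \<tau> times the derivative
      of the rescaled W, so each unit interval integrates to one difference of y; moreover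
      \<open>y n\<close> is W 0 = 0, which removes the boundary term.\<close>
    define y where "y k = W (real n * \<tau> - \<tau> * real k)" for k
    have step: "(v has_integral (1 / \<tau>) *\<^sub>R (y k - y (Suc k))) {real k..real k + 1}" for k
    proof -
      have "((\<lambda>u. - (1 / \<tau>) *\<^sub>R W (real n * \<tau> - \<tau> * u)) has_vector_derivative v u) (at u within A)" for u A
      proof -
        have "((\<lambda>u. real n * \<tau> - \<tau> * u) has_vector_derivative (- \<tau>)) (at u within A)"
          by (auto intro!: derivative_eq_intros)
        from vector_diff_chain_within[OF this has_vector_derivative_at_within[OF W]]
        have "((\<lambda>u. W (real n * \<tau> - \<tau> * u)) has_vector_derivative (- \<tau>) *\<^sub>R v u) (at u within A)"
          by (simp add: o_def v_def)
        from bounded_linear.has_vector_derivative[OF bounded_linear_scaleR_right[of "- (1 / \<tau>)"] this] show ?thesis using \<tau> by simp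
      qed
      from fundamental_theorem_of_calculus[OF _ this, of "real k" "real k + 1"]
      show ?thesis by (simp add: y_def algebra_simps)
    qed
    have "((\<lambda>u. g_partial \<gamma> (nat \<lfloor>u\<rfloor>) *\<^sub>R v u) has_integral (\<Sum>k<n. g_partial \<gamma> k *\<^sub>R ((1 / \<tau>) *\<^sub>R (y k - y (Suc k))))) {0..real n}"
      by (rule has_integral_step[OF step])
    then have gs: "(\<Sum>k<n. g_partial \<gamma> k *\<^sub>R ((1 / \<tau>) *\<^sub>R (y k - y (Suc k)))) = (LINT u:{0..real n}|lborel. g_partial \<gamma> (nat \<lfloor>u\<rfloor>) *\<^sub>R v u)"
      using set_borel_integral_eq_integral(2)[OF gi] integral_unique by metis
    have "(\<Sum>k\<le>n. (g_coeff \<gamma> k / \<tau> powr \<gamma>) *\<^sub>R w (real (n - k) * \<tau>)) = (1 / \<tau> powr \<gamma>) *\<^sub>R (\<Sum>k\<le>n. g_coeff \<gamma> k *\<^sub>R y k)"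
      unfolding scaleR_sum_right
    proof (intro sum.cong refl)
      fix k assume "k \<in> {..n}"
      then have "w (real (n - k) * \<tau>) = y k"
        using w[of "real (n - k) * \<tau>"] \<tau> by (simp add: y_def W_def of_nat_diff algebra_simps)
      then show "(g_coeff \<gamma> k / \<tau> powr \<gamma>) *\<^sub>R w (real (n - k) * \<tau>) = (1 / \<tau> powr \<gamma>) *\<^sub>R g_coeff \<gamma> k *\<^sub>R y k" by simp
    qed
    also have "(\<Sum>k\<le>n. g_coeff \<gamma> k *\<^sub>R y k) = (\<Sum>k<n. g_partial \<gamma> k *\<^sub>R (y k - y (Suc k)))"
      using zero[of 0] unfolding sum_by_parts_partial by (simp add: y_def W_def mult.commute)
    also have "\<dots> = \<tau> *\<^sub>R (\<Sum>k<n. g_partial \<gamma> k *\<^sub>R ((1 / \<tau>) *\<^sub>R (y k - y (Suc k))))"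
      using \<tau> by (simp add: scaleR_sum_right)
    also have "(1 / \<tau> powr \<gamma>) *\<^sub>R \<tau> *\<^sub>R (\<Sum>k<n. g_partial \<gamma> k *\<^sub>R ((1 / \<tau>) *\<^sub>R (y k - y (Suc k))))
       = \<tau> powr (1 - \<gamma>) *\<^sub>R (LINT u|lborel. complex_of_real (gl_kernel \<gamma> u) * v u) +
         (\<tau> powr (1 - \<gamma>) / Gamma (1 - \<gamma>)) *\<^sub>R (LINT u:{0..real n}|lborel. u powr (- \<gamma>) *\<^sub>R v u)"
      using \<tau> unfolding gs split by (simp add: powr_diff scaleR_add_right)
    also have "(\<tau> powr (1 - \<gamma>) / Gamma (1 - \<gamma>)) *\<^sub>R (LINT u:{0..real n}|lborel. u powr (- \<gamma>) *\<^sub>R v u) = caputo \<gamma> w (real n * \<tau>)"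
      by (subst caputo_rescaled[OF W _ \<tau> n]) (use w in \<open>auto simp: W_def v_def\<close>)
    finally have "(\<Sum>k\<le>n. (g_coeff \<gamma> k / \<tau> powr \<gamma>) *\<^sub>R w (real (n - k) * \<tau>)) - caputo \<gamma> w (real n * \<tau>)
      = \<tau> powr (1 - \<gamma>) *\<^sub>R (LINT u|lborel. complex_of_real (gl_kernel \<gamma> u) * v u)" by simp
    also have "cmod \<dots> \<le> \<tau> powr (1 - \<gamma>) * (C * \<tau> powr \<gamma> * (LINT \<omega>|lborel. (1 + \<bar>\<omega>\<bar>) powr (1 + \<gamma>) * cmod (F \<omega>)))"
      using conv(2) by (simp add: mult_left_mono)
    also have "\<dots> = C * (\<tau> powr (1 - \<gamma>) * \<tau> powr \<gamma>) * (LINT \<omega>|lborel. (1 + \<bar>\<omega>\<bar>) powr (1 + \<gamma>) * cmod (F \<omega>))"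
      by (simp only: mult_ac)
    also have "\<tau> powr (1 - \<gamma>) * \<tau> powr \<gamma> = \<tau>" using \<tau> by (simp add: powr_add[symmetric])
    finally show ?thesis .
  qed
  with C(1) show ?thesis using that by blast
qed

end

section \<open>Truncation error in space\<close>

lemma vderiv_on_has_vector_derivative:
  assumes "C_on k g {a..b}" "j < k" "y \<in> {a..b}"
  shows "(vderiv_on {a..b} j g has_vector_derivative vderiv_on {a..b} (Suc j) g y) (at y within {a..b})"
  using assms by (auto simp: C_on_def differentiable_on_def vector_derivative_works)

text \<open>The even function s -> g (x + s) + g (x - s) has vanishing odd derivatives at 0, so a
  single Taylor expansion at 0 produces the second difference directly. The integral form of the
  remainder is used because complex values exclude a mean value form; bounding it by h ^ 3 / 6 * 2 *
  B over an interval of length h gives B * h ^ 4 / 3.\<close>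

lemma central_difference_error:
  assumes g: "C_on 4 g {a..b}" and B: "\<And>y. y \<in> {a..b} \<Longrightarrow> cmod (vderiv_on {a..b} 4 g y) \<le> B"
    and h: "h > 0" and x: "a \<le> x - h" "x + h \<le> b"
  shows "cmod ((g (x + h) - 2 * g x + g (x - h)) / (complex_of_real h)\<^sup>2 - vderiv_on {a..b} 2 g x) \<le> B * h\<^sup>2 / 3"
proof -
  define D where "D j = vderiv_on {a..b} j g" for j
  define Df where "Df j s = D j (x + s) + (-1) ^ j *\<^sub>R D j (x - s)" for j s
  have D: "(D j has_vector_derivative D (Suc j) y) (at y within S)" if "j < 4" "y \<in> S" "S \<subseteq> {a..b}" for j y S
    using has_vector_derivative_within_subset[OF vderiv_on_has_vector_derivative[OF g that(1), of y] that(3)] that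
    by (auto simp: D_def)
  have Df: "(Df j has_vector_derivative Df (Suc j) s) (at s within {0..h})" if j: "j < 4" and s: "0 \<le> s" "s \<le> h" for j s
  proof -
    have p: "((\<lambda>s. x + s) has_vector_derivative 1) (at s within {0..h})"
      "((\<lambda>s. x - s) has_vector_derivative - 1) (at s within {0..h})"
      by (auto intro!: derivative_eq_intros)
    have "((D j \<circ> (\<lambda>s. x + s)) has_vector_derivative 1 *\<^sub>R D (Suc j) (x + s)) (at s within {0..h})"
      by (rule vector_diff_chain_within[OF p(1)], rule D) (use j s x in auto)
    moreover have "((D j \<circ> (\<lambda>s. x - s)) has_vector_derivative (- 1) *\<^sub>R D (Suc j) (x - s)) (at s within {0..h})"
      by (rule vector_diff_chain_within[OF p(2)], rule D) (use j s x in auto)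
    ultimately have "((\<lambda>s. (D j \<circ> (\<lambda>s. x + s)) s + (-1) ^ j *\<^sub>R (D j \<circ> (\<lambda>s. x - s)) s) has_vector_derivative
        1 *\<^sub>R D (Suc j) (x + s) + (-1) ^ j *\<^sub>R ((- 1) *\<^sub>R D (Suc j) (x - s))) (at s within {0..h})"
      by (intro has_vector_derivative_add bounded_linear.has_vector_derivative[OF bounded_linear_scaleR_right])
    then show ?thesis by (simp add: Df_def[abs_def])
  qed
  have "B \<ge> 0" using B[of x] h x by (auto intro: order_trans[OF norm_ge_zero])
  have sum: "(\<Sum>i<4. ((h - 0) ^ i / fact i) *\<^sub>R Df i 0) = 2 * g x + (complex_of_real h)\<^sup>2 * D 2 x"
    by (simp add: eval_nat_numeral Df_def D_def scaleR_conv_of_real algebra_simps)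
  have "((\<lambda>s. ((h - s) ^ (4 - 1) / fact (4 - 1)) *\<^sub>R Df 4 s) has_integral
      Df 0 h - (\<Sum>i<4. ((h - 0) ^ i / fact i) *\<^sub>R Df i 0)) {0..h}"
    using h by (intro Taylor_has_integral Df) auto
  moreover have "cmod (((h - s) ^ (4 - 1) / fact (4 - 1)) *\<^sub>R Df 4 s) \<le> h ^ 3 / 6 * (2 * B)" if s: "s \<in> {0..h}" for s
  proof -
    have "cmod (Df 4 s) \<le> cmod (D 4 (x + s)) + cmod (D 4 (x - s))"
      unfolding Df_def using norm_triangle_ineq by (simp add: norm_triangle_ineq)
    also have "\<dots> \<le> 2 * B" using B[of "x + s"] B[of "x - s"] s x by (simp add: D_def)
    finally have "cmod (Df 4 s) \<le> 2 * B" .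
    moreover have "(h - s) ^ 3 \<le> h ^ 3" using s by (intro power_mono) auto
    ultimately have "(h - s) ^ 3 / 6 * cmod (Df 4 s) \<le> h ^ 3 / 6 * (2 * B)"
      using h by (intro mult_mono divide_right_mono) auto
    then show ?thesis using s by (simp add: fact_numeral)
  qed
  ultimately have "cmod (Df 0 h - (\<Sum>i<4. ((h - 0) ^ i / fact i) *\<^sub>R Df i 0)) \<le> h ^ 3 / 6 * (2 * B) * measure lborel {0..h}"
    using \<open>B \<ge> 0\<close> h by (intro has_integral_bound_real) auto
  then have main: "cmod (g (x + h) + g (x - h) - (2 * g x + (complex_of_real h)\<^sup>2 * D 2 x)) \<le> B * h ^ 4 / 3"
    using h unfolding sum by (simp add: Df_def D_def eval_nat_numeral mult_ac)
  have "(g (x + h) - 2 * g x + g (x - h)) / (complex_of_real h)\<^sup>2 - D 2 x =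
      (g (x + h) + g (x - h) - (2 * g x + (complex_of_real h)\<^sup>2 * D 2 x)) / (complex_of_real h)\<^sup>2"
    using h by (simp add: field_simps)
  also have "cmod \<dots> = cmod (g (x + h) + g (x - h) - (2 * g x + (complex_of_real h)\<^sup>2 * D 2 x)) / h\<^sup>2"
    by (simp add: norm_divide norm_power)
  also have "\<dots> \<le> B * h ^ 4 / 3 / h\<^sup>2"
    using main by (intro divide_right_mono) auto
  also have "\<dots> = B * h\<^sup>2 / 3" using h by (simp add: eval_nat_numeral)
  finally show ?thesis by (simp add: D_def)
qed

section \<open>Stability\<close>

text \<open>Each off-diagonal product is at most half the sum of the two squares. After exchanging
  the sums over k and n, shifted and unshifted squares are each bounded by the full sum A, so the
  off-diagonal part is at most (sum of |d k|) * A <= d 0 * A. The gain appears only after summing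
  over all time levels. The multipliers enter through their modulus, hence oscillation caused by Im
  p is harmless.\<close>

lemma convolution_form_nonneg:
  fixes d :: "nat \<Rightarrow> real" and z y :: "nat \<Rightarrow> complex"
  assumes d: "(\<Sum>k=1..N. \<bar>d k\<bar>) \<le> d 0" and z: "z 0 = 1" "\<And>k. cmod (z k) \<le> 1" and y: "y 0 = 0"
  shows "0 \<le> (\<Sum>n=1..N. Re ((\<Sum>k=0..n. complex_of_real (d k) * z k * y (n - k)) * cnj (y n)))"
proof -
  define q where "q n = (cmod (y n))\<^sup>2" for n
  define A where "A = (\<Sum>n=1..N. q n)"
  have q: "q n \<ge> 0" "q 0 = 0" for n using y by (auto simp: q_def)
  have "A \<ge> 0" by (simp add: A_def q sum_nonneg)
  have ineq: "Re (complex_of_real (d k) * z k * y (n - k) * cnj (y n)) \<ge> - (\<bar>d k\<bar> * ((q (n - k) + q n) / 2))" for k n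
  proof -
    have "- Re (complex_of_real (d k) * z k * y (n - k) * cnj (y n)) \<le> cmod (complex_of_real (d k) * z k * y (n - k) * cnj (y n))"
      using abs_Re_le_cmod[of "complex_of_real (d k) * z k * y (n - k) * cnj (y n)"] by linarith
    also have "\<dots> = \<bar>d k\<bar> * (cmod (z k) * (cmod (y (n - k)) * cmod (y n)))" by (simp add: norm_mult mult_ac)
    also have "\<dots> \<le> \<bar>d k\<bar> * (1 * ((q (n - k) + q n) / 2))"
      using z(2)[of k] sum_squares_bound[of "cmod (y (n - k))" "cmod (y n)"]
      by (intro mult_left_mono mult_mono) (auto simp: q_def)
    finally show ?thesis by simp
  qed
  have lower: "d 0 * q n - (\<Sum>k=1..n. \<bar>d k\<bar> * ((q (n - k) + q n) / 2)) \<le>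
      Re ((\<Sum>k=0..n. complex_of_real (d k) * z k * y (n - k)) * cnj (y n))" for n
  proof -
    have "(\<Sum>k=0..n. complex_of_real (d k) * z k * y (n - k)) * cnj (y n) =
       complex_of_real (d 0) * (y n * cnj (y n)) + (\<Sum>k=1..n. complex_of_real (d k) * z k * y (n - k) * cnj (y n))"
      by (simp add: sum.atLeast_Suc_atMost z(1) distrib_right sum_distrib_right mult.assoc)
    then have "Re ((\<Sum>k=0..n. complex_of_real (d k) * z k * y (n - k)) * cnj (y n)) =
       d 0 * q n + (\<Sum>k=1..n. Re (complex_of_real (d k) * z k * y (n - k) * cnj (y n)))"
      by (simp add: q_def complex_mult_cnj cmod_power2 Re_sum)
    moreover have "(\<Sum>k=1..n. - (\<bar>d k\<bar> * ((q (n - k) + q n) / 2))) \<le>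
        (\<Sum>k=1..n. Re (complex_of_real (d k) * z k * y (n - k) * cnj (y n)))"
      by (intro sum_mono ineq)
    ultimately show ?thesis by (simp add: sum_negf)
  qed
  have S: "(\<Sum>n=1..N. \<Sum>k=1..n. \<bar>d k\<bar> * s n k) = (\<Sum>k=1..N. \<bar>d k\<bar> * (\<Sum>n=k..N. s n k))" for s :: "nat \<Rightarrow> nat \<Rightarrow> real"
  proof -
    have "(\<Sum>n=1..N. \<Sum>k=1..n. \<bar>d k\<bar> * s n k) = (\<Sum>n\<in>{1..N}. \<Sum>k | k \<in> {1..N} \<and> k \<le> n. \<bar>d k\<bar> * s n k)"
      by (intro sum.cong refl) auto
    also have "\<dots> = (\<Sum>k\<in>{1..N}. \<Sum>n | n \<in> {1..N} \<and> k \<le> n. \<bar>d k\<bar> * s n k)"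
      by (rule sum.swap_restrict) auto
    also have "\<dots> = (\<Sum>k=1..N. \<bar>d k\<bar> * (\<Sum>n=k..N. s n k))"
      unfolding sum_distrib_left by (intro sum.cong refl) auto
    finally show ?thesis .
  qed
  have "(\<Sum>n=k..N. q (n - k)) \<le> A" if "k \<in> {1..N}" for k
  proof -
    have "(\<Sum>n=k..N. q (n - k)) = (\<Sum>j=0..N-k. q j)"
      using that by (intro sum.reindex_bij_witness[of _ "\<lambda>j. j + k" "\<lambda>n. n - k"]) auto
    also have "\<dots> = (\<Sum>j=1..N-k. q j)" by (simp add: sum.atLeast_Suc_atMost q)
    also have "\<dots> \<le> A" unfolding A_def by (intro sum_mono2) (auto simp: q)
    finally show ?thesis .
  qed
  moreover have "(\<Sum>n=k..N. q n) \<le> A" if "k \<in> {1..N}" for k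
    unfolding A_def using that by (intro sum_mono2) (auto simp: q)
  ultimately have "(\<Sum>n=k..N. (q (n - k) + q n) / 2) \<le> A" if "k \<in> {1..N}" for k
    using that by (fastforce simp: sum.distrib simp flip: sum_divide_distrib)
  then have "(\<Sum>k=1..N. \<bar>d k\<bar> * (\<Sum>n=k..N. (q (n - k) + q n) / 2)) \<le> (\<Sum>k=1..N. \<bar>d k\<bar> * A)"
    by (intro sum_mono mult_left_mono) auto
  also have "\<dots> \<le> d 0 * A"
    using d \<open>A \<ge> 0\<close> by (simp add: sum_distrib_right[symmetric] mult_right_mono)
  finally have "0 \<le> (\<Sum>n=1..N. d 0 * q n - (\<Sum>k=1..n. \<bar>d k\<bar> * ((q (n - k) + q n) / 2)))"
    by (simp only: sum_subtractf S sum_distrib_left[symmetric] A_def[symmetric] diff_ge_0_iff_ge)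
  also have "\<dots> \<le> (\<Sum>n=1..N. Re ((\<Sum>k=0..n. complex_of_real (d k) * z k * y (n - k)) * cnj (y n)))"
    by (intro sum_mono lower)
  finally show ?thesis .
qed

text \<open>Induction on the upper limit with a boundary flux. At n = M - 1 the flux is -|w (M -
  1)|^2 because w M = 0, and this is precisely the missing last difference m = M.\<close>

lemma discrete_green:
  fixes w :: "nat \<Rightarrow> complex"
  assumes "w 0 = 0" "w M = 0" "M \<ge> 1"
  shows "(\<Sum>m=1..M-1. (w (m + 1) - 2 * w m + w (m - 1)) * cnj (w m)) = - complex_of_real (\<Sum>m=1..M. (cmod (w m - w (m - 1)))\<^sup>2)"
proof -
  have "(\<Sum>m=1..n. (w (m + 1) - 2 * w m + w (m - 1)) * cnj (w m)) =
     - (\<Sum>m=1..n. (w m - w (m - 1)) * cnj (w m - w (m - 1))) + (w (n + 1) - w n) * cnj (w n)" for n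
    by (induction n) (simp_all add: assms algebra_simps)
  moreover obtain n where n: "M = Suc n" using assms(3) by (cases M) auto
  ultimately show ?thesis
    unfolding of_real_sum complex_norm_square using assms(2) by (simp add: n)
qed

text \<open>Telescoping from the left end and Cauchy-Schwarz. With M = L / h, where L is the length
  of the interval, the right side is L times the squared discrete H1 seminorm, so the constant does
  not depend on h.\<close>

lemma discrete_sup_bound:
  fixes w :: "nat \<Rightarrow> complex"
  assumes "w 0 = 0" "m \<le> M"
  shows "(cmod (w m))\<^sup>2 \<le> real M * (\<Sum>j=1..M. (cmod (w j - w (j - 1)))\<^sup>2)"
proof -
  have "w m = (\<Sum>j=1..m. w j - w (j - 1))"
    using assms(1) by (induction m) auto
  then have "cmod (w m) \<le> (\<Sum>j=1..m. cmod (w j - w (j - 1)))"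
    by (metis norm_sum)
  then have "(cmod (w m))\<^sup>2 \<le> (\<Sum>j=1..m. cmod (w j - w (j - 1)))\<^sup>2"
    by (intro power_mono) auto
  also have "\<dots> \<le> (\<Sum>j=1..m. (cmod (w j - w (j - 1)))\<^sup>2) * real (card {1..m})"
    by (rule sum_squared_le_sum_of_squares)
  also have "\<dots> \<le> (\<Sum>j=1..M. (cmod (w j - w (j - 1)))\<^sup>2) * real M"
    using assms(2) by (intro mult_mono sum_mono2) (auto intro: sum_nonneg)
  finally show ?thesis by (simp add: mult.commute)
qed

text \<open>Nonnegativity of the memory form leaves only the Green term against the residual. The
  error factor in the residual term is bounded through the sup bound, and Young's inequality absorbs
  it into half of the Green term. No Gronwall argument is needed. With \<kappa> = K / h^2 the factor
  M ^ 3 / \<kappa>^2 is L ^ 3 * h / K^2, and this h cancels against the one in the norm.\<close>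

theorem energy_estimate:
  fixes e R :: "nat \<Rightarrow> nat \<Rightarrow> complex" and z :: "nat \<Rightarrow> nat \<Rightarrow> complex" and d :: "nat \<Rightarrow> real"
  assumes d: "(\<Sum>k=1..N. \<bar>d k\<bar>) \<le> d 0"
    and z: "\<And>m. z m 0 = 1" "\<And>m k. m \<in> {1..M-1} \<Longrightarrow> cmod (z m k) \<le> 1"
    and e: "\<And>m. e 0 m = 0" "\<And>n. e n 0 = 0" "\<And>n. e n M = 0"
    and \<kappa>: "\<kappa> > 0" and M: "M \<ge> 1"
    and scheme: "\<And>n m. n \<in> {1..N} \<Longrightarrow> m \<in> {1..M-1} \<Longrightarrow>
      (\<Sum>k=0..n. complex_of_real (d k) * z m k * e (n - k) m) =
        complex_of_real \<kappa> * (e n (m + 1) - 2 * e n m + e n (m - 1)) + R n m"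
    and R: "\<And>n m. n \<in> {1..N} \<Longrightarrow> m \<in> {1..M-1} \<Longrightarrow> cmod (R n m) \<le> \<rho>" and \<rho>: "\<rho> \<ge> 0"
  shows "(\<Sum>n=1..N. \<Sum>m=1..M. (cmod (e n m - e n (m - 1)))\<^sup>2) \<le> real N * (\<rho>\<^sup>2 * real M ^ 3 / \<kappa>\<^sup>2)"
proof -
  define Q where "Q n = (\<Sum>m=1..M. (cmod (e n m - e n (m - 1)))\<^sup>2)" for n
  have Q: "Q n \<ge> 0" for n by (simp add: Q_def sum_nonneg)
  have "0 \<le> (\<Sum>m=1..M-1. \<Sum>n=1..N. Re ((\<Sum>k=0..n. complex_of_real (d k) * z m k * e (n - k) m) * cnj (e n m)))"
  proof (intro sum_nonneg[of "{1..M-1}"])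
    fix m assume "m \<in> {1..M-1}"
    then have m: "cmod (z m k) \<le> 1" for k using z(2) by blast
    show "0 \<le> (\<Sum>n=1..N. Re ((\<Sum>k=0..n. complex_of_real (d k) * z m k * e (n - k) m) * cnj (e n m)))"
      by (rule convolution_form_nonneg[where z = "z m" and y = "\<lambda>n. e n m", OF d z(1) m]) (rule e)
  qed
  also have "\<dots> = (\<Sum>n=1..N. \<Sum>m=1..M-1. Re ((\<Sum>k=0..n. complex_of_real (d k) * z m k * e (n - k) m) * cnj (e n m)))"
    by (rule sum.swap)
  also have "\<dots> = (\<Sum>n=1..N. - \<kappa> * Q n + (\<Sum>m=1..M-1. Re (R n m * cnj (e n m))))"
  proof (intro sum.cong refl)
    fix n assume n: "n \<in> {1..N}"
    have "(\<Sum>m=1..M-1. Re ((\<Sum>k=0..n. complex_of_real (d k) * z m k * e (n - k) m) * cnj (e n m))) =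
      (\<Sum>m=1..M-1. Re (complex_of_real \<kappa> * ((e n (m + 1) - 2 * e n m + e n (m - 1)) * cnj (e n m)) + R n m * cnj (e n m)))"
    proof (intro sum.cong refl)
      fix m assume m: "m \<in> {1..M-1}"
      show "Re ((\<Sum>k=0..n. complex_of_real (d k) * z m k * e (n - k) m) * cnj (e n m)) =
        Re (complex_of_real \<kappa> * ((e n (m + 1) - 2 * e n m + e n (m - 1)) * cnj (e n m)) + R n m * cnj (e n m))"
        unfolding scheme[OF n m] by (simp only: distrib_right[of _ "R n m"] mult.assoc)
    qed
    also have "\<dots> = Re (complex_of_real \<kappa> * (\<Sum>m=1..M-1. (e n (m + 1) - 2 * e n m + e n (m - 1)) * cnj (e n m)))
       + (\<Sum>m=1..M-1. Re (R n m * cnj (e n m)))"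
      by (simp only: sum_distrib_left Re_sum plus_complex.sel sum.distrib)
    also have "(\<Sum>m=1..M-1. (e n (m + 1) - 2 * e n m + e n (m - 1)) * cnj (e n m)) = - complex_of_real (Q n)"
      unfolding Q_def by (rule discrete_green) (use e M in auto)
    finally show "(\<Sum>m=1..M-1. Re ((\<Sum>k=0..n. complex_of_real (d k) * z m k * e (n - k) m) * cnj (e n m))) =
      - \<kappa> * Q n + (\<Sum>m=1..M-1. Re (R n m * cnj (e n m)))" by simp
  qed
  also have "\<dots> \<le> (\<Sum>n=1..N. - \<kappa> * Q n + (\<kappa> / 2 * Q n + \<rho>\<^sup>2 * real M ^ 3 / (2 * \<kappa>)))"
  proof (intro sum_mono add_left_mono)
    fix n assume n: "n \<in> {1..N}"
    have "(\<Sum>m=1..M-1. Re (R n m * cnj (e n m))) \<le> (\<Sum>m=1..M-1. \<rho> * sqrt (real M * Q n))"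
    proof (intro sum_mono)
      fix m assume m: "m \<in> {1..M-1}"
      have "Re (R n m * cnj (e n m)) \<le> cmod (R n m) * cmod (e n m)"
        using complex_Re_le_cmod[of "R n m * cnj (e n m)"] by (simp add: norm_mult)
      also have "\<dots> \<le> \<rho> * sqrt (real M * Q n)"
        using R[OF n m] \<rho> discrete_sup_bound[of "e n" m M] m e
        by (intro mult_mono real_le_rsqrt) (auto simp: Q_def)
      finally show "Re (R n m * cnj (e n m)) \<le> \<rho> * sqrt (real M * Q n)" .
    qed
    also have "\<dots> \<le> real M * (\<rho> * sqrt (real M * Q n))"
      using \<rho> Q by (simp add: mult_right_mono)
    also have "\<dots> \<le> \<kappa> / 2 * Q n + \<rho>\<^sup>2 * real M ^ 3 / (2 * \<kappa>)"
    proof -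
      define s where "s = sqrt (Q n)"
      define r where "r = \<rho> * real M * sqrt (real M)"
      \<comment> \<open>The weight \<kappa> is chosen so that dividing by 2 * \<kappa> leaves
        exactly \<kappa> / 2 times \<open>Q n\<close>, half of what the Green term offers.\<close>
      have "0 \<le> (\<kappa> * s - r)\<^sup>2" by simp
      then have "2 * (\<kappa> * s * r) \<le> \<kappa>\<^sup>2 * s\<^sup>2 + r\<^sup>2" by (simp add: power2_diff power_mult_distrib)
      then have "s * r \<le> (\<kappa>\<^sup>2 * s\<^sup>2 + r\<^sup>2) / (2 * \<kappa>)" using \<kappa> by (simp add: field_simps)
      also have "\<dots> = \<kappa> / 2 * s\<^sup>2 + r\<^sup>2 / (2 * \<kappa>)" using \<kappa> by (simp add: field_simps power2_eq_square)
      also have "s\<^sup>2 = Q n" using Q by (simp add: s_def)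
      also have "r\<^sup>2 = \<rho>\<^sup>2 * real M ^ 3" by (simp add: r_def power_mult_distrib eval_nat_numeral)
      finally show ?thesis by (simp add: s_def r_def real_sqrt_mult mult_ac)
    qed
    finally show "(\<Sum>m=1..M-1. Re (R n m * cnj (e n m))) \<le> \<kappa> / 2 * Q n + \<rho>\<^sup>2 * real M ^ 3 / (2 * \<kappa>)" .
  qed
  also have "\<dots> = - (\<kappa> / 2) * (\<Sum>n=1..N. Q n) + real N * (\<rho>\<^sup>2 * real M ^ 3 / (2 * \<kappa>))"
    by (simp add: sum.distrib sum_subtractf sum_negf sum_distrib_left[symmetric] sum_divide_distrib[symmetric])
  finally have "\<kappa> / 2 * (\<Sum>n=1..N. Q n) \<le> real N * (\<rho>\<^sup>2 * real M ^ 3 / (2 * \<kappa>))" by simp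
  then have "(\<Sum>n=1..N. Q n) \<le> real N * (\<rho>\<^sup>2 * real M ^ 3 / (2 * \<kappa>)) / (\<kappa> / 2)"
    using \<kappa> by (subst pos_le_divide_eq) (auto simp: mult.commute)
  also have "\<dots> = real N * (\<rho>\<^sup>2 * real M ^ 3 / \<kappa>\<^sup>2)" by (simp add: power2_eq_square)
  finally show ?thesis by (simp add: Q_def)
qed

section \<open>Convergence\<close>

lemma continuous_on_zero_extension:
  fixes v :: "real \<Rightarrow> complex"
  assumes "continuous_on {0..T} v" "\<And>t. t \<le> 0 \<Longrightarrow> v t = 0" "0 < T"
  shows "continuous_on {..T} v"
proof -
  have "continuous_on {..0::real} v"
    using assms(2) by (subst continuous_on_cong[OF refl, of _ _ "\<lambda>_. 0"]) auto
  then have "continuous_on ({..0} \<union> {0..T}) v"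
    using assms(1) by (intro continuous_on_closed_Un) auto
  moreover have "{..0} \<union> {0..T} = {..T}" using assms(3) by auto
  ultimately show ?thesis by simp
qed

text \<open>Below T the function is continuous on a two-sided neighbourhood and the inversion
  theorem applies. At T the extension may jump to the right; there the double transform is
  continuous, being differentiable, and both sides have the same left limit. The last grid time is
  T, so this point cannot be skipped.\<close>

lemma S_class_inversion:
  fixes v :: "real \<Rightarrow> complex"
  assumes \<gamma>: "0 < \<gamma>" "\<gamma> < 1" and v: "v \<in> S_class \<gamma>" and cont: "continuous_on {..T} v" and t: "t \<le> T"
  shows "fourier (fourier v) (- t) = 2 * pi * v t"
proof -
  have int: "integrable lborel v" and S: "integrable lborel (\<lambda>\<omega>. (1 + \<bar>\<omega>\<bar>) powr (1 + \<gamma>) * cmod (fourier v \<omega>))"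
    using v by (auto simp: S_class_def S_weight_def[abs_def])
  note [measurable] = borel_measurable_integrable[OF int]
  note Fv = integrable_lower_weights(1,2)[OF \<gamma> _ S]
  define W where "W t = fourier (fourier v) (- t)" for t
  have eq: "W s = 2 * pi * v s" if "s < T" for s
  proof -
    have "continuous_on {..<T} v" using cont by (rule continuous_on_subset) auto
    then have "isCont v s" using that by (auto simp: continuous_on_eq_continuous_at)
    then show ?thesis unfolding W_def by (intro fourier_inversion_at int Fv) auto
  qed
  have "W T = 2 * pi * v T"
  proof (rule tendsto_unique)
    show "(W \<longlongrightarrow> W T) (at_left T)"
    proof -
      have "(W has_vector_derivative fourier (\<lambda>\<omega>. \<i> * complex_of_real \<omega> * fourier v \<omega>) (- T)) (at T)"
        unfolding W_def by (intro fourier_has_vector_derivative Fv) auto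
      then have "isCont W T" by (rule has_vector_derivative_continuous)
      then show ?thesis unfolding isCont_def by (rule filterlim_at_split[THEN iffD1, THEN conjunct1])
    qed
    have "(v \<longlongrightarrow> v T) (at T within {..T})" using cont by (auto simp: continuous_on_def)
    then have "(v \<longlongrightarrow> v T) (at_left T)" by (rule tendsto_within_subset) auto
    then have "((\<lambda>s. 2 * pi * v s) \<longlongrightarrow> 2 * pi * v T) (at_left T)" by (intro tendsto_intros)
    moreover have "\<forall>\<^sub>F s in at_left T. 2 * pi * v s = W s"
      using eq by (auto simp: eventually_at_filter)
    ultimately show "(W \<longlongrightarrow> 2 * pi * v T) (at_left T)" by (rule Lim_transform_eventually)
  qed simp
  with eq t show ?thesis by (cases "t = T") (auto simp: W_def)
qed

section \<open>Componentwise form of the difference scheme\<close>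

lemma M_mat_mult_index:
  assumes "v \<in> carrier_vec (M - 1)" "i < M - 1"
  shows "(M_mat p U a M h \<tau> k *\<^sub>v v) $ i =
    exp (- (p * complex_of_real (U (node a h (i + 1))) * of_nat k * complex_of_real \<tau>)) * v $ i"
  using assms by (simp add: M_mat_def mat_diag_def scalar_prod_def if_distrib[of "\<lambda>x. x * _"] sum.delta cong: if_cong)

text \<open>Entry i belongs to node i + 1, so its neighbours are nodes i and i + 2. In the first and
  last row one neighbour is missing from the matrix, which agrees with the boundary value 0 of
  \<open>zero_ext\<close>.\<close>

lemma H_mat_mult_index:
  assumes v: "v \<in> carrier_vec (M - 1)" and i: "i < M - 1"
  shows "(H_mat M h *\<^sub>v v) $ i =
    complex_of_real (1 / h\<^sup>2) * (zero_ext v (i + 2) - 2 * zero_ext v (i + 1) + zero_ext v i)"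
proof -
  define n where "n = M - 1"
  have "(H_mat M h *\<^sub>v v) $ i =
      (\<Sum>j=0..<n. complex_of_real (1 / h\<^sup>2) * (if i = j then - 2 else if i = Suc j then 1 else if j = Suc i then 1 else 0) * v $ j)"
    using v i by (simp add: H_mat_def tridiag_def scalar_prod_def n_def)
  also have "\<dots> = complex_of_real (1 / h\<^sup>2) * (\<Sum>j=0..<n. (if j = i then - 2 * v $ j else 0) +
      (if i = Suc j then v $ j else 0) + (if j = Suc i then v $ j else 0))"
    unfolding sum_distrib_left by (intro sum.cong refl) auto
  also have "(\<Sum>j=0..<n. (if j = i then - 2 * v $ j else 0) +
      (if i = Suc j then v $ j else 0) + (if j = Suc i then v $ j else 0)) =
      - 2 * v $ i + (\<Sum>j=0..<n. if i = Suc j then v $ j else 0) + (if Suc i < n then v $ (Suc i) else 0)"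
    using i by (simp add: sum.distrib sum.delta n_def)
  also have "(\<Sum>j=0..<n. if i = Suc j then v $ j else 0) = zero_ext v i"
    using i v by (cases i) (auto simp: n_def zero_ext_def sum.delta)
  finally show ?thesis using v i by (auto simp: zero_ext_def n_def)
qed

lemma fd_solution_index:
  assumes fd: "fd_solution \<gamma> lam K p U f a M N h \<tau> Gh" and n: "n \<in> {1..N}" and m: "m \<in> {1..M - 1}"
  shows "(\<Sum>k=0..n. complex_of_real (d_coeff \<gamma> lam \<tau> k / \<tau> powr \<gamma>) *
      exp (- (p * complex_of_real (U (node a h m)) * of_nat k * complex_of_real \<tau>)) * zero_ext (Gh (n - k)) m) =
    complex_of_real (K / h\<^sup>2) * (zero_ext (Gh n) (m + 1) - 2 * zero_ext (Gh n) m + zero_ext (Gh n) (m - 1))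
      + f (node a h m) p (real n * \<tau>)"
proof -
  define i where "i = m - 1"
  have i: "i < M - 1" "m = i + 1" using m by (auto simp: i_def)
  have carrier: "Gh j \<in> carrier_vec (M - 1)" if "j \<le> n" for j
    using fd n that by (cases "j = 0") (auto simp: fd_solution_def)
  have ze: "Gh j $ i = zero_ext (Gh j) m" if "j \<le> n" for j
    using carrier[OF that] i by (auto simp: zero_ext_def)
  have M: "M_mat p U a M h \<tau> k \<in> carrier_mat (M - 1) (M - 1)" for k by (simp add: M_mat_def)
  have H: "H_mat M h \<in> carrier_mat (M - 1) (M - 1)" by (simp add: H_mat_def tridiag_def)
  have "finsum_vec TYPE(complex) (M - 1)
          (\<lambda>k. complex_of_real (d_coeff \<gamma> lam \<tau> k / \<tau> powr \<gamma>) \<cdot>\<^sub>v (M_mat p U a M h \<tau> k *\<^sub>v Gh (n - k))) {0..n} $ i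
     = (\<Sum>k=0..n. (complex_of_real (d_coeff \<gamma> lam \<tau> k / \<tau> powr \<gamma>) \<cdot>\<^sub>v (M_mat p U a M h \<tau> k *\<^sub>v Gh (n - k))) $ i)"
    using M carrier i by (intro index_finsum_vec) (auto intro!: smult_carrier_vec[THEN iffD2] mult_mat_vec_carrier)
  also have "\<dots> = (\<Sum>k=0..n. complex_of_real (d_coeff \<gamma> lam \<tau> k / \<tau> powr \<gamma>) *
      exp (- (p * complex_of_real (U (node a h m)) * of_nat k * complex_of_real \<tau>)) * zero_ext (Gh (n - k)) m)"
  proof (intro sum.cong refl)
    fix k assume "k \<in> {0..n}"
    have c: "M_mat p U a M h \<tau> k *\<^sub>v Gh (n - k) \<in> carrier_vec (M - 1)"
      by (rule mult_mat_vec_carrier[OF M carrier]) simp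
    show "(complex_of_real (d_coeff \<gamma> lam \<tau> k / \<tau> powr \<gamma>) \<cdot>\<^sub>v (M_mat p U a M h \<tau> k *\<^sub>v Gh (n - k))) $ i =
      complex_of_real (d_coeff \<gamma> lam \<tau> k / \<tau> powr \<gamma>) *
      exp (- (p * complex_of_real (U (node a h m)) * of_nat k * complex_of_real \<tau>)) * zero_ext (Gh (n - k)) m"
    proof -
      have "i < dim_vec (M_mat p U a M h \<tau> k *\<^sub>v Gh (n - k))" using carrier_vecD[OF c] i by simp
      moreover have "(M_mat p U a M h \<tau> k *\<^sub>v Gh (n - k)) $ i =
          exp (- (p * complex_of_real (U (node a h m)) * of_nat k * complex_of_real \<tau>)) * zero_ext (Gh (n - k)) m"
        by (subst M_mat_mult_index[OF carrier i(1)]) (simp_all only: i(2)[symmetric] ze diff_le_self)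
      ultimately show ?thesis by (simp only: index_smult_vec(1) mult.assoc)
    qed
  qed
  finally have lhs: "\<dots> = finsum_vec TYPE(complex) (M - 1)
          (\<lambda>k. complex_of_real (d_coeff \<gamma> lam \<tau> k / \<tau> powr \<gamma>) \<cdot>\<^sub>v (M_mat p U a M h \<tau> k *\<^sub>v Gh (n - k))) {0..n} $ i" ..
  have c: "H_mat M h *\<^sub>v Gh n \<in> carrier_vec (M - 1)"
    by (rule mult_mat_vec_carrier[OF H carrier]) simp
  show ?thesis
  proof -
    have "finsum_vec TYPE(complex) (M - 1)
          (\<lambda>k. complex_of_real (d_coeff \<gamma> lam \<tau> k / \<tau> powr \<gamma>) \<cdot>\<^sub>v (M_mat p U a M h \<tau> k *\<^sub>v Gh (n - k))) {0..n} =
        complex_of_real K \<cdot>\<^sub>v (H_mat M h *\<^sub>v Gh n) + Matrix.vec (M - 1) (\<lambda>i. f (node a h (i + 1)) p (real n * \<tau>))"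
      using fd n unfolding fd_solution_def by blast
    then show ?thesis
      unfolding lhs using carrier_vecD[OF c] i H_mat_mult_index[OF carrier[OF order_refl] i(1), of h]
      by simp
  qed
qed

text \<open>Three contributions: the time truncation of w, the mismatch between
  \<open>lam powr \<gamma>\<close> and its discrete counterpart, and the central difference. The
  equation expresses f through G, so C is fixed before f and depends only on bounds for G and the
  data; the final + 1 makes it positive.\<close>

lemma consistency_error:
  fixes \<gamma> lam K T a b :: real
    and p :: complex
    and U :: "real \<Rightarrow> real"
    and G :: "real \<Rightarrow> complex \<Rightarrow> real \<Rightarrow> complex"
  assumes \<gamma>: "0 < \<gamma>" "\<gamma> < 1" and lam: "0 \<le> lam" and K: "0 < K" and T: "0 < T" and ab: "a < b"
    and p: "0 < Re p" and U: "\<forall>x\<in>{a..b}. 0 \<le> U x" and reg: "regular \<gamma> lam T a b p U G"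
  obtains C where "C > 0" "\<And>f h \<tau> x n. \<lbrakk>exact_solution \<gamma> lam K T a b p U f G; 0 < h; a \<le> x - h; x + h \<le> b;
      0 < \<tau>; 1 \<le> n; real n * \<tau> \<le> T\<rbrakk> \<Longrightarrow>
    cmod ((\<Sum>k=0..n. complex_of_real (d_coeff \<gamma> lam \<tau> k / \<tau> powr \<gamma>) *
        exp (- (p * complex_of_real (U x) * of_nat k * complex_of_real \<tau>)) * G x p (real (n - k) * \<tau>))
      - complex_of_real (K / h\<^sup>2) * (G (x + h) p (real n * \<tau>) - 2 * G x p (real n * \<tau>) + G (x - h) p (real n * \<tau>))
      - f x p (real n * \<tau>)) \<le> C * (\<tau> + h\<^sup>2)"
proof -
  obtain C0 where C0: "C0 > 0"
    "\<And>F \<tau> n w. \<lbrakk>F \<in> borel_measurable borel; integrable lborel (\<lambda>\<omega>. (1 + \<bar>\<omega>\<bar>) powr (1 + \<gamma>) * cmod (F \<omega>));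
      \<tau> > 0; n \<ge> 1; \<And>t. t \<le> 0 \<Longrightarrow> fourier F (- t) = 0;
      \<And>t. t \<in> {0..real n * \<tau>} \<Longrightarrow> w t = fourier F (- t)\<rbrakk> \<Longrightarrow>
      cmod ((\<Sum>k\<le>n. (g_coeff \<gamma> k / \<tau> powr \<gamma>) *\<^sub>R w (real (n - k) * \<tau>)) - caputo \<gamma> w (real n * \<tau>))
        \<le> C0 * \<tau> * (LINT \<omega>|lborel. (1 + \<bar>\<omega>\<bar>) powr (1 + \<gamma>) * cmod (F \<omega>))"
    by (rule gl_truncation_error[OF \<gamma>]) blast
  obtain B4 where B4: "\<And>t x. t \<in> {0..T} \<Longrightarrow> x \<in> {a..b} \<Longrightarrow> cmod (vderiv_on {a..b} 4 (\<lambda>y. G y p t) x) \<le> B4"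
    using reg unfolding regular_def by blast
  obtain v B where v: "\<And>x. x \<in> {a..b} \<Longrightarrow> v x \<in> S_class \<gamma>"
    "\<And>x t. x \<in> {a..b} \<Longrightarrow> t \<in> {0..T} \<Longrightarrow> v x t = exp ((complex_of_real lam + p * complex_of_real (U x)) * complex_of_real t) * G x p t"
    "\<And>x t. x \<in> {a..b} \<Longrightarrow> t \<le> 0 \<Longrightarrow> v x t = 0"
    "\<And>x. x \<in> {a..b} \<Longrightarrow> (LINT \<omega>|lborel. S_weight \<gamma> (v x) \<omega>) \<le> B"
    using reg unfolding regular_def by blast
  have C4: "C_on 4 (\<lambda>x. G x p t) {a..b}" if "t \<in> {0..T}" for t
    using reg that unfolding regular_def by blast
  have C1: "C_on 1 (\<lambda>t. G x p t) {0..T}" if "x \<in> {a..b}" for x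
    using reg that unfolding regular_def by blast
  have "B \<ge> 0" using v(4)[of a] ab by (auto intro!: order_trans[OF integral_nonneg_AE] simp: S_weight_def)
  have "B4 \<ge> 0" using B4[of 0 a] T ab by (auto intro: order_trans[OF norm_ge_zero])
  define C where "C = C0 * B + \<gamma> * lam * lam powr \<gamma> * B + K * B4 + 1"
  have "C > 0" using C0 \<gamma> lam K \<open>B \<ge> 0\<close> \<open>B4 \<ge> 0\<close> by (simp add: C_def add_nonneg_pos)
  moreover have "cmod ((\<Sum>k=0..n. complex_of_real (d_coeff \<gamma> lam \<tau> k / \<tau> powr \<gamma>) *
        exp (- (p * complex_of_real (U x) * of_nat k * complex_of_real \<tau>)) * G x p (real (n - k) * \<tau>))
      - complex_of_real (K / h\<^sup>2) * (G (x + h) p (real n * \<tau>) - 2 * G x p (real n * \<tau>) + G (x - h) p (real n * \<tau>))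
      - f x p (real n * \<tau>)) \<le> C * (\<tau> + h\<^sup>2)"
    if ex: "exact_solution \<gamma> lam K T a b p U f G" and h: "0 < h" "a \<le> x - h" "x + h \<le> b"
      and \<tau>: "0 < \<tau>" and n: "1 \<le> n" "real n * \<tau> \<le> T" for f h \<tau> x n
  proof -
    define t where "t = real n * \<tau>"
    have t: "t \<in> {0<..T}" "t \<in> {0..T}" using n \<tau> by (auto simp: t_def)
    have x: "x \<in> {a..b}" "x \<in> {a<..<b}" using h by auto
    define \<mu> where "\<mu> = complex_of_real lam + p * complex_of_real (U x)"
    define w where "w s = exp (\<mu> * complex_of_real s) * G x p s" for s
    \<comment> \<open>Division by 2 * pi normalises the inversion formula, so that
      \<open>fourier F (- s)\<close> is \<open>v x s\<close> itself.\<close>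
    define F where "F \<omega> = fourier (v x) \<omega> / complex_of_real (2 * pi)" for \<omega>
    have vw: "v x s = w s" if "s \<in> {0..T}" for s using v(2)[OF x(1) that] by (simp add: w_def \<mu>_def)
    have vint: "integrable lborel (v x)" and S: "integrable lborel (\<lambda>\<omega>. (1 + \<bar>\<omega>\<bar>) powr (1 + \<gamma>) * cmod (fourier (v x) \<omega>))"
      using v(1)[OF x(1)] by (auto simp: S_class_def S_weight_def[abs_def])
    note [measurable] = borel_measurable_integrable[OF vint]
    have [measurable]: "F \<in> borel_measurable borel" unfolding F_def by measurable
    have FS: "(1 + \<bar>\<omega>\<bar>) powr (1 + \<gamma>) * cmod (F \<omega>) = S_weight \<gamma> (v x) \<omega> / (2 * pi)" for \<omega>
      by (simp add: F_def S_weight_def norm_divide norm_mult)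
    have F: "integrable lborel (\<lambda>\<omega>. (1 + \<bar>\<omega>\<bar>) powr (1 + \<gamma>) * cmod (F \<omega>))"
      unfolding FS using v(1)[OF x(1)] by (simp add: S_class_def)
    have FB: "(LINT \<omega>|lborel. (1 + \<bar>\<omega>\<bar>) powr (1 + \<gamma>) * cmod (F \<omega>)) \<le> B"
    proof -
      have "(LINT \<omega>|lborel. S_weight \<gamma> (v x) \<omega>) / (2 * pi) \<le> B / 1"
        using v(4)[OF x(1)] \<open>B \<ge> 0\<close> pi_gt3 by (intro frac_le) auto
      then show ?thesis unfolding FS by simp
    qed
    have "continuous_on {0..T} (\<lambda>s. G x p s)"
      using C1[OF x(1)] by (auto simp: C_on_def intro: differentiable_imp_continuous_on)
    then have "continuous_on {0..T} w" unfolding w_def by (intro continuous_intros)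
    then have "continuous_on {0..T} (v x)"
      by (subst continuous_on_cong[OF refl vw]) auto
    then have cont: "continuous_on {..T} (v x)"
      using v(3)[OF x(1)] T by (intro continuous_on_zero_extension) auto
    have Fv: "fourier F (- s) = v x s" if "s \<le> T" for s
    proof -
      have "fourier F (- s) = fourier (fourier (v x)) (- s) / complex_of_real (2 * pi)"
        unfolding fourier_def[of F] F_def fourier_def[of "fourier (v x)"] by simp
      then show ?thesis using S_class_inversion[OF \<gamma> v(1)[OF x(1)] cont that] by simp
    qed
    define A where "A = (\<Sum>k\<le>n. (g_coeff \<gamma> k / \<tau> powr \<gamma>) *\<^sub>R w (real (n - k) * \<tau>))"
    have time: "cmod (A - caputo \<gamma> w t) \<le> C0 * \<tau> * B"
    proof -
      have "cmod (A - caputo \<gamma> w t) \<le> C0 * \<tau> * (LINT \<omega>|lborel. (1 + \<bar>\<omega>\<bar>) powr (1 + \<gamma>) * cmod (F \<omega>))"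
        unfolding A_def t_def
      proof (rule C0(2)[OF _ F \<tau> n(1)])
        show "fourier F (- s) = 0" if "s \<le> 0" for s
          using Fv[of s] v(3)[OF x(1) that] T that by simp
        show "w s = fourier F (- s)" if "s \<in> {0..real n * \<tau>}" for s
          using Fv[of s] vw[of s] n that by auto
      qed simp
      also have "\<dots> \<le> C0 * \<tau> * B" using C0(1) \<tau> FB by (intro mult_left_mono) auto
      finally show ?thesis .
    qed
    have expn: "cmod (exp (- (\<mu> * complex_of_real t))) \<le> 1"
      using lam p U x t by (simp add: \<mu>_def norm_exp_eq_Re)
    have Gw: "G x p s = exp (- (\<mu> * complex_of_real s)) * w s" for s
      by (simp add: w_def mult.assoc[symmetric] exp_add[symmetric])
    \<comment> \<open>A bound on w, and thereby on G, uniform in x and t, read off from the Fourier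
      integral.\<close>
    have wB: "cmod (w t) \<le> B"
    proof -
      have "cmod (w t) = cmod (fourier F (- t))" using vw[OF t(2)] Fv[of t] t by simp
      also have "\<dots> \<le> (LINT \<omega>|lborel. cmod (F \<omega>))"
        by (rule norm_fourier_le) (rule integrable_lower_weights[OF \<gamma> _ F], measurable)
      also have "\<dots> \<le> (LINT \<omega>|lborel. (1 + \<bar>\<omega>\<bar>) powr (1 + \<gamma>) * cmod (F \<omega>))"
        by (rule integrable_lower_weights[OF \<gamma> _ F]) measurable
      finally show ?thesis using FB by simp
    qed
    have GB: "cmod (G x p t) \<le> B"
      unfolding Gw norm_mult using mult_mono[OF expn wB] \<open>B \<ge> 0\<close> by simp
    \<comment> \<open>The amount by which the zeroth coefficient divided by
      \<open>\<tau> powr \<gamma>\<close> falls short of the plain one; the powers of \<tau> cancel,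
      leaving a perturbation of \<open>lam powr \<gamma>\<close>.\<close>
    define c where "c = exp (- (\<gamma> * lam * \<tau>)) * lam powr \<gamma>"
    \<comment> \<open>Moving from time t to (n - k) * \<tau> under the weight exp (\<mu> * s) costs
      exp (- \<mu> * k * \<tau>), which is the tempering factor times the diagonal entry of the k-th
      matrix. Only untempered coefficients acting on w remain.\<close>
    have summand: "complex_of_real (d_coeff \<gamma> lam \<tau> k / \<tau> powr \<gamma>) *
        exp (- (p * complex_of_real (U x) * of_nat k * complex_of_real \<tau>)) * G x p (real (n - k) * \<tau>) =
        exp (- (\<mu> * complex_of_real t)) * ((g_coeff \<gamma> k / \<tau> powr \<gamma>) *\<^sub>R w (real (n - k) * \<tau>))
        - (if k = 0 then complex_of_real c * G x p t else 0)" if k: "k \<le> n" for k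
    proof -
      have "real (n - k) * \<tau> = t - real k * \<tau>" using k by (simp add: t_def of_nat_diff algebra_simps)
      then have tk: "complex_of_real t = of_nat k * complex_of_real \<tau> + complex_of_real (real (n - k) * \<tau>)"
        by (metis (no_types) add.commute diff_add_cancel of_real_add of_real_mult of_real_of_nat_eq)
      have e: "exp (- (\<mu> * complex_of_real t)) * w (real (n - k) * \<tau>) = exp (- (\<mu> * (of_nat k * complex_of_real \<tau>))) * G x p (real (n - k) * \<tau>)"
        by (simp only: Gw tk distrib_left minus_add_distrib exp_add mult.assoc)
      have e2: "exp (- (\<mu> * (of_nat k * complex_of_real \<tau>))) = complex_of_real (exp (- (real k * lam * \<tau>))) *
          exp (- (p * complex_of_real (U x) * of_nat k * complex_of_real \<tau>))"
      proof -
        have "- (\<mu> * (of_nat k * complex_of_real \<tau>)) = complex_of_real (- (real k * lam * \<tau>)) +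
            - (p * complex_of_real (U x) * of_nat k * complex_of_real \<tau>)"
          by (simp add: \<mu>_def algebra_simps)
        then show ?thesis by (simp only: exp_add exp_of_real)
      qed
      have gd: "d_coeff \<gamma> lam \<tau> k / \<tau> powr \<gamma> = exp (- (real k * lam * \<tau>)) * (g_coeff \<gamma> k / \<tau> powr \<gamma>) - (if k = 0 then c else 0)"
        using \<tau> lam g_coeff_0[OF \<gamma>]
        by (cases "k = 0") (simp_all add: d_coeff_def g_tempered_def c_def powr_mult diff_divide_distrib)
      have "exp (- (\<mu> * complex_of_real t)) * ((g_coeff \<gamma> k / \<tau> powr \<gamma>) *\<^sub>R w (real (n - k) * \<tau>)) =
        complex_of_real (exp (- (real k * lam * \<tau>)) * (g_coeff \<gamma> k / \<tau> powr \<gamma>)) *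
          exp (- (p * complex_of_real (U x) * of_nat k * complex_of_real \<tau>)) * G x p (real (n - k) * \<tau>)"
        using e e2 by (simp add: scaleR_conv_of_real mult_ac)
      then show ?thesis unfolding gd by (simp add: t_def left_diff_distrib)
    qed
    have "(\<Sum>k=0..n. complex_of_real (d_coeff \<gamma> lam \<tau> k / \<tau> powr \<gamma>) *
        exp (- (p * complex_of_real (U x) * of_nat k * complex_of_real \<tau>)) * G x p (real (n - k) * \<tau>))
      = (\<Sum>k=0..n. exp (- (\<mu> * complex_of_real t)) * ((g_coeff \<gamma> k / \<tau> powr \<gamma>) *\<^sub>R w (real (n - k) * \<tau>))
        - (if k = 0 then complex_of_real c * G x p t else 0))"
      by (intro sum.cong refl summand) simp
    also have "\<dots> = exp (- (\<mu> * complex_of_real t)) * A - complex_of_real c * G x p t"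
      by (simp add: sum_subtractf sum_distrib_left A_def atLeast0AtMost sum.delta)
    finally have lhs: "(\<Sum>k=0..n. complex_of_real (d_coeff \<gamma> lam \<tau> k / \<tau> powr \<gamma>) *
        exp (- (p * complex_of_real (U x) * of_nat k * complex_of_real \<tau>)) * G x p (real (n - k) * \<tau>))
      = exp (- (\<mu> * complex_of_real t)) * A - complex_of_real c * G x p t" .
    define D2 where "D2 = vderiv_on {a..b} 2 (\<lambda>y. G y p t) x"
    define \<delta> where "\<delta> = (G (x + h) p t - 2 * G x p t + G (x - h) p t) / (complex_of_real h)\<^sup>2 - D2"
    have \<delta>: "cmod \<delta> \<le> B4 * h\<^sup>2 / 3"
      unfolding \<delta>_def D2_def using central_difference_error[OF C4[OF t(2)] B4[OF t(2)] h] .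
    have space: "complex_of_real (K / h\<^sup>2) * (G (x + h) p t - 2 * G x p t + G (x - h) p t) =
        complex_of_real K * (D2 + \<delta>)"
      using h by (simp add: \<delta>_def)
    have f: "f x p t = exp (- (\<mu> * complex_of_real t)) * caputo \<gamma> w t - complex_of_real (lam powr \<gamma>) * G x p t - complex_of_real K * D2"
    proof -
      have "exp (- (\<mu> * complex_of_real t)) * caputo \<gamma> w t - complex_of_real (lam powr \<gamma>) * G x p t =
          complex_of_real K * D2 + f x p t"
        using ex x(2) t(1) unfolding exact_solution_def D2_def w_def[abs_def] \<mu>_def by blast
      then show ?thesis by (simp add: algebra_simps)
    qed
    have c: "\<bar>lam powr \<gamma> - c\<bar> \<le> \<gamma> * lam * lam powr \<gamma> * \<tau>"
    proof -
      have "1 - exp (- (\<gamma> * lam * \<tau>)) \<le> \<gamma> * lam * \<tau>" using exp_ge_add_one_self[of "- (\<gamma> * lam * \<tau>)"] by linarith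
      then have "lam powr \<gamma> * (1 - exp (- (\<gamma> * lam * \<tau>))) \<le> lam powr \<gamma> * (\<gamma> * lam * \<tau>)" by (intro mult_left_mono) auto
      moreover have "0 \<le> lam powr \<gamma> * (1 - exp (- (\<gamma> * lam * \<tau>)))" using \<gamma> lam \<tau> by (intro mult_nonneg_nonneg) auto
      ultimately show ?thesis by (simp add: c_def algebra_simps)
    qed
    have "exp (- (\<mu> * complex_of_real t)) * A - complex_of_real c * G x p t
      - complex_of_real (K / h\<^sup>2) * (G (x + h) p t - 2 * G x p t + G (x - h) p t) - f x p t
      = exp (- (\<mu> * complex_of_real t)) * (A - caputo \<gamma> w t) + complex_of_real (lam powr \<gamma> - c) * G x p t - complex_of_real K * \<delta>"
      unfolding space f by (simp add: algebra_simps)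
    also have "cmod \<dots> \<le> cmod (exp (- (\<mu> * complex_of_real t)) * (A - caputo \<gamma> w t)) + cmod (complex_of_real (lam powr \<gamma> - c) * G x p t) + cmod (complex_of_real K * \<delta>)"
      by (rule order_trans[OF norm_triangle_ineq4 add_right_mono[OF norm_triangle_ineq]])
    also have "\<dots> \<le> C0 * \<tau> * B + \<gamma> * lam * lam powr \<gamma> * \<tau> * B + K * (B4 * h\<^sup>2 / 3)"
    proof (intro add_mono)
      show "cmod (exp (- (\<mu> * complex_of_real t)) * (A - caputo \<gamma> w t)) \<le> C0 * \<tau> * B"
        unfolding norm_mult using mult_mono[OF expn time] by simp
      show "cmod (complex_of_real (lam powr \<gamma> - c) * G x p t) \<le> \<gamma> * lam * lam powr \<gamma> * \<tau> * B"
        unfolding norm_mult norm_of_real using mult_mono[OF c GB] \<gamma> lam \<tau> by simp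
      show "cmod (complex_of_real K * \<delta>) \<le> K * (B4 * h\<^sup>2 / 3)"
        unfolding norm_mult using mult_left_mono[OF \<delta>, of K] K by simp
    qed
    also have "\<dots> \<le> C * (\<tau> + h\<^sup>2)"
    proof -
      have "K * (B4 * h\<^sup>2 / 3) \<le> K * (B4 * h\<^sup>2)" using K \<open>B4 \<ge> 0\<close> by (intro mult_left_mono) auto
      moreover have "0 \<le> C0 * B * h\<^sup>2" "0 \<le> \<gamma> * lam * lam powr \<gamma> * B * h\<^sup>2" "0 \<le> K * B4 * \<tau>" "0 \<le> \<tau> + h\<^sup>2"
        using C0 \<gamma> lam K \<tau> \<open>B \<ge> 0\<close> \<open>B4 \<ge> 0\<close> by auto
      ultimately show ?thesis by (simp add: C_def algebra_simps)
    qed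
    finally show ?thesis unfolding lhs[unfolded t_def] t_def .
  qed
  ultimately show ?thesis using that by blast
qed

text \<open>Both constants are quantified before f. The interior nodes and positive grid times at
  which the scheme samples f are points where the equation expresses f through G.\<close>

theorem theorem3p2:
  fixes \<gamma> lam K T a b :: real
    and p :: complex
    and U :: "real \<Rightarrow> real"
    and G :: "real \<Rightarrow> complex \<Rightarrow> real \<Rightarrow> complex"
  assumes "0 < \<gamma>" "\<gamma> < 1"
    and "0 \<le> lam"
    and "0 < K"
    and "0 < T"
    and "a < b"
    and "0 < Re p"
    and "\<forall>x\<in>{a..b}. 0 \<le> U x"
    and "bounded (U ` {a..b})"
    and "regular \<gamma> lam T a b p U G"
  shows "\<exists>c1>0. \<exists>c2>0. \<forall>f. exact_solution \<gamma> lam K T a b p U f G \<longrightarrow>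
    (\<forall>M\<ge>2. \<forall>N\<ge>1. \<forall>h \<tau> Gh.
       h = (b - a) / real M \<longrightarrow> \<tau> = T / real N \<longrightarrow>
       fd_solution \<gamma> lam K p U f a M N h \<tau> Gh \<longrightarrow>
         norm_0'_h_inf M N \<tau> (fd_error p G a M h \<tau> Gh) < c1 * (\<tau> + h\<^sup>2) \<and>
         norm_0_h_1 M N h \<tau> (fd_error p G a M h \<tau> Gh) < c2 * (\<tau> + h\<^sup>2))"
proof -
  obtain C where C: "C > 0" "\<And>f h \<tau> x n. \<lbrakk>exact_solution \<gamma> lam K T a b p U f G; 0 < h; a \<le> x - h; x + h \<le> b;
      0 < \<tau>; 1 \<le> n; real n * \<tau> \<le> T\<rbrakk> \<Longrightarrow>
    cmod ((\<Sum>k=0..n. complex_of_real (d_coeff \<gamma> lam \<tau> k / \<tau> powr \<gamma>) *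
        exp (- (p * complex_of_real (U x) * of_nat k * complex_of_real \<tau>)) * G x p (real (n - k) * \<tau>))
      - complex_of_real (K / h\<^sup>2) * (G (x + h) p (real n * \<tau>) - 2 * G x p (real n * \<tau>) + G (x - h) p (real n * \<tau>))
      - f x p (real n * \<tau>)) \<le> C * (\<tau> + h\<^sup>2)"
    by (rule consistency_error[OF assms(1-8,10)]) blast
  define L where "L = b - a"
  have L: "L > 0" using assms(6) by (simp add: L_def)
  \<comment> \<open>The square root of the factor left by the energy estimate after rescaling, with
    \<tau> * N = T and h * M = L inserted.\<close>
  define c where "c = C * sqrt (T * L ^ 3) / K"
  have c: "c > 0" using C(1) assms(4,5) L by (simp add: c_def)
  show ?thesis
  \<comment> \<open>The estimates themselves give <= with \<open>sqrt (T * L) * c\<close> and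
    \<open>c\<close>; adding 1 makes them strict because \<tau> + h^2 > 0.\<close>
  proof (rule exI[of _ "sqrt (T * L) * c + 1"], intro conjI exI[of _ "c + 1"] allI impI)
    show "0 < sqrt (T * L) * c + 1" using c assms(5) L by (simp add: add_nonneg_pos)
    show "0 < c + 1" using c by simp
    fix f M N h \<tau> Gh
    assume ex: "exact_solution \<gamma> lam K T a b p U f G" and M: "(2::nat) \<le> M" and N: "(1::nat) \<le> N"
      and h_def: "h = (b - a) / real M" and \<tau>_def: "\<tau> = T / real N"
      and fd: "fd_solution \<gamma> lam K p U f a M N h \<tau> Gh"
    define E where "E = fd_error p G a M h \<tau> Gh"
    define e where "e n m = zero_ext (E n) m" for n m
    have h: "h > 0" "h * real M = L" using M L by (auto simp: h_def L_def)
    have \<tau>: "\<tau> > 0" "\<tau> * real N = T" using N assms(5) by (auto simp: \<tau>_def)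
    have node: "node a h 0 = a" "node a h M = b" "node a h (m + 1) = node a h m + h"
      "m \<ge> 1 \<Longrightarrow> node a h (m - 1) = node a h m - h" "m \<le> M \<Longrightarrow> node a h m \<in> {a..b}" for m
    proof -
      show "m \<le> M \<Longrightarrow> node a h m \<in> {a..b}"
        using h mult_right_mono[of "real m" "real M" h] by (auto simp: node_def L_def mult.commute)
    qed (use h in \<open>auto simp: node_def L_def algebra_simps of_nat_diff\<close>)
    have bd: "G a p t = 0" "G b p t = 0" if "t \<in> {0..T}" for t
      using ex that by (auto simp: exact_solution_def)
    have tn: "real n * \<tau> \<in> {0..T}" if "n \<le> N" for n
      using mult_right_mono[of "real n" "real N" \<tau>] \<tau> that by (auto simp: mult.commute)
    have dimGh: "dim_vec (Gh n) = M - 1" if "n \<le> N" for n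
      using fd that by (cases "n = 0") (auto simp: fd_solution_def)
    have dimE: "dim_vec (E n) = M - 1" if "n \<le> N" for n
      using dimGh[OF that] by (simp add: E_def fd_error_def)
    have e: "e n m = G (node a h m) p (real n * \<tau>) - zero_ext (Gh n) m" if n: "n \<le> N" and m: "m \<le> M" for n m
    proof (cases "1 \<le> m \<and> m \<le> M - 1")
      case True
      then show ?thesis using dimGh[OF n] by (auto simp: e_def E_def zero_ext_def fd_error_def)
    next
      case False
      then have "m = 0 \<or> m = M" using m by auto
      then show ?thesis using dimGh[OF n] dimE[OF n] bd[OF tn[OF n]] node(1,2) M
        by (auto simp: e_def zero_ext_def)
    qed
    \<comment> \<open>Cut off beyond \<open>N\<close>, where the scheme does not even fix the dimension of \<open>Gh n\<close>.\<close>
    define en where "en n m = (if n \<le> N then e n m else 0)" for n m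
    have en0: "en 0 m = 0" for m
    proof (cases "1 \<le> m \<and> m \<le> M - 1")
      case True
      then have "G (node a h m) p 0 = 0"
        using ex node(5)[of m] by (auto simp: exact_solution_def)
      moreover have "zero_ext (Gh 0) m = 0" using fd True by (auto simp: fd_solution_def zero_ext_def)
      ultimately show ?thesis using e[of 0 m] True by (auto simp: en_def)
    qed (use dimE[of 0] in \<open>auto simp: en_def e_def zero_ext_def\<close>)
    define d where "d k = d_coeff \<gamma> lam \<tau> k / \<tau> powr \<gamma>" for k
    define z where "z m k = exp (- (p * complex_of_real (U (node a h m)) * of_nat k * complex_of_real \<tau>))" for m and k :: nat
    \<comment> \<open>The residual of the exact solution in the scheme. Subtracting the scheme
      leaves it as the only forcing of the error.\<close>
    define R where "R n m = (\<Sum>k=0..n. complex_of_real (d k) * z m k * G (node a h m) p (real (n - k) * \<tau>))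
      - complex_of_real (K / h\<^sup>2) * (G (node a h m + h) p (real n * \<tau>) - 2 * G (node a h m) p (real n * \<tau>) + G (node a h m - h) p (real n * \<tau>))
      - f (node a h m) p (real n * \<tau>)" for n m
    define \<rho> where "\<rho> = C * (\<tau> + h\<^sup>2)"
    have "(\<Sum>n=1..N. \<Sum>m=1..M. (cmod (en n m - en n (m - 1)))\<^sup>2) \<le> real N * (\<rho>\<^sup>2 * real M ^ 3 / (K / h\<^sup>2)\<^sup>2)"
    proof (rule energy_estimate[where d = d and z = z and R = R])
      show "(\<Sum>k=1..N. \<bar>d k\<bar>) \<le> d 0"
        using d_coeff_sum_le[OF assms(1-3) \<tau>(1), of N] \<tau>(1)
        by (simp add: d_def abs_divide sum_divide_distrib[symmetric] divide_right_mono)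
      show "z m 0 = 1" for m by (simp add: z_def)
      show "cmod (z m k) \<le> 1" if "m \<in> {1..M-1}" for m k
        using assms(7,8) node(5)[of m] that \<tau>(1) by (auto simp: z_def norm_exp_eq_Re)
      show "en 0 m = 0" for m by (rule en0)
      show "en n 0 = 0" "en n M = 0" for n using dimE[of n] M by (auto simp: en_def e_def zero_ext_def)
      show "K / h\<^sup>2 > 0" using assms(4) h by simp
      show "1 \<le> M" "\<rho> \<ge> 0" using M C(1) \<tau>(1) by (auto simp: \<rho>_def)
      fix n m assume n: "n \<in> {1..N}" and m: "m \<in> {1..M-1}"
      show "cmod (R n m) \<le> \<rho>"
        unfolding R_def d_def z_def \<rho>_def
      proof (rule C(2)[OF ex h(1)])
        show "a \<le> node a h m - h" using node(4,5)[of "m"] node(5)[of "m - 1"] m by auto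
        show "node a h m + h \<le> b" using node(3)[of m] node(5)[of "m + 1"] m by auto
      qed (use \<tau> n tn[of n] in auto)
      have "(\<Sum>k=0..n. complex_of_real (d k) * z m k * en (n - k) m) =
         (\<Sum>k=0..n. complex_of_real (d k) * z m k * G (node a h m) p (real (n - k) * \<tau>)) -
         (\<Sum>k=0..n. complex_of_real (d k) * z m k * zero_ext (Gh (n - k)) m)"
        unfolding sum_subtractf[symmetric]
      proof (intro sum.cong refl)
        fix k
        have "en (n - k) m = G (node a h m) p (real (n - k) * \<tau>) - zero_ext (Gh (n - k)) m"
        proof -
          have "n - k \<le> N" "m \<le> M" using n m by auto
          then show ?thesis using e by (simp add: en_def)
        qed
        then show "complex_of_real (d k) * z m k * en (n - k) m =
          complex_of_real (d k) * z m k * G (node a h m) p (real (n - k) * \<tau>) -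
          complex_of_real (d k) * z m k * zero_ext (Gh (n - k)) m"
          by (simp only: right_diff_distrib)
      qed
      also have "(\<Sum>k=0..n. complex_of_real (d k) * z m k * zero_ext (Gh (n - k)) m) =
         complex_of_real (K / h\<^sup>2) * (zero_ext (Gh n) (m + 1) - 2 * zero_ext (Gh n) m + zero_ext (Gh n) (m - 1)) + f (node a h m) p (real n * \<tau>)"
        unfolding d_def z_def by (rule fd_solution_index[OF fd n m])
      finally have lhs: "(\<Sum>k=0..n. complex_of_real (d k) * z m k * en (n - k) m) =
        (\<Sum>k=0..n. complex_of_real (d k) * z m k * G (node a h m) p (real (n - k) * \<tau>)) -
        (complex_of_real (K / h\<^sup>2) * (zero_ext (Gh n) (m + 1) - 2 * zero_ext (Gh n) m + zero_ext (Gh n) (m - 1)) + f (node a h m) p (real n * \<tau>))" .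
      have nm: "n \<le> N" "m \<le> M" "m + 1 \<le> M" "m - 1 \<le> M" "m \<ge> 1" using n m by auto
      have en: "en n m = G (node a h m) p (real n * \<tau>) - zero_ext (Gh n) m"
        "en n (m + 1) = G (node a h m + h) p (real n * \<tau>) - zero_ext (Gh n) (m + 1)"
        "en n (m - 1) = G (node a h m - h) p (real n * \<tau>) - zero_ext (Gh n) (m - 1)"
        using e[OF nm(1,2)] e[OF nm(1,3)] e[OF nm(1,4)] nm(1) unfolding en_def node(3) node(4)[OF nm(5)] by simp_all
      show "(\<Sum>k=0..n. complex_of_real (d k) * z m k * en (n - k) m) =
        complex_of_real (K / h\<^sup>2) * (en n (m + 1) - 2 * en n m + en n (m - 1)) + R n m"
        unfolding lhs en R_def by (simp add: algebra_simps)
    qed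
    also have "(\<Sum>n=1..N. \<Sum>m=1..M. (cmod (en n m - en n (m - 1)))\<^sup>2) = (\<Sum>n=1..N. h * (seminorm_h_1 M h (E n))\<^sup>2)"
    proof (intro sum.cong refl)
      fix n assume n: "n \<in> {1..N}"
      have "(seminorm_h_1 M h (E n))\<^sup>2 = h * (\<Sum>m=1..M. (cmod ((e n m - e n (m - 1)) / complex_of_real h))\<^sup>2)"
        unfolding seminorm_h_1_def e_def using h(1)
        by (intro real_sqrt_pow2 mult_nonneg_nonneg sum_nonneg) auto
      also have "\<dots> = h * ((\<Sum>m=1..M. (cmod (e n m - e n (m - 1)))\<^sup>2) / h\<^sup>2)"
        using h by (simp add: norm_divide power_divide sum_divide_distrib)
      finally show "(\<Sum>m=1..M. (cmod (en n m - en n (m - 1)))\<^sup>2) = h * (seminorm_h_1 M h (E n))\<^sup>2"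
        using h n by (simp add: en_def power2_eq_square)
    qed
    also have "\<dots> = h / \<tau> * (norm_0_h_1 M N h \<tau> E)\<^sup>2"
      using \<tau> unfolding norm_0_h_1_def by (simp add: sum_nonneg sum_distrib_left mult_ac)
    finally have *: "h / \<tau> * (norm_0_h_1 M N h \<tau> E)\<^sup>2 \<le> real N * (\<rho>\<^sup>2 * real M ^ 3 / (K / h\<^sup>2)\<^sup>2)" .
    have "(norm_0_h_1 M N h \<tau> E)\<^sup>2 = \<tau> / h * (h / \<tau> * (norm_0_h_1 M N h \<tau> E)\<^sup>2)"
      using h(1) \<tau>(1) by simp
    also have "\<dots> \<le> \<tau> / h * (real N * (\<rho>\<^sup>2 * real M ^ 3 / (K / h\<^sup>2)\<^sup>2))"
      using * h(1) \<tau>(1) by (intro mult_left_mono) auto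
    \<comment> \<open>All powers of the mesh sizes combine into \<tau> * N = T and h * M = L, so
      apart from \<rho> nothing depends on M or N.\<close>
    also have "\<dots> = (\<tau> * real N) * (h * real M) ^ 3 * \<rho>\<^sup>2 / K\<^sup>2"
      using h by (simp add: field_simps power2_eq_square power3_eq_cube)
    also have "\<dots> = (c * (\<tau> + h\<^sup>2))\<^sup>2"
      unfolding h(2) \<tau>(2) using assms(5) L by (simp add: c_def \<rho>_def power_mult_distrib power_divide)
    finally have N1: "norm_0_h_1 M N h \<tau> E \<le> c * (\<tau> + h\<^sup>2)"
      by (rule power2_le_imp_le) (use c \<tau> in auto)
    have sup: "norm_h_inf M (E n) \<le> sqrt L * seminorm_h_1 M h (E n)" if "n \<in> {1..N}" for n
      unfolding norm_h_inf_def
    proof (rule Max.boundedI)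
      fix y assume "y \<in> (\<lambda>m. cmod (zero_ext (E n) m)) ` {1..M - 1}"
      then obtain m where m: "y = cmod (e n m)" "m \<le> M" by (auto simp: e_def)
      have "y\<^sup>2 \<le> real M * (\<Sum>j=1..M. (cmod (e n j - e n (j - 1)))\<^sup>2)"
        unfolding m(1) by (rule discrete_sup_bound[OF _ m(2)]) (simp add: e_def zero_ext_def)
      also have "\<dots> = L * (h * (\<Sum>m=1..M. (cmod ((e n m - e n (m - 1)) / complex_of_real h))\<^sup>2))"
        using h by (simp add: norm_divide power_divide sum_divide_distrib[symmetric] power2_eq_square flip: h(2))
      finally have "y \<le> sqrt (L * (h * (\<Sum>m=1..M. (cmod ((e n m - e n (m - 1)) / complex_of_real h))\<^sup>2)))"
        by (rule real_le_rsqrt)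
      then show "y \<le> sqrt L * seminorm_h_1 M h (E n)"
        by (simp add: seminorm_h_1_def e_def real_sqrt_mult)
    qed (use M in auto)
    have "norm_0'_h_inf M N \<tau> E \<le> (\<Sum>n=1..N. sqrt L * seminorm_h_1 M h (E n) * \<tau>)"
      unfolding norm_0'_h_inf_def using sup \<tau> by (intro sum_mono mult_right_mono) auto
    also have "\<dots> = sqrt L * \<tau> * (\<Sum>n=1..N. seminorm_h_1 M h (E n))"
      by (simp add: sum_distrib_left mult_ac)
    also have "\<dots> \<le> sqrt (T * L) * norm_0_h_1 M N h \<tau> E"
    proof -
      \<comment> \<open>Cauchy-Schwarz in time: \<tau> * N = T bounds the plain sum over the levels
        by the square root of the sum of squares.\<close>
      have "(\<Sum>n=1..N. seminorm_h_1 M h (E n))\<^sup>2 \<le> (\<Sum>n=1..N. (seminorm_h_1 M h (E n))\<^sup>2) * real (card {1..N})"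
        by (rule sum_squared_le_sum_of_squares)
      then have "\<tau>\<^sup>2 * (\<Sum>n=1..N. seminorm_h_1 M h (E n))\<^sup>2 \<le> \<tau>\<^sup>2 * ((\<Sum>n=1..N. (seminorm_h_1 M h (E n))\<^sup>2) * real N)"
        by (intro mult_left_mono) auto
      also have "\<dots> = (\<tau> * real N) * (\<Sum>n=1..N. (seminorm_h_1 M h (E n))\<^sup>2 * \<tau>)"
        by (simp add: power2_eq_square sum_distrib_left mult_ac)
      finally have "\<tau> * (\<Sum>n=1..N. seminorm_h_1 M h (E n)) \<le> sqrt (T * (\<Sum>n=1..N. (seminorm_h_1 M h (E n))\<^sup>2 * \<tau>))"
        unfolding \<tau>(2) by (intro real_le_rsqrt) (simp add: power_mult_distrib)
      from mult_left_mono[OF this, of "sqrt L"] show ?thesis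
        using L by (simp add: norm_0_h_1_def real_sqrt_mult mult_ac)
    qed
    also have "\<dots> \<le> sqrt (T * L) * (c * (\<tau> + h\<^sup>2))"
      using N1 assms(5) L by (intro mult_left_mono) auto
    finally have N2: "norm_0'_h_inf M N \<tau> E \<le> sqrt (T * L) * c * (\<tau> + h\<^sup>2)" by (simp add: mult.assoc)
    have pos: "\<tau> + h\<^sup>2 > 0" using \<tau> by (simp add: add_pos_nonneg)
    show "norm_0'_h_inf M N \<tau> (fd_error p G a M h \<tau> Gh) < (sqrt (T * L) * c + 1) * (\<tau> + h\<^sup>2)"
      by (rule le_less_trans[OF N2[unfolded E_def] mult_strict_right_mono[OF _ pos]]) simp
    show "norm_0_h_1 M N h \<tau> (fd_error p G a M h \<tau> Gh) < (c + 1) * (\<tau> + h\<^sup>2)"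
      by (rule le_less_trans[OF N1[unfolded E_def] mult_strict_right_mono[OF _ pos]]) simp
  qed
qed

end
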